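(* Let $q_j, \tilde q_j \in W_2^{j-1}(0,\pi)$, $j=0,1$, be complex-valued, and let $\{\lambda_n, M_n\}_{n\in\mathbb Z_0}$ and $\{\tilde\lambda_n,\tilde M_n\}_{n\in\mathbb Z_0}$ be the spectral data of the problems $L(q_0,q_1)$ and $L(\tilde q_0,\tilde q_1)$, respectively. If $\lambda_n=\tilde\lambda_n$ and $M_n=\tilde M_n$ for all $n\in\mathbb Z_0$, then $q_j=\tilde q_j$ in $W_2^{j-1}(0,\pi)$, $j=0,1$. Thus, the spectral data $\{\lambda_n,M_n\}_{n\in\mathbb Z_0}$ of the problem $L(q_0,q_1)$ uniquely specify the potentials $q_j$, $j=0,1$.
   Context: Notation: $\mathbb Z_0=\mathbb Z\setminus\{0\}$; $W_2^{0}(0,\pi)=L_2(0,\pi)$; $W_2^{-1}(0,\pi)$ is the class of distributional derivatives $\sigma'$ of functions $\sigma\in L_2(0,\pi)$. The problem $L(q_0,q_1)$. For complex-valued $q_1\in L_2(0,\pi)$ and $q_0=\sigma'$, $\sigma\in L_2(0,\pi)$, $L(q_0,q_1)$ is the boundary value problem $-y''+(2\lambda q_1(x)+q_0(x))y=\lambda^2y$, $x\in(0,\pi)$, $y(0)=y(\pi)=0$, with spectral parameter $\lambda$. The equation is understood as $-(y^{[1]})'-\sigma y^{[1]}-\sigma^2y+2\lambda q_1y=\lambda^2y$ with the quasi-derivative $y^{[1]}:=y'-\sigma y$ and $y,y^{[1]}\in AC[0,\pi]$. Let $S(x,\lambda)$ be the solution with $S(0,\lambda)=0$, $S^{[1]}(0,\lambda)=1$.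 The eigenvalues, counted with multiplicities, are the zeros of the entire function $\Delta(\lambda)=S(\pi,\lambda)$; they form a sequence $\{\lambda_n\}_{n\in\mathbb Z_0}$ with $\lambda_n=n+\omega_0+\varkappa_n$, $\{\varkappa_n\}\in l_2$, $\omega_0=\frac1\pi\int_0^\pi q_1(t)\,dt$. Put $\mathbb S=\{n\in\mathbb Z_0:\ \lambda_k\ne\lambda_n\ \forall k<n\}$ and $m_n=\#\{k\in\mathbb Z_0:\lambda_k=\lambda_n\}$. Assumption $(\mathcal O)$ on the numbering: $\lambda_n\ne\lambda_k$ for $nk<0$, and $\lambda_n=\lambda_{n+1}=\dots=\lambda_{n+m_n-1}$ for $n\in\mathbb S$. The eigenvalues of both problems are numbered according to $(\mathcal O)$. Weyl function and spectral data. Let $\Phi(x,\lambda)$ be the solution of the equation with $\Phi(0,\lambda)=1$, $\Phi(\pi,\lambda)=0$. The Weyl function is $M(\lambda):=\Phi^{[1]}(0,\lambda)$; it is meromorphic with poles $\lambda_n$, $n\in\mathbb S$, of multiplicities $m_n$. Put $M_{n+\nu}:=\operatorname{Res}_{\lambda=\lambda_n}(\lambda-\lambda_n)^\nu M(\lambda)$, $n\in\mathbb S$, $0\le\nu\le m_n-1$. The collection $\{\lambda_n,M_n\}_{n\in\mathbb Z_0}$ is called the spectral data of $L(q_0,q_1)$ (the additive constant in the choice of $\sigma$ does not affect it). *)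

theory Defs
  imports "HOL-Complex_Analysis.Complex_Analysis"
begin

definition L2_0pi :: "(real \<Rightarrow> complex) set" where
  "L2_0pi = {f. f \<in> borel_measurable (lebesgue_on {0<..<pi}) \<and>
                integrable (lebesgue_on {0<..<pi}) (\<lambda>x. (cmod (f x))\<^sup>2)}"

(* The space D(0,pi) of infinitely differentiable functions whose support is a compact
   subset of the open interval, extended by zero to the real line. *)
definition test_functions :: "(real \<Rightarrow> complex) set" where
  "test_functions =
     {\<phi>. (\<forall>k x. (((\<lambda>g t. vector_derivative g (at t)) ^^ k) \<phi>) differentiable (at x)) \<and>
          (\<exists>a b. 0 < a \<and> a < b \<and> b < pi \<and> (\<forall>x. x \<notin> {a..b} \<longrightarrow> \<phi> x = 0))}"

(* A distribution on (0,pi) is represented by a functional of which only the values on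
   test functions matter; two distributions are equal iff they agree there. *)
type_synonym distribution = "(real \<Rightarrow> complex) \<Rightarrow> complex"

definition distr_deriv :: "(real \<Rightarrow> complex) \<Rightarrow> distribution" where
  "distr_deriv \<sigma> \<phi> = - (LINT x|lebesgue_on {0<..<pi}. \<sigma> x * vector_derivative \<phi> (at x))"

definition distr_eq :: "distribution \<Rightarrow> distribution \<Rightarrow> bool" where
  "distr_eq q q' \<longleftrightarrow> (\<forall>\<phi>\<in>test_functions. q \<phi> = q' \<phi>)"

definition W2_minus1 :: "distribution set" where
  "W2_minus1 = {q. \<exists>\<sigma>\<in>L2_0pi. distr_eq q (distr_deriv \<sigma>)}"

definition abs_continuous_on_Icc :: "real \<Rightarrow> real \<Rightarrow> (real \<Rightarrow> complex) \<Rightarrow> bool" where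
  "abs_continuous_on_Icc a b f \<longleftrightarrow>
     (\<forall>\<epsilon>>0. \<exists>\<delta>>0. \<forall>I :: (real \<times> real) set.
        finite I \<and> (\<forall>(s, t)\<in>I. a \<le> s \<and> s < t \<and> t \<le> b) \<and>
        pairwise (\<lambda>(s, t) (u, v). {s<..<t} \<inter> {u<..<v} = {}) I \<and>
        (\<Sum>(s, t)\<in>I. t - s) < \<delta>
        \<longrightarrow> (\<Sum>(s, t)\<in>I. cmod (f t - f s)) < \<epsilon>)"

(* y1 is the absolutely continuous representative of y' - sigma y. *)
definition is_quasi_derivative ::
  "(real \<Rightarrow> complex) \<Rightarrow> (real \<Rightarrow> complex) \<Rightarrow> (real \<Rightarrow> complex) \<Rightarrow> bool" where
  "is_quasi_derivative \<sigma> y y1 \<longleftrightarrow>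
     abs_continuous_on_Icc 0 pi y \<and> abs_continuous_on_Icc 0 pi y1 \<and>
     (AE x in lebesgue_on {0<..<pi}.
        \<exists>y'. (y has_vector_derivative y') (at x) \<and> y1 x = y' - \<sigma> x * y x)"

definition is_solution ::
  "(real \<Rightarrow> complex) \<Rightarrow> (real \<Rightarrow> complex) \<Rightarrow> complex \<Rightarrow> (real \<Rightarrow> complex) \<Rightarrow> (real \<Rightarrow> complex) \<Rightarrow> bool"
where
  "is_solution \<sigma> q1 \<mu> y y1 \<longleftrightarrow>
     is_quasi_derivative \<sigma> y y1 \<and>
     (AE x in lebesgue_on {0<..<pi}.
        \<exists>d. (y1 has_vector_derivative d) (at x) \<and>
            - d - \<sigma> x * y1 x - (\<sigma> x)\<^sup>2 * y x + 2 * \<mu> * q1 x * y x = \<mu>\<^sup>2 * y x)"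

definition sol_S ::
  "(real \<Rightarrow> complex) \<Rightarrow> (real \<Rightarrow> complex) \<Rightarrow> real \<Rightarrow> complex \<Rightarrow> complex" where
  "sol_S \<sigma> q1 x \<mu> = (THE v. \<exists>y y1. is_solution \<sigma> q1 \<mu> y y1 \<and> y 0 = 0 \<and> y1 0 = 1 \<and> v = y x)"

definition char_fun :: "(real \<Rightarrow> complex) \<Rightarrow> (real \<Rightarrow> complex) \<Rightarrow> complex \<Rightarrow> complex" where
  "char_fun \<sigma> q1 \<mu> = sol_S \<sigma> q1 pi \<mu>"

(* Unspecified when \<mu> is an eigenvalue; these are the poles. *)
definition Weyl_fun :: "(real \<Rightarrow> complex) \<Rightarrow> (real \<Rightarrow> complex) \<Rightarrow> complex \<Rightarrow> complex" where
  "Weyl_fun \<sigma> q1 \<mu> = (THE v. \<exists>y y1. is_solution \<sigma> q1 \<mu> y y1 \<and> y 0 = 1 \<and> y pi = 0 \<and> v = y1 0)"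

definition Z0 :: "int set" where
  "Z0 = UNIV - {0}"

(* Sequences indexed by Z0 are functions on int whose value at 0 is irrelevant. *)
definition index_mult :: "(int \<Rightarrow> complex) \<Rightarrow> int \<Rightarrow> nat" where
  "index_mult lam n = card {k \<in> Z0. lam k = lam n}"

definition first_indices :: "(int \<Rightarrow> complex) \<Rightarrow> int set" where
  "first_indices lam = {n \<in> Z0. \<forall>k\<in>Z0. k < n \<longrightarrow> lam k \<noteq> lam n}"

definition mean_omega0 :: "(real \<Rightarrow> complex) \<Rightarrow> complex" where
  "mean_omega0 q1 = 1 / of_real pi * (LINT t|lebesgue_on {0<..<pi}. q1 t)"

definition eigenvalue_sequence ::
  "(real \<Rightarrow> complex) \<Rightarrow> (real \<Rightarrow> complex) \<Rightarrow> (int \<Rightarrow> complex) \<Rightarrow> bool" where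
  "eigenvalue_sequence \<sigma> q1 lam \<longleftrightarrow>
     lam ` Z0 = {\<mu>. char_fun \<sigma> q1 \<mu> = 0} \<and>
     (\<forall>n\<in>Z0. finite {k \<in> Z0. lam k = lam n} \<and>
             int (index_mult lam n) = zorder (char_fun \<sigma> q1) (lam n)) \<and>
     (\<lambda>n. (cmod (lam n - of_int n - mean_omega0 q1))\<^sup>2) summable_on Z0"

(* In the second clause n + j never hits the index 0: by the first clause, the indices k with
   lam k = lam n all have the sign of n, and n is the smallest of them. *)
definition assumption_O :: "(int \<Rightarrow> complex) \<Rightarrow> bool" where
  "assumption_O lam \<longleftrightarrow>
     (\<forall>n\<in>Z0. \<forall>k\<in>Z0. n * k < 0 \<longrightarrow> lam n \<noteq> lam k) \<and>
     (\<forall>n\<in>first_indices lam. \<forall>j<index_mult lam n. lam (n + int j) = lam n)"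

definition weight_sequence ::
  "(real \<Rightarrow> complex) \<Rightarrow> (real \<Rightarrow> complex) \<Rightarrow> (int \<Rightarrow> complex) \<Rightarrow> (int \<Rightarrow> complex) \<Rightarrow> bool" where
  "weight_sequence \<sigma> q1 lam M \<longleftrightarrow>
     (\<forall>n\<in>first_indices lam. \<forall>\<nu><index_mult lam n.
        M (n + int \<nu>) = residue (\<lambda>\<mu>. (\<mu> - lam n) ^ \<nu> * Weyl_fun \<sigma> q1 \<mu>) (lam n))"

(* Replacing \<sigma> by \<sigma> + c leaves sol_S unchanged and shifts Weyl_fun by -c, so the residues do not
   depend on the choice of the primitive \<sigma> of q0. *)
definition spectral_data ::
  "distribution \<Rightarrow> (real \<Rightarrow> complex) \<Rightarrow> (int \<Rightarrow> complex) \<Rightarrow> (int \<Rightarrow> complex) \<Rightarrow> bool" where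
  "spectral_data q0 q1 lam M \<longleftrightarrow>
     (\<exists>\<sigma>\<in>L2_0pi. distr_eq q0 (distr_deriv \<sigma>) \<and>
        eigenvalue_sequence \<sigma> q1 lam \<and> assumption_O lam \<and> weight_sequence \<sigma> q1 lam M)"

end

theory Submission
  imports Defs
begin

text \<open>
  The proof is a method of spectral mappings. Write \<open>S\<close>, \<open>C\<close> for the fundamental solutions and
  \<open>S'\<close>, \<open>C'\<close> for those of the second problem. The Weyl functions \<open>- C pi / S pi\<close> and
  \<open>- C' pi / S' pi\<close> have equal poles and equal principal parts, hence differ by an entire function
  \<open>h\<close>; dividing out the eigenvalues, whose counting function is at most linear, shows that \<open>h\<close>
  has order at most \<open>3/2\<close>. For fixed \<open>x\<close> the entire function
  \<open>S x * C' x - C x * S' x + h * S x * S' x\<close> equals \<open>S \<Phi>' - \<Phi> S'\<close> with the Weyl solutions \<open>\<Phi>\<close>,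
  \<open>\<Phi>'\<close>, which tends to \<open>0\<close> along the four diagonals, and so vanishes by Phragmen-Lindeloef.
  Differentiating this identity in \<open>x\<close> and using the Wronskian gives \<open>S\<^sup>2 = S'\<^sup>2\<close> for all \<open>x\<close> and
  all values of the spectral parameter. Consequently \<open>S\<close> solves both equations wherever it does not
  vanish, and comparing the equations at two values of the parameter yields \<open>q1 = q1'\<close> and
  that \<open>\<sigma> - \<sigma>'\<close> is constant.
\<close>

section \<open>Absolutely continuous functions and the Lebesgue integral\<close>

text \<open>The residues determine the Weyl function only up to an entire function \<open>h\<close>.
  Instead of bounding the Weyl functions all over the plane away from their poles, the argument uses
  a lower bound of \<open>S\<close> along rays off the real axis; the price is an a priori growth
  bound for \<open>h\<close>, obtained by division. The exponent 3/2 has room on both sides: above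
  1, because dividing out a linear number of zeros costs a factor of size
  \<open>exp (R * ln R)\<close>, and below 2, because the diagonals cut the plane into quarter
  planes, where Phragmen-Lindeloef admits orders below 2. The function \<open>h\<close> is never
  identified; it is carried along and eliminated after differentiation in \<open>x\<close>. This
  elimination is quadratic and fixes \<open>S\<close> only up to sign, which is harmless since
  logarithmic derivatives do not see the sign. As \<sigma> is merely square integrable, derivatives
  exist only almost everywhere, so each differential identity is read off from absolutely continuous
  functions, and pointwise conclusions come back through continuity. One value of the spectral
  parameter only ties \<open>q1 - q1'\<close> to \<open>\<sigma> - \<sigma>'\<close>; a second value
  separates them.\<close>

abbreviation nonoverlapping :: "(real \<times> real) set \<Rightarrow> bool" where
  "nonoverlapping I \<equiv> pairwise (\<lambda>(s, t) (u, v). {s<..<t} \<inter> {u<..<v} = {}) I"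

abbreviation small_system :: "real \<Rightarrow> real \<Rightarrow> real \<Rightarrow> (real \<times> real) set \<Rightarrow> bool" where
  "small_system a b \<delta> I \<equiv> finite I \<and> (\<forall>(s, t)\<in>I. a \<le> s \<and> s < t \<and> t \<le> b) \<and>
     nonoverlapping I \<and> (\<Sum>(s, t)\<in>I. t - s) < \<delta>"

section \<open>Lebesgue differentiation and the fundamental theorem of calculus\<close>

text \<open>Lebesgue differentiation for gauge integrals. \<open>E n\<close> collects the points
  that have arbitrarily short intervals around them on which the average of \<open>g\<close> is off
  by more than \<open>1 / Suc n\<close>. A disjoint Vitali subfamily of such intervals is a tagged
  partial division, so Henstock's lemma makes its total length, and with it the outer measure of
  \<open>E n\<close>, as small as desired.\<close>

lemma integral_derivative_ae:
  fixes g :: "real \<Rightarrow> complex"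
  assumes g: "g integrable_on {a..b}"
  shows "negligible {x \<in> {a<..<b}. \<not> ((\<lambda>x. integral {a..x} g) has_vector_derivative g x) (at x)}"
proof -
  let ?err = "\<lambda>u v x. norm ((v - u) *\<^sub>R g x - integral {u..v} g)"
  define E where "E n = {x \<in> {a<..<b}. \<forall>d>0. \<exists>u v. a \<le> u \<and> u \<le> x \<and> x \<le> v \<and> v \<le> b \<and> u < v \<and> v - u < d \<and>
     ?err u v x > (v - u) / real (Suc n)}" for n
  have negE: "negligible (E n)" for n
    unfolding negligible_outer_le
  proof (intro allI impI)
    fix e :: real assume e: "e > 0"
    \<comment> \<open>The 5 pays for the enlargement of the Vitali balls, \<open>Suc n\<close> for
      the relative defect in \<open>E n\<close>.\<close>
    define e' where "e' = e / (5 * real (Suc n))"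
    have e': "e' > 0" using e by (simp add: e'_def)
    obtain \<gamma> where \<gamma>: "gauge \<gamma>" and
      fine: "\<And>p. \<lbrakk>p tagged_partial_division_of (cbox a b); \<gamma> fine p\<rbrakk> \<Longrightarrow>
             sum (\<lambda>(x,k). norm(measure lborel k *\<^sub>R g x - integral k g)) p < e'"
      using Henstock_lemma[OF g[folded box_real(2)] e'] by blast
    \<comment> \<open>Vitali's lemma speaks of balls, so a tagged interval is indexed by
      \<open>(u, v, x)\<close> and described by its centre \<open>c\<close> and radius
      \<open>r\<close>; \<open>v - u < 1\<close> keeps the radii bounded, and the condition on
      \<gamma> makes the subfamily fine.\<close>
    define K where "K = {(u,v,x). x \<in> E n \<and> a \<le> u \<and> u \<le> x \<and> x \<le> v \<and> v \<le> b \<and> u < v \<and> v - u < 1 \<and>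
       {u..v} \<subseteq> \<gamma> x \<and> ?err u v x > (v - u) / real (Suc n)}"
    define c where "c = (\<lambda>(u::real,v::real,x::real). (u + v) / 2)"
    define r where "r = (\<lambda>(u::real,v::real,x::real). (v - u) / 2)"
    have cb: "cball (c (u,v,x)) (r (u,v,x)) = {u..v}" for u v x
      by (auto simp: c_def r_def cball_eq_atLeastAtMost field_simps)
    have cov: "E n \<subseteq> (\<Union>i\<in>K. cball (c i) (r i))"
    proof
      fix x assume x: "x \<in> E n"
      obtain d where d: "d > 0" "ball x d \<subseteq> \<gamma> x"
        using \<gamma> by (meson gauge_def open_contains_ball)
      have "min d 1 > 0" using d by simp
      then obtain u v where uv: "a \<le> u \<and> u \<le> x \<and> x \<le> v \<and> v \<le> b \<and> u < v \<and> v - u < min d 1 \<and>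
         ?err u v x > (v - u) / real (Suc n)"
        using x unfolding E_def by blast
      have "{u..v} \<subseteq> ball x d" using uv by (auto simp: dist_real_def)
      hence "(u,v,x) \<in> K" using uv x d unfolding K_def by auto
      moreover have "x \<in> cball (c (u,v,x)) (r (u,v,x))" unfolding cb using uv by auto
      ultimately show "x \<in> (\<Union>i\<in>K. cball (c i) (r i))" by blast
    qed
    have r01: "0 < r i \<and> r i \<le> 1" if "i \<in> K" for i
      using that unfolding K_def r_def by auto
    obtain C where C: "countable C" "C \<subseteq> K"
        "pairwise (\<lambda>i j. disjnt (cball (c i) (r i)) (cball (c j) (r j))) C"
        "E n \<subseteq> (\<Union>i\<in>C. cball (c i) (5 * r i))"
      using Vitali_covering_lemma_cballs[OF cov r01] by blast
    have fin: "(\<Sum>i\<in>D. measure lebesgue (cball (c i) (5 * r i))) \<le> e" if D: "D \<subseteq> C" "finite D" for D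
    proof -
      define p where "p = (\<lambda>(u::real,v::real,x::real). (x, {u..v})) ` D"
      have inj: "inj_on (\<lambda>(u::real,v::real,x::real). (x, {u..v})) D"
        using D C(2) unfolding K_def inj_on_def by auto
      have part: "p tagged_partial_division_of (cbox a b)"
        unfolding tagged_partial_division_of_def
      proof (intro conjI allI impI)
        show "finite p" using D p_def by auto
      next
        fix x k assume "(x,k) \<in> p"
        then obtain u v where uv: "(u,v,x) \<in> D" "k = {u..v}" unfolding p_def by auto
        hence K: "(u,v,x) \<in> K" using D C by blast
        show "x \<in> k" "k \<subseteq> cbox a b" using K uv unfolding K_def by auto
        show "\<exists>a b. k = cbox a b" using uv(2) box_real(2) by blast
      next
        fix x1 k1 x2 k2 assume A: "(x1, k1) \<in> p \<and> (x2, k2) \<in> p \<and> (x1, k1) \<noteq> (x2, k2)"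
        then obtain u1 v1 u2 v2 where uv: "(u1,v1,x1) \<in> D" "k1 = {u1..v1}" "(u2,v2,x2) \<in> D" "k2 = {u2..v2}"
          unfolding p_def by auto
        have "(u1,v1,x1) \<noteq> (u2,v2,x2)" using A uv by auto
        hence "disjnt (cball (c (u1,v1,x1)) (r (u1,v1,x1))) (cball (c (u2,v2,x2)) (r (u2,v2,x2)))"
          using pairwiseD[OF C(3)] D uv(1,3) by blast
        hence "disjnt k1 k2" unfolding cb uv .
        thus "interior k1 \<inter> interior k2 = {}" using interior_subset unfolding disjnt_def by blast
      qed
      have fp: "\<gamma> fine p" unfolding fine_def p_def using D C(2) unfolding K_def by auto
      have "(\<Sum>i\<in>D. measure lebesgue (cball (c i) (5 * r i))) = (\<Sum>(u,v,x)\<in>D. 5 * (v - u))"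
      proof (rule sum.cong, simp, clarify)
        fix u v x assume "(u,v,x) \<in> D"
        hence "u < v" using D C(2) unfolding K_def by auto
        thus "measure lebesgue (cball (c (u, v, x)) (5 * r (u, v, x))) = 5 * (v - u)"
          by (simp add: cball_eq_atLeastAtMost c_def r_def field_simps)
      qed
      also have "\<dots> \<le> (\<Sum>(u,v,x)\<in>D. 5 * real (Suc n) * ?err u v x)"
      proof (rule sum_mono, clarify)
        fix u v x assume "(u,v,x) \<in> D"
        hence "(u,v,x) \<in> K" using D C by blast
        hence "?err u v x > (v - u) / real (Suc n)" unfolding K_def by auto
        hence "(v - u) \<le> real (Suc n) * ?err u v x"
          by (simp add: field_simps del: of_nat_Suc)
        thus "5 * (v - u) \<le> 5 * real (Suc n) * ?err u v x"
          unfolding mult.assoc by (rule mult_left_mono) simp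
      qed
      also have "\<dots> = 5 * real (Suc n) * (\<Sum>(u,v,x)\<in>D. ?err u v x)"
        by (simp add: sum_distrib_left case_prod_unfold)
      also have "(\<Sum>(u,v,x)\<in>D. ?err u v x) =
          sum (\<lambda>(x,k). norm(measure lborel k *\<^sub>R g x - integral k g)) p"
        unfolding p_def
      proof (subst sum.reindex[OF inj], rule sum.cong, simp, clarify)
        fix u v x assume "(u,v,x) \<in> D"
        hence "u < v" using D C(2) unfolding K_def by auto
        thus "?err u v x = ((\<lambda>(x,k). norm(measure lborel k *\<^sub>R g x - integral k g)) \<circ> (\<lambda>(u, v, x). (x, {u..v}))) (u, v, x)"
          by simp
      qed
      also have "5 * real (Suc n) * \<dots> \<le> 5 * real (Suc n) * e'"
        using fine[OF part fp] by (intro mult_left_mono) auto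
      also have "\<dots> = e" by (simp add: e'_def)
      finally show ?thesis .
    qed
    have finU: "measure lebesgue (\<Union>i\<in>D. cball (c i) (5 * r i)) \<le> e" if "D \<subseteq> C" "finite D" for D
      using order_trans[OF measure_UNION_le[OF that(2)] fin[OF that]] by simp
    have "(\<Union>i\<in>C. cball (c i) (5 * r i)) \<in> lmeasurable \<and> measure lebesgue (\<Union>i\<in>C. cball (c i) (5 * r i)) \<le> e"
    proof (intro conjI)
      show "(\<Union>i\<in>C. cball (c i) (5 * r i)) \<in> lmeasurable"
        by (rule fmeasurable_UN_bound[OF C(1), where B=e]) (use finU in auto)
      show "measure lebesgue (\<Union>i\<in>C. cball (c i) (5 * r i)) \<le> e"
        by (rule measure_UN_bound[OF C(1)]) (use finU in auto)
    qed
    thus "\<exists>T. E n \<subseteq> T \<and> T \<in> lmeasurable \<and> measure lebesgue T \<le> e" using C(4) by blast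
  qed
  have "{x \<in> {a<..<b}. \<not> ((\<lambda>x. integral {a..x} g) has_vector_derivative g x) (at x)} \<subseteq> (\<Union>n. E n)"
  proof
    fix x assume x: "x \<in> {x \<in> {a<..<b}. \<not> ((\<lambda>x. integral {a..x} g) has_vector_derivative g x) (at x)}"
    define F where "F = (\<lambda>x. integral {a..x} g)"
    have comb: "F v - F u = integral {u..v} g" if "a \<le> u" "u \<le> v" "v \<le> b" for u v
    proof -
      have "g integrable_on {a..v}" using g that by (meson integrable_on_subinterval atLeastatMost_subset_iff order_refl)
      from Henstock_Kurzweil_Integration.integral_combine[OF that(1,2) this] show ?thesis unfolding F_def by (simp add: algebra_simps)
    qed
    show "x \<in> (\<Union>n. E n)"
    proof (rule ccontr)
      assume nE: "x \<notin> (\<Union>n. E n)"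
      have "(F has_vector_derivative g x) (at x)"
        unfolding has_vector_derivative_def has_derivative_within_alt
      proof (intro conjI allI impI)
        show "bounded_linear (\<lambda>h. h *\<^sub>R g x)" by (rule bounded_linear_scaleR_left)
        fix e :: real assume "e > 0"
        then obtain n where n: "inverse (real (Suc n)) < e" using reals_Archimedean by blast
        from nE have "x \<notin> E n" by blast
        hence "\<not> (\<forall>d>0. \<exists>u v. a \<le> u \<and> u \<le> x \<and> x \<le> v \<and> v \<le> b \<and> u < v \<and> v - u < d \<and>
          ?err u v x > (v - u) / real (Suc n))"
          using x unfolding E_def by blast
        then obtain d where d0: "d > 0" "\<not> (\<exists>u v. a \<le> u \<and> u \<le> x \<and> x \<le> v \<and> v \<le> b \<and> u < v \<and> v - u < d \<and>
          ?err u v x > (v - u) / real (Suc n))" by blast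
        have d: "d > 0" "\<And>u v. a \<le> u \<Longrightarrow> u \<le> x \<Longrightarrow> x \<le> v \<Longrightarrow> v \<le> b \<Longrightarrow> u < v \<Longrightarrow> v - u < d \<Longrightarrow>
           ?err u v x \<le> (v - u) / real (Suc n)"
          using d0 not_less by blast+
        define d' where "d' = min d (min (x - a) (b - x))"
        have "d' > 0" using d x by (auto simp: d'_def)
        moreover have "norm (F y - F x - (y - x) *\<^sub>R g x) \<le> e * norm (y - x)" if y: "norm (y - x) < d'" for y
        proof (cases y x rule: linorder_cases)
          case less
          have "norm ((x - y) *\<^sub>R g x - integral {y..x} g) \<le> (x - y) / real (Suc n)"
            using y less x by (intro d(2)) (auto simp: d'_def)
          moreover have "integral {y..x} g = F x - F y" using comb[of y x] y less x by (auto simp: d'_def)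
          moreover have "(x - y) / real (Suc n) \<le> e * (x - y)" using n less
            by (metis diff_gt_0_iff_gt divide_inverse less_eq_real_def mult.commute mult_right_mono)
          moreover have "norm (F y - F x - (y - x) *\<^sub>R g x) = norm ((x - y) *\<^sub>R g x - (F x - F y))"
            by (rule arg_cong[where f=norm]) (simp add: algebra_simps)
          ultimately show ?thesis using less by simp
        next
          case greater
          have "norm ((y - x) *\<^sub>R g x - integral {x..y} g) \<le> (y - x) / real (Suc n)"
            using y greater x by (intro d(2)) (auto simp: d'_def)
          moreover have "integral {x..y} g = F y - F x" using comb[of x y] y greater x by (auto simp: d'_def)
          moreover have "(y - x) / real (Suc n) \<le> e * (y - x)" using n greater
            by (metis diff_gt_0_iff_gt divide_inverse less_eq_real_def mult.commute mult_right_mono)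
          moreover have "norm (F y - F x - (y - x) *\<^sub>R g x) = norm ((y - x) *\<^sub>R g x - (F y - F x))"
            by (simp add: norm_minus_commute)
          ultimately show ?thesis using greater by simp
        qed simp
        ultimately show "\<exists>d>0. \<forall>y\<in>UNIV. norm (y - x) < d \<longrightarrow> norm (F y - F x - (y - x) *\<^sub>R g x) \<le> e * norm (y - x)"
          by blast
      qed
      thus False using x unfolding F_def by blast
    qed
  qed
  moreover have "negligible (\<Union>n. E n)" by (intro negligible_countable_Union) (use negE in auto)
  ultimately show ?thesis using negligible_subset by blast
qed

text \<open>The exceptional set carries no increment of \<open>f\<close>: intervals tagged in the
  null set are confined to an open set of measure below the \<delta> of absolute continuity, so the
  increments over them sum to little. At the other tags differentiability controls the error by
  \<open>e1\<close> times the length.\<close>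

lemma abs_continuous_has_integral:
  fixes f g :: "real \<Rightarrow> complex"
  assumes ab: "a \<le> b" and f: "abs_continuous_on_Icc a b f" and N: "negligible N"
    and der: "\<And>x. x \<in> {a<..<b} - N \<Longrightarrow> (f has_vector_derivative g x) (at x)"
  shows "(g has_integral (f b - f a)) {a..b}"
proof -
  \<comment> \<open>The endpoints join the null set because the derivative is given in the open
    interval only. Setting the integrand to 0 on \<open>N'\<close> leaves nothing but increments of
    \<open>f\<close> at the tags there.\<close>
  define N' where "N' = N \<union> {a,b}"
  have N': "negligible N'" using N unfolding N'_def by (intro negligible_Un) auto
  define g0 where "g0 = (\<lambda>x. if x \<in> N' then 0 else g x)"
  have "(g0 has_integral (f b - f a)) {a..b}"
    unfolding has_integral_real
  proof (intro allI impI)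
    fix e :: real assume e: "e > 0"
    \<comment> \<open>Summed over a division this contributes at most \<open>e / 3\<close>; the
      \<open>+ 1\<close> covers the case \<open>a = b\<close>.\<close>
    define e1 where "e1 = e / (3 * (b - a + 1))"
    have e1: "e1 > 0" using e ab by (simp add: e1_def)
    have "e / 3 > 0" using e by simp
    from f[unfolded abs_continuous_on_Icc_def, rule_format, OF this]
    obtain \<delta> where \<delta>: "\<delta> > 0" and AC: "\<And>I :: (real \<times> real) set.
        finite I \<Longrightarrow> (\<forall>(s, t)\<in>I. a \<le> s \<and> s < t \<and> t \<le> b) \<Longrightarrow>
        nonoverlapping I \<Longrightarrow>
        (\<Sum>(s, t)\<in>I. t - s) < \<delta> \<Longrightarrow> (\<Sum>(s, t)\<in>I. cmod (f t - f s)) < e/3"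
      by blast
    have "N' \<in> sets lebesgue" "emeasure lebesgue N' = 0" using N' negligible_iff_null_sets by auto
    then obtain U where U: "open U" "N' \<subseteq> U" "U - N' \<in> lmeasurable" "emeasure lebesgue (U - N') < ennreal \<delta>"
      using sets_lebesgue_outer_open[OF _ \<delta>] by metis
    have "negligible (U \<inter> N')" using N' by (simp add: negligible_Int)
    have UL: "U \<in> lmeasurable"
    proof -
      have "U = (U - N') \<union> (U \<inter> N')" by blast
      thus ?thesis using U(3) \<open>negligible (U \<inter> N')\<close> negligible_imp_measurable by (metis fmeasurable.Un)
    qed
    have "measure lebesgue U < \<delta>"
    proof -
      have "measure lebesgue U = measure lebesgue (U - N')"
        by (metis N' measure_Diff_null_set UL fmeasurableD negligible_iff_null_sets)
      also have "\<dots> < \<delta>" using U(3,4) \<delta> by (metis emeasure_eq_measure2 ennreal_less_iff measure_nonneg)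
      finally show ?thesis .
    qed
    have "\<exists>d>0. x \<in> {a..b} - N' \<longrightarrow> (\<forall>y. norm (y - x) < d \<longrightarrow> norm (f y - f x - (y - x) *\<^sub>R g x) \<le> e1 * norm (y - x))" for x
    proof (cases "x \<in> {a..b} - N'")
      case True
      hence "x \<in> {a<..<b} - N" by (auto simp: N'_def)
      from der[OF this] e1 show ?thesis
        unfolding has_vector_derivative_def has_derivative_within_alt by blast
    qed (auto intro: exI[of _ 1])
    then obtain d where d: "\<And>x. d x > 0" "\<And>x y. x \<in> {a..b} - N' \<Longrightarrow> norm (y - x) < d x \<Longrightarrow> norm (f y - f x - (y - x) *\<^sub>R g x) \<le> e1 * norm (y - x)"
      by metis
    define \<gamma> where "\<gamma> x = (if x \<in> N' then U else ball x (d x))" for x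
    have gau: "gauge \<gamma>" unfolding gauge_def \<gamma>_def using U d by auto
    have lt: "norm ((\<Sum>(x,k)\<in>p. measure lborel k *\<^sub>R g0 x) - (f b - f a)) < e"
      if p: "p tagged_division_of {a..b}" "\<gamma> fine p" for p
    proof -
      let ?T = "\<lambda>x k. measure lborel k *\<^sub>R g0 x - (f (Sup k) - f (Inf k))"
      have finp: "finite p" using p(1) by blast
      define p1 where "p1 = {(x,k) \<in> p. x \<in> N'}"
      define p2 where "p2 = {(x,k) \<in> p. x \<notin> N'}"
      have p12: "p = p1 \<union> p2" "p1 \<inter> p2 = {}" "finite p1" "finite p2"
        using finp unfolding p1_def p2_def by (auto intro: finite_subset[of _ p])
      have cb: "\<exists>s t. k = {s..t} \<and> s \<le> t \<and> x \<in> {s..t} \<and> a \<le> s \<and> t \<le> b" if xk: "(x,k) \<in> p" for x k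
      proof -
        obtain s t where st: "k = cbox s t" using tagged_division_ofD(4)[OF p(1) xk] by blast
        have "x \<in> k" "k \<subseteq> {a..b}" using tagged_division_ofD(2,3)[OF p(1) xk] by auto
        thus ?thesis using st by (intro exI[of _ s] exI[of _ t]) auto
      qed
      have tot: "(\<Sum>(x,k)\<in>p. f (Sup k) - f (Inf k)) = f b - f a"
        using additive_tagged_division_1[OF ab p(1), of f] by simp
      have totl: "(\<Sum>(x,k)\<in>p. Sup k - Inf k) = b - a"
        using additive_tagged_division_1[OF ab p(1), of "\<lambda>x. x"] by simp
      have eq: "(\<Sum>(x,k)\<in>p. measure lborel k *\<^sub>R g0 x) - (f b - f a) = (\<Sum>(x,k)\<in>p. ?T x k)"
        unfolding tot[symmetric] by (simp add: sum_subtractf case_prod_unfold)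
      also have "\<dots> = (\<Sum>(x,k)\<in>p1. ?T x k) + (\<Sum>(x,k)\<in>p2. ?T x k)"
        unfolding p12(1) by (rule sum.union_disjoint[OF p12(3,4,2)])
      finally have split: "(\<Sum>(x,k)\<in>p. measure lborel k *\<^sub>R g0 x) - (f b - f a) = \<dots>" .
      have b2: "norm (\<Sum>(x,k)\<in>p2. ?T x k) \<le> e / 3"
      proof -
        have "norm (\<Sum>(x,k)\<in>p2. ?T x k) \<le> (\<Sum>(x,k)\<in>p2. e1 * (Sup k - Inf k))"
        proof (rule sum_norm_le, clarify)
          fix x k assume xk: "(x,k) \<in> p2"
          hence xp: "(x,k) \<in> p" and xN: "x \<notin> N'" by (auto simp: p2_def)
          obtain s t where st: "k = {s..t}" "s \<le> t" "x \<in> {s..t}" "a \<le> s" "t \<le> b" using cb[OF xp] by blast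
          have "k \<subseteq> \<gamma> x" using p(2) xp unfolding fine_def by auto
          hence kb: "k \<subseteq> ball x (d x)" using xN by (simp add: \<gamma>_def)
          have "s \<in> k" "t \<in> k" using st by auto
          hence "t \<in> ball x (d x)" "s \<in> ball x (d x)" using kb by blast+
          hence "norm (t - x) < d x" "norm (s - x) < d x" by (auto simp: dist_real_def)
          moreover have "x \<in> {a..b} - N'" using st xN by auto
          ultimately have 1: "norm (f t - f x - (t - x) *\<^sub>R g x) \<le> e1 * (t - x)" "norm (f s - f x - (s - x) *\<^sub>R g x) \<le> e1 * (x - s)"
            using d(2)[of x t] d(2)[of x s] st by (auto simp: abs_if split: if_splits)
          have "norm (?T x k) = norm ((f s - f x - (s - x) *\<^sub>R g x) - (f t - f x - (t - x) *\<^sub>R g x))"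
            using st xN by (simp add: g0_def algebra_simps)
          also have "\<dots> \<le> e1 * (t - x) + e1 * (x - s)" using norm_triangle_ineq4 1 by (smt (verit, best))
          also have "\<dots> = e1 * (Sup k - Inf k)" using st by (simp add: algebra_simps)
          finally show "norm (?T x k) \<le> e1 * (Sup k - Inf k)" .
        qed
        also have "\<dots> \<le> (\<Sum>(x,k)\<in>p. e1 * (Sup k - Inf k))"
        proof (rule sum_mono2[OF finp])
          show "p2 \<subseteq> p" using p12 by blast
          fix z assume "z \<in> p - p2"
          then obtain x k where z: "z = (x,k)" "(x,k) \<in> p" by (cases z) auto
          obtain s t where st: "k = {s..t}" "s \<le> t" using cb[OF z(2)] by blast
          show "0 \<le> (case z of (x,k) \<Rightarrow> e1 * (Sup k - Inf k))" using z st e1 by simp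
        qed
        also have "\<dots> = e1 * (b - a)" unfolding totl[symmetric] by (simp add: sum_distrib_left case_prod_unfold)
        also have "\<dots> \<le> e1 * (b - a + 1)" using e1 by simp
        also have "\<dots> = e / 3" using ab e unfolding e1_def by (simp add: divide_simps)
        finally show ?thesis .
      qed
      have b1: "norm (\<Sum>(x,k)\<in>p1. ?T x k) < e / 3"
      proof -
        define p1' where "p1' = {(x,k) \<in> p1. Inf k < Sup k}"
        have fp1': "finite p1'" using p12(3) unfolding p1'_def by (auto intro: finite_subset[of _ p1])
        define J where "J = (\<lambda>(x::real,k). (Inf k :: real, Sup k :: real))"
        define I where "I = J ` p1'"
        have p1'D: "(x,k) \<in> p \<and> x \<in> N' \<and> k = {Inf k..Sup k} \<and> Inf k < Sup k \<and> a \<le> Inf k \<and> Sup k \<le> b" if "(x,k) \<in> p1'" for x k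
        proof -
          have xp: "(x,k) \<in> p" "x \<in> N'" "Inf k < Sup k" using that unfolding p1'_def p1_def by auto
          obtain s t where "k = {s..t}" "s \<le> t" "a \<le> s" "t \<le> b" using cb[OF xp(1)] by blast
          thus ?thesis using xp by simp
        qed
        have disj: "{Inf k<..<Sup k} \<inter> {Inf k'<..<Sup k'} = {}" if "(x,k) \<in> p1'" "(x',k') \<in> p1'" "(x,k) \<noteq> (x',k')" for x k x' k'
        proof -
          have "interior k \<inter> interior k' = {}"
            using tagged_division_ofD(5)[OF p(1)] p1'D[OF that(1)] p1'D[OF that(2)] that(3) by blast
          moreover have "interior k = {Inf k<..<Sup k}" "interior k' = {Inf k'<..<Sup k'}"
            using p1'D[OF that(1)] p1'D[OF that(2)] by (metis interior_atLeastAtMost_real)+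
          ultimately show ?thesis by simp
        qed
        have inj: "inj_on J p1'"
        proof (rule inj_onI, clarify)
          fix x k x' k' assume A: "(x,k) \<in> p1'" "(x',k') \<in> p1'" "J (x,k) = J (x',k')"
          show "x = x' \<and> k = k'"
          proof (rule ccontr)
            assume "\<not> (x = x' \<and> k = k')"
            hence "{Inf k<..<Sup k} \<inter> {Inf k'<..<Sup k'} = {}" using disj[OF A(1,2)] by auto
            moreover have "{Inf k<..<Sup k} = {Inf k'<..<Sup k'}" using A(3) by (simp add: J_def)
            moreover have "{Inf k<..<Sup k} \<noteq> {}" using p1'D[OF A(1)] by simp
            ultimately show False by auto
          qed
        qed
        have "(\<Sum>(x,k)\<in>p1. ?T x k) = (\<Sum>(x,k)\<in>p1'. - (f (Sup k) - f (Inf k)))"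
        proof (rule sum.mono_neutral_cong_right[OF p12(3)])
          show "p1' \<subseteq> p1" unfolding p1'_def by blast
          show "\<forall>i\<in>p1 - p1'. (case i of (x, k) \<Rightarrow> ?T x k) = 0"
          proof clarify
            fix x k assume xk: "(x,k) \<in> p1" "(x,k) \<notin> p1'"
            hence "(x,k) \<in> p" "x \<in> N'" by (auto simp: p1_def)
            then obtain s t where st: "k = {s..t}" "s \<le> t" using cb by blast
            moreover have "\<not> Inf k < Sup k" using xk by (auto simp: p1'_def)
            ultimately show "?T x k = 0" using \<open>x \<in> N'\<close> by (simp add: g0_def)
          qed
          show "(case z of (x, k) \<Rightarrow> ?T x k) = (case z of (x, k) \<Rightarrow> - (f (Sup k) - f (Inf k)))" if "z \<in> p1'" for z
            using that p1'D by (cases z) (auto simp: g0_def)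
        qed
        also have "norm \<dots> \<le> (\<Sum>(x,k)\<in>p1'. cmod (f (Sup k) - f (Inf k)))"
          by (rule sum_norm_le) (auto simp: norm_minus_commute)
        also have "\<dots> = (\<Sum>(s,t)\<in>I. cmod (f t - f s))"
          unfolding I_def by (subst sum.reindex[OF inj]) (auto simp: J_def intro!: sum.cong)
        also have "\<dots> < e / 3"
        proof (rule AC)
          show "finite I" using fp1' I_def by simp
          show "\<forall>(s,t)\<in>I. a \<le> s \<and> s < t \<and> t \<le> b" unfolding I_def J_def using p1'D by fastforce
          show "nonoverlapping I"
          proof (rule pairwiseI)
            fix y z assume A: "y \<in> I" "z \<in> I" "y \<noteq> z"
            obtain x k where xk: "(x,k) \<in> p1'" "y = J (x,k)" using A(1) unfolding I_def by auto
            obtain x' k' where xk': "(x',k') \<in> p1'" "z = J (x',k')" using A(2) unfolding I_def by auto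
            have "(x,k) \<noteq> (x',k')" using A(3) xk xk' by auto
            from disj[OF xk(1) xk'(1) this]
            show "(\<lambda>(s, t) (u, v). {s<..<t} \<inter> {u<..<v} = {}) y z"
              unfolding xk(2) xk'(2) J_def by simp
          qed
          have "(\<Sum>(s,t)\<in>I. t - s) = (\<Sum>(x,k)\<in>p1'. Sup k - Inf k)"
            unfolding I_def by (subst sum.reindex[OF inj]) (auto simp: J_def intro!: sum.cong)
          also have "\<dots> = (\<Sum>(x,k)\<in>p1'. measure lebesgue k)"
          proof (rule sum.cong, simp, clarify)
            fix x k assume "(x,k) \<in> p1'"
            from p1'D[OF this] show "Sup k - Inf k = measure lebesgue k" 
              by (metis content_real less_eq_real_def measure_lborel_Icc measure_completion borel_closed closed_atLeastAtMost sets_lborel)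
          qed
          also have "\<dots> = measure lebesgue (\<Union>z\<in>p1'. snd z)"
          proof -
            have "measure lebesgue (\<Union>z\<in>p1'. snd z) = (\<Sum>z\<in>p1'. measure lebesgue (snd z))"
            proof (rule measure_negligible_finite_Union_image[OF fp1'])
              show "snd z \<in> lmeasurable" if "z \<in> p1'" for z
              proof (cases z)
                case (Pair x k)
                have "snd z = {Inf k..Sup k}" using p1'D[of x k] that Pair by simp
                thus ?thesis by (metis lmeasurable_cbox box_real(2))
              qed
              show "pairwise (\<lambda>x y. negligible (snd x \<inter> snd y)) p1'"
              proof (rule pairwiseI)
                fix y y' assume A': "y \<in> p1'" "y' \<in> p1'" "y \<noteq> y'"
                obtain x k x' k' where yy: "y = (x,k)" "y' = (x',k')" by (cases y, cases y') auto
                have A: "(x,k) \<in> p1'" "(x',k') \<in> p1'" "(x, k) \<noteq> (x', k')" using A' yy by auto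
                have d: "{Inf k<..<Sup k} \<inter> {Inf k'<..<Sup k'} = {}" using disj[OF A(1,2)] A(3) by auto
                have "k \<inter> k' \<subseteq> {Inf k, Sup k, Inf k', Sup k'}"
                proof
                  fix z assume "z \<in> k \<inter> k'"
                  hence "z \<in> {Inf k..Sup k}" "z \<in> {Inf k'..Sup k'}" using p1'D[OF A(1)] p1'D[OF A(2)] by auto
                  moreover have "\<not> (z \<in> {Inf k<..<Sup k} \<and> z \<in> {Inf k'<..<Sup k'})" using d by blast
                  ultimately show "z \<in> {Inf k, Sup k, Inf k', Sup k'}" by auto
                qed
                moreover have "negligible {Inf k, Sup k, Inf k', Sup k'}" by (rule negligible_finite) simp
                ultimately show "negligible (snd y \<inter> snd y')" unfolding yy using negligible_subset by (metis snd_conv)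
              qed
            qed
            thus ?thesis by (simp add: case_prod_unfold)
          qed
          also have "\<dots> \<le> measure lebesgue U"
          proof (rule measure_mono_fmeasurable[OF _ _ UL])
            show "(\<Union>z\<in>p1'. snd z) \<subseteq> U"
            proof clarify
              fix x k y assume A: "(x,k) \<in> p1'" "y \<in> snd (x,k)"
              have "k \<subseteq> \<gamma> x" using p(2) p1'D[OF A(1)] unfolding fine_def by auto
              thus "y \<in> U" using A p1'D[OF A(1)] by (auto simp: \<gamma>_def)
            qed
            have "snd z \<in> sets lebesgue" if "z \<in> p1'" for z
            proof (cases z)
              case (Pair x k)
              have "snd z = {Inf k..Sup k}" using p1'D[of x k] that Pair by simp
              thus ?thesis by simp
            qed
            thus "(\<Union>z\<in>p1'. snd z) \<in> sets lebesgue" using fp1' by (intro sets.finite_UN) auto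
          qed
          also have "\<dots> < \<delta>" by fact
          finally show "(\<Sum>(s,t)\<in>I. t - s) < \<delta>" .
        qed
        finally show ?thesis .
      qed
      show ?thesis unfolding split
        by (rule le_less_trans[OF norm_triangle_ineq]) (use b1 b2 e in linarith)
    qed
    show "\<exists>\<gamma>. gauge \<gamma> \<and> (\<forall>p. p tagged_division_of {a..b} \<and> \<gamma> fine p \<longrightarrow>
        norm ((\<Sum>(x,k)\<in>p. measure lborel k *\<^sub>R g0 x) - (f b - f a)) < e)"
      by (rule exI[of _ \<gamma>], intro conjI allI impI gau) (rule lt, simp_all)
  qed
  thus ?thesis
    by (rule has_integral_spike[OF N', rotated]) (auto simp: g0_def)
qed

lemma AE_lebesgue_on_iff_negligible:
  fixes S :: "'a::euclidean_space set"
  assumes "S \<in> sets lebesgue"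
  shows "(AE x in lebesgue_on S. P x) \<longleftrightarrow> negligible {x \<in> S. \<not> P x}"
proof
  assume "AE x in lebesgue_on S. P x"
  then obtain N where N': "\<And>x. x \<in> space (lebesgue_on S) - N \<Longrightarrow> P x" and N: "N \<in> null_sets (lebesgue_on S)"
    by (rule AE_E3) blast
  have "negligible N" using N assms by (simp add: null_sets_restrict_space negligible_iff_null_sets)
  thus "negligible {x \<in> S. \<not> P x}" by (rule negligible_subset) (use N' in \<open>auto simp: space_restrict_space\<close>)
next
  assume "negligible {x \<in> S. \<not> P x}"
  hence "{x \<in> S. \<not> P x} \<in> null_sets (lebesgue_on S)" 
    using assms by (auto simp: null_sets_restrict_space negligible_iff_null_sets)
  thus "AE x in lebesgue_on S. P x" by (rule AE_I') auto
qed

lemma abs_continuous_on_subinterval: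
  assumes "abs_continuous_on_Icc a b f" "a \<le> c" "d \<le> b"
  shows "abs_continuous_on_Icc c d f"
  unfolding abs_continuous_on_Icc_def
proof (intro allI impI)
  fix e :: real assume "e > 0"
  from assms(1)[unfolded abs_continuous_on_Icc_def, rule_format, OF this]
  obtain \<delta> where \<delta>: "\<delta> > 0" "\<And>I. small_system a b \<delta> I \<Longrightarrow> (\<Sum>(s, t)\<in>I. cmod (f t - f s)) < e" by blast
  have "(\<Sum>(s, t)\<in>I. cmod (f t - f s)) < e" if "small_system c d \<delta> I" for I
    using that assms(2,3) by (intro \<delta>(2)) fastforce
  thus "\<exists>\<delta>>0. \<forall>I. small_system c d \<delta> I \<longrightarrow> (\<Sum>(s, t)\<in>I. cmod (f t - f s)) < e" using \<delta>(1) by blast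
qed

lemma abs_continuous_on_imp_continuous_on:
  assumes "abs_continuous_on_Icc a b f"
  shows "continuous_on {a..b} f"
  unfolding continuous_on_iff
proof (intro ballI allI impI)
  fix x e :: real assume x: "x \<in> {a..b}" and "e > 0"
  from assms[unfolded abs_continuous_on_Icc_def, rule_format, OF this(2)]
  obtain \<delta> where \<delta>: "\<delta> > 0" "\<And>I. small_system a b \<delta> I \<Longrightarrow> (\<Sum>(s, t)\<in>I. cmod (f t - f s)) < e" by blast
  have "dist (f y) (f x) < e" if y: "y \<in> {a..b}" "dist y x < \<delta>" for y
  proof (cases y x rule: linorder_cases)
    case less
    thus ?thesis using \<delta>(2)[of "{(y,x)}"] x y by (simp add: dist_norm norm_minus_commute)
  next
    case equal thus ?thesis using \<open>e > 0\<close> by simp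
  next
    case greater
    thus ?thesis using \<delta>(2)[of "{(x,y)}"] x y by (simp add: dist_norm norm_minus_commute)
  qed
  thus "\<exists>d>0. \<forall>x'\<in>{a..b}. dist x' x < d \<longrightarrow> dist (f x') (f x) < e" using \<delta>(1) by blast
qed

text \<open>Sums, products, conjugates, exponentials and quotients all reach absolute continuity
  through this one comparison of increments.\<close>

lemma abs_continuous_on_dominated:
  assumes f: "abs_continuous_on_Icc a b f" and g: "abs_continuous_on_Icc a b g"
    and h: "\<And>s t. a \<le> s \<Longrightarrow> s < t \<Longrightarrow> t \<le> b \<Longrightarrow> cmod (h t - h s) \<le> L * (cmod (f t - f s) + cmod (g t - g s))"
  shows "abs_continuous_on_Icc a b h"
  unfolding abs_continuous_on_Icc_def
proof (intro allI impI)
  fix e :: real assume e: "e > 0"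
  define L' where "L' = max L 1"
  define e' where "e' = e / (2 * L')"
  have "e' > 0" "L' > 0" using e by (auto simp: e'_def L'_def)
  from f[unfolded abs_continuous_on_Icc_def, rule_format, OF this(1)]
  obtain d1 where d1: "d1 > 0" "\<And>I. small_system a b d1 I \<Longrightarrow> (\<Sum>(s, t)\<in>I. cmod (f t - f s)) < e'" by blast
  from g[unfolded abs_continuous_on_Icc_def, rule_format, OF \<open>e' > 0\<close>]
  obtain d2 where d2: "d2 > 0" "\<And>I. small_system a b d2 I \<Longrightarrow> (\<Sum>(s, t)\<in>I. cmod (g t - g s)) < e'" by blast
  have "(\<Sum>(s, t)\<in>I. cmod (h t - h s)) < e" if I: "finite I" "(\<forall>(s, t)\<in>I. a \<le> s \<and> s < t \<and> t \<le> b)"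
        "nonoverlapping I" "(\<Sum>(s, t)\<in>I. t - s) < min d1 d2" for I
  proof -
    have "(\<Sum>(s, t)\<in>I. cmod (h t - h s)) \<le> (\<Sum>(s, t)\<in>I. L' * (cmod (f t - f s) + cmod (g t - g s)))"
    proof (rule sum_mono, clarify)
      fix s t assume "(s,t) \<in> I"
      hence "cmod (h t - h s) \<le> L * (cmod (f t - f s) + cmod (g t - g s))" using I(2) h by blast
      also have "\<dots> \<le> L' * (cmod (f t - f s) + cmod (g t - g s))" by (intro mult_right_mono) (auto simp: L'_def)
      finally show "cmod (h t - h s) \<le> L' * (cmod (f t - f s) + cmod (g t - g s))" .
    qed
    also have "\<dots> = L' * ((\<Sum>(s, t)\<in>I. cmod (f t - f s)) + (\<Sum>(s, t)\<in>I. cmod (g t - g s)))"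
      by (simp add: sum_distrib_left sum.distrib case_prod_unfold distrib_left)
    also have "\<dots> < L' * (e' + e')" using d1(2)[of I] d2(2)[of I] I \<open>L' > 0\<close> by (intro mult_strict_left_mono add_strict_mono) auto
    also have "\<dots> = e" using \<open>L' > 0\<close> by (simp add: e'_def field_simps)
    finally show ?thesis .
  qed
  moreover have "min d1 d2 > 0" using d1 d2 by simp
  ultimately show "\<exists>\<delta>>0. \<forall>I. small_system a b \<delta> I \<longrightarrow> (\<Sum>(s, t)\<in>I. cmod (h t - h s)) < e" by blast
qed

text \<open>At every point at most one of the open intervals is active, so the sum of the restricted
  integrands stays below \<open>r\<close>. Open intervals are used because closed ones may share
  endpoints.\<close>

lemma sum_integral_disjoint_le:
  fixes r :: "real \<Rightarrow> real"
  assumes r: "r integrable_on {a..b}" and r0: "\<And>x. x \<in> {a..b} \<Longrightarrow> r x \<ge> 0" and fin: "finite I"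
    and I: "\<forall>(s, t)\<in>I. a \<le> s \<and> s < t \<and> t \<le> b" 
    and disj: "nonoverlapping I"
  shows "(\<Sum>(s, t)\<in>I. integral {s..t} r) \<le> integral {a..b} r"
proof -
  have "((\<lambda>x. \<Sum>i\<in>I. (if x \<in> {fst i<..<snd i} then r x else 0)) has_integral (\<Sum>i\<in>I. integral {fst i..snd i} r)) {a..b}"
  proof (rule has_integral_sum[OF fin])
    fix i assume i: "i \<in> I"
    hence sub: "{fst i..snd i} \<subseteq> {a..b}" using I by (auto simp: case_prod_unfold)
    have "r integrable_on {fst i..snd i}" using r sub integrable_on_subinterval by blast
    hence "(r has_integral integral {fst i..snd i} r) {fst i..snd i}" by (rule integrable_integral)
    from has_integral_restrict_open_subinterval[OF this[folded box_real(2)] sub[folded box_real(2)]]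
    show "((\<lambda>x. if x \<in> {fst i<..<snd i} then r x else 0) has_integral integral {fst i..snd i} r) {a..b}"
      by simp
  qed
  moreover have "(r has_integral integral {a..b} r) {a..b}" using r by (rule integrable_integral)
  ultimately have "(\<Sum>i\<in>I. integral {fst i..snd i} r) \<le> integral {a..b} r"
  proof (rule has_integral_le)
    fix x assume x: "x \<in> {a..b}"
    show "(\<Sum>i\<in>I. (if x \<in> {fst i<..<snd i} then r x else 0)) \<le> r x"
    proof (cases "\<exists>i\<in>I. x \<in> {fst i<..<snd i}")
      case True
      then obtain i where i: "i \<in> I" "x \<in> {fst i<..<snd i}" by blast
      have "(\<Sum>j\<in>I. (if x \<in> {fst j<..<snd j} then r x else 0)) = (\<Sum>j\<in>I. (if j = i then r x else 0))"
      proof (rule sum.cong[OF refl])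
        fix j assume j: "j \<in> I"
        show "(if x \<in> {fst j<..<snd j} then r x else 0) = (if j = i then r x else 0)"
        proof (cases "j = i")
          case False
          have "{fst j<..<snd j} \<inter> {fst i<..<snd i} = {}"
            using pairwiseD[OF disj j i(1) False] by (simp add: case_prod_unfold)
          thus ?thesis using i(2) False by auto
        qed (use i in auto)
      qed
      also have "\<dots> = r x" using i fin by simp
      finally show ?thesis by simp
    next
      case False
      hence "(\<Sum>i\<in>I. (if x \<in> {fst i<..<snd i} then r x else 0)) = 0" by (intro sum.neutral) auto
      thus ?thesis using r0[OF x] by simp
    qed
  qed
  thus ?thesis by (simp add: case_prod_unfold)
qed

text \<open>Truncation of the norm at a level \<open>N\<close>: the part above \<open>N\<close> has
  small total integral whatever the intervals are, and the part below is controlled by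
  \<open>N\<close> times their total length.\<close>

lemma abs_continuous_on_integral:
  fixes g :: "real \<Rightarrow> complex"
  assumes g: "g absolutely_integrable_on {a..b}"
  shows "abs_continuous_on_Icc a b (\<lambda>x. integral {a..x} g)"
  unfolding abs_continuous_on_Icc_def
proof (intro allI impI)
  fix e :: real assume e: "e > 0"
  define G where "G = (\<lambda>x. norm (g x))"
  have G: "G absolutely_integrable_on {a..b}" using absolutely_integrable_norm[OF g] by (simp add: G_def o_def)
  have Gi: "G integrable_on {a..b}" using G set_lebesgue_integral_eq_integral(1) by blast
  have mi: "(\<lambda>x. min (G x) (real n)) absolutely_integrable_on {a..b}" for n
    using absolutely_integrable_min_1[OF G, of "\<lambda>x. real n"] by simp
  hence mi': "(\<lambda>x. min (G x) (real n)) integrable_on {a..b}" for n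
    using set_lebesgue_integral_eq_integral(1) by blast
  have "(\<lambda>n. integral {a..b} (\<lambda>x. min (G x) (real n))) \<longlonglongrightarrow> integral {a..b} G"
  proof (rule dominated_convergence(2)[OF mi' Gi])
    show "norm (min (G x) (real n)) \<le> G x" for n x by (auto simp: G_def)
    show "(\<lambda>n. min (G x) (real n)) \<longlonglongrightarrow> G x" for x
    proof (rule tendsto_eventually)
      obtain N where "G x \<le> real N" using real_arch_simple by blast
      thus "\<forall>\<^sub>F n in sequentially. min (G x) (real n) = G x"
        by (intro eventually_sequentiallyI[of N]) (auto simp: min_def)
    qed
  qed
  from LIMSEQ_D[OF this, of "e/2"] e obtain N where
    N: "norm (integral {a..b} (\<lambda>x. min (G x) (real N)) - integral {a..b} G) < e/2" by auto
  define R where "R = (\<lambda>x. G x - min (G x) (real N))"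
  have R: "R integrable_on {a..b}" unfolding R_def by (intro integrable_diff Gi mi')
  have "integral {a..b} R = integral {a..b} G - integral {a..b} (\<lambda>x. min (G x) (real N))"
    unfolding R_def by (intro Henstock_Kurzweil_Integration.integral_diff Gi mi')
  hence R2: "integral {a..b} R < e/2" using N unfolding real_norm_def abs_less_iff by linarith
  define \<delta> where "\<delta> = e / (2 * (real N + 1))"
  have \<delta>: "\<delta> > 0" using e by (simp add: \<delta>_def)
  have "(\<Sum>(s, t)\<in>I. cmod (integral {a..t} g - integral {a..s} g)) < e"
    if I: "finite I" "\<forall>(s, t)\<in>I. a \<le> s \<and> s < t \<and> t \<le> b"
        "nonoverlapping I" "(\<Sum>(s, t)\<in>I. t - s) < \<delta>" for I
  proof -
    have "(\<Sum>(s, t)\<in>I. cmod (integral {a..t} g - integral {a..s} g)) \<le> (\<Sum>(s,t)\<in>I. integral {s..t} R + real N * (t - s))"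
    proof (rule sum_mono, clarify)
      fix s t assume "(s,t) \<in> I"
      hence st: "a \<le> s" "s < t" "t \<le> b" using I(2) by auto
      have gi: "g integrable_on {a..b}" using g set_lebesgue_integral_eq_integral(1) by blast
      have gi2: "g integrable_on {s..t}" using gi st by (intro integrable_on_subinterval[OF gi]) auto
      have gi3: "g integrable_on {a..t}" using gi st by (intro integrable_on_subinterval[OF gi]) auto
      have Ri: "R integrable_on {s..t}" using st by (intro integrable_on_subinterval[OF R]) auto
      have "integral {a..t} g - integral {a..s} g = integral {s..t} g"
        using Henstock_Kurzweil_Integration.integral_combine[of a s t g] gi3 st by (simp add: algebra_simps)
      also have "cmod \<dots> \<le> integral {s..t} (\<lambda>x. R x + real N)"
      proof (rule integral_norm_bound_integral[OF gi2])
        show "(\<lambda>x. R x + real N) integrable_on {s..t}" by (intro integrable_add Ri integrable_const_ivl)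
        show "norm (g x) \<le> R x + real N" for x by (auto simp: R_def G_def)
      qed
      also have "\<dots> = integral {s..t} R + real N * (t - s)"
        using st by (subst Henstock_Kurzweil_Integration.integral_add[OF Ri integrable_const_ivl]) (simp add: mult.commute)
      finally show "cmod (integral {a..t} g - integral {a..s} g) \<le> integral {s..t} R + real N * (t - s)" .
    qed
    also have "\<dots> = (\<Sum>(s,t)\<in>I. integral {s..t} R) + real N * (\<Sum>(s,t)\<in>I. t - s)"
      by (simp add: case_prod_unfold sum.distrib sum_distrib_left)
    also have "\<dots> \<le> integral {a..b} R + real N * \<delta>"
      by (intro add_mono mult_left_mono sum_integral_disjoint_le R I less_imp_le[OF I(4)]) (auto simp: R_def)
    also have "\<dots> < e/2 + (real N + 1) * \<delta>" using R2 \<delta> by (intro add_strict_mono mult_strict_right_mono) auto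
    also have "(real N + 1) * \<delta> = e / 2" unfolding \<delta>_def by (simp add: divide_simps)
    also have "e / 2 + e / 2 = e" by simp
    finally show ?thesis .
  qed
  thus "\<exists>\<delta>>0. \<forall>I. small_system a b \<delta> I \<longrightarrow> (\<Sum>(s, t)\<in>I. cmod (integral {a..t} g - integral {a..s} g)) < e"
    using \<delta> by blast
qed

section \<open>Calculus of absolutely continuous functions and their derivatives\<close>

text \<open>The derivative is a separate argument because it is determined only almost everywhere.
  With both functions in one relation the differentiation rules become closure lemmas, and
  \<open>ac_deriv_cong\<close> lets a derivative be rewritten by pointwise algebra.\<close>

definition ac_deriv :: "(real \<Rightarrow> complex) \<Rightarrow> (real \<Rightarrow> complex) \<Rightarrow> bool" where
  "ac_deriv f f' \<longleftrightarrow> abs_continuous_on_Icc 0 pi f \<and>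
     (AE x in lebesgue_on {0<..<pi}. (f has_vector_derivative f' x) (at x))"

lemma ac_deriv_continuous_on: "ac_deriv f f' \<Longrightarrow> continuous_on {0..pi} f"
  unfolding ac_deriv_def using abs_continuous_on_imp_continuous_on by blast

lemma ac_deriv_has_integral:
  assumes "ac_deriv f f'" "0 \<le> a" "a \<le> b" "b \<le> pi"
  shows "(f' has_integral (f b - f a)) {a..b}"
proof (rule abs_continuous_has_integral[OF assms(3)])
  show "abs_continuous_on_Icc a b f"
    using assms abs_continuous_on_subinterval unfolding ac_deriv_def by blast
  show "negligible {x \<in> {0<..<pi}. \<not> (f has_vector_derivative f' x) (at x)}"
    using assms(1) unfolding ac_deriv_def by (simp add: AE_lebesgue_on_iff_negligible)
qed (use assms in auto)

lemma ac_deriv_bounded: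
  assumes "ac_deriv f f'"
  obtains B where "B > 0" "\<And>x. x \<in> {0..pi} \<Longrightarrow> cmod (f x) \<le> B"
proof -
  have "compact (f ` {0..pi})" using ac_deriv_continuous_on[OF assms] by (intro compact_continuous_image) auto
  then obtain B where "\<forall>y\<in>f ` {0..pi}. cmod y \<le> B" using compact_imp_bounded bounded_iff by metis
  thus ?thesis using that[of "max B 1"] by force
qed

lemma ac_deriv_const: "ac_deriv (\<lambda>x. c) (\<lambda>x. 0)"
  unfolding ac_deriv_def abs_continuous_on_Icc_def by (auto intro: exI[of _ 1])

lemma ac_deriv_add:
  assumes "ac_deriv f f'" "ac_deriv g g'"
  shows "ac_deriv (\<lambda>x. f x + g x) (\<lambda>x. f' x + g' x)"
  unfolding ac_deriv_def
proof
  show "abs_continuous_on_Icc 0 pi (\<lambda>x. f x + g x)"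
  proof (rule abs_continuous_on_dominated[of 0 pi f g _ 1])
    show "cmod (f t + g t - (f s + g s)) \<le> 1 * (cmod (f t - f s) + cmod (g t - g s))" for s t
      using norm_triangle_ineq[of "f t - f s" "g t - g s"] by (simp add: algebra_simps)
  qed (use assms in \<open>auto simp: ac_deriv_def\<close>)
  show "AE x in lebesgue_on {0<..<pi}. ((\<lambda>x. f x + g x) has_vector_derivative f' x + g' x) (at x)"
    using assms unfolding ac_deriv_def by (auto intro: has_vector_derivative_add elim!: AE_mp)
qed

lemma ac_deriv_mult:
  assumes "ac_deriv f f'" "ac_deriv g g'"
  shows "ac_deriv (\<lambda>x. f x * g x) (\<lambda>x. f x * g' x + f' x * g x)"
  unfolding ac_deriv_def
proof
  obtain B where B: "B > 0" "\<And>x. x \<in> {0..pi} \<Longrightarrow> cmod (f x) \<le> B" using ac_deriv_bounded[OF assms(1)] by blast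
  obtain C where C: "C > 0" "\<And>x. x \<in> {0..pi} \<Longrightarrow> cmod (g x) \<le> C" using ac_deriv_bounded[OF assms(2)] by blast
  show "abs_continuous_on_Icc 0 pi (\<lambda>x. f x * g x)"
  proof (rule abs_continuous_on_dominated[of 0 pi f g _ "B + C"])
    show "cmod (f t * g t - f s * g s) \<le> (B + C) * (cmod (f t - f s) + cmod (g t - g s))" if "0 \<le> s" "s < t" "t \<le> pi" for s t
    proof -
      have "f t * g t - f s * g s = f t * (g t - g s) + (f t - f s) * g s" by (simp add: algebra_simps)
      also have "cmod \<dots> \<le> cmod (f t) * cmod (g t - g s) + cmod (f t - f s) * cmod (g s)"
        by (metis norm_triangle_ineq norm_mult)
      also have "\<dots> \<le> B * cmod (g t - g s) + cmod (f t - f s) * C"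
        using that by (intro add_mono mult_right_mono mult_left_mono B C) auto
      also have "\<dots> \<le> (B + C) * (cmod (f t - f s) + cmod (g t - g s))" using B(1) C(1) by (simp add: algebra_simps)
      finally show ?thesis .
    qed
  qed (use assms in \<open>auto simp: ac_deriv_def\<close>)
  show "AE x in lebesgue_on {0<..<pi}. ((\<lambda>x. f x * g x) has_vector_derivative f x * g' x + f' x * g x) (at x)"
    using assms unfolding ac_deriv_def by (auto intro: has_vector_derivative_mult elim!: AE_mp)
qed

lemma ac_deriv_cmult: "ac_deriv f f' \<Longrightarrow> ac_deriv (\<lambda>x. c * f x) (\<lambda>x. c * f' x)"
  using ac_deriv_mult[OF ac_deriv_const, of f f' c] by simp

lemma ac_deriv_diff:
  assumes "ac_deriv f f'" "ac_deriv g g'"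
  shows "ac_deriv (\<lambda>x. f x - g x) (\<lambda>x. f' x - g' x)"
  using ac_deriv_add[OF assms(1) ac_deriv_cmult[OF assms(2), of "-1"]] by simp

lemma ac_deriv_cnj:
  assumes "ac_deriv f f'"
  shows "ac_deriv (\<lambda>x. cnj (f x)) (\<lambda>x. cnj (f' x))"
  unfolding ac_deriv_def
proof
  show "abs_continuous_on_Icc 0 pi (\<lambda>x. cnj (f x))"
  proof (rule abs_continuous_on_dominated[of 0 pi f f _ 1])
    show "cmod (cnj (f t) - cnj (f s)) \<le> 1 * (cmod (f t - f s) + cmod (f t - f s))" for s t
      by (metis complex_cnj_diff complex_mod_cnj le_add_same_cancel1 mult_1 norm_ge_zero)
  qed (use assms in \<open>auto simp: ac_deriv_def\<close>)
  show "AE x in lebesgue_on {0<..<pi}. ((\<lambda>x. cnj (f x)) has_vector_derivative cnj (f' x)) (at x)"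
    using assms unfolding ac_deriv_def by (auto intro: has_vector_derivative_cnj elim!: AE_mp)
qed

lemma ac_deriv_exp:
  assumes "ac_deriv f f'"
  shows "ac_deriv (\<lambda>x. exp (f x)) (\<lambda>x. f' x * exp (f x))"
  unfolding ac_deriv_def
proof
  obtain B where B: "B > 0" "\<And>x. x \<in> {0..pi} \<Longrightarrow> cmod (f x) \<le> B" using ac_deriv_bounded[OF assms(1)] by blast
  show "abs_continuous_on_Icc 0 pi (\<lambda>x. exp (f x))"
  proof (rule abs_continuous_on_dominated[of 0 pi f f _ "exp B"])
    show "cmod (exp (f t) - exp (f s)) \<le> exp B * (cmod (f t - f s) + cmod (f t - f s))" if "0 \<le> s" "s < t" "t \<le> pi" for s t
    proof -
      have "norm (exp (f t) - exp (f s)) \<le> exp B * norm (f t - f s)"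
      proof (rule field_differentiable_bound[of "cball 0 B" exp exp])
        show "(exp has_field_derivative exp z) (at z within cball 0 B)" for z :: complex
          using DERIV_exp has_field_derivative_at_within by blast
        show "norm (exp z) \<le> exp B" if "z \<in> cball 0 B" for z :: complex
          using that by (smt (verit) exp_le_cancel_iff mem_cball_0 norm_exp)
      qed (use B that in auto)
      also have "\<dots> \<le> exp B * (cmod (f t - f s) + cmod (f t - f s))" by simp
      finally show ?thesis .
    qed
  qed (use assms in \<open>auto simp: ac_deriv_def\<close>)
  have "((\<lambda>x. exp (f x)) has_vector_derivative f' x * exp (f x)) (at x)"
    if "(f has_vector_derivative f' x) (at x)" for x
    using field_vector_diff_chain_at[OF that DERIV_exp] by (simp add: o_def)
  thus "AE x in lebesgue_on {0<..<pi}. ((\<lambda>x. exp (f x)) has_vector_derivative f' x * exp (f x)) (at x)"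
    using assms unfolding ac_deriv_def by (auto elim!: AE_mp)
qed

lemma ac_deriv_power:
  assumes "ac_deriv f f'"
  shows "ac_deriv (\<lambda>x. f x ^ Suc n) (\<lambda>x. of_nat (Suc n) * f x ^ n * f' x)"
proof (induction n)
  case 0 thus ?case using assms by simp
next
  case (Suc n)
  from ac_deriv_mult[OF assms Suc] show ?case by (simp add: algebra_simps)
qed

lemma ac_deriv_cong:
  assumes "ac_deriv f f'" "\<And>x. x \<in> {0..pi} \<Longrightarrow> f x = g x"
    and "AE x in lebesgue_on {0<..<pi}. f' x = g' x"
  shows "ac_deriv g g'"
  unfolding ac_deriv_def
proof
  show "abs_continuous_on_Icc 0 pi g"
    by (rule abs_continuous_on_dominated[of 0 pi f f _ 1]) (use assms in \<open>auto simp: ac_deriv_def\<close>)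
  have "(g has_vector_derivative g' x) (at x)" if "(f has_vector_derivative f' x) (at x)" "f' x = g' x" "x \<in> {0<..<pi}" for x
    using that has_vector_derivative_transform_within_open[of f "f' x" x "{0<..<pi}" g] assms(2) by auto
  thus "AE x in lebesgue_on {0<..<pi}. (g has_vector_derivative g' x) (at x)"
    using assms(1,3) unfolding ac_deriv_def by (auto elim!: AE_mp)
qed

lemma ac_deriv_integral:
  assumes "g absolutely_integrable_on {0..pi}"
  shows "ac_deriv (\<lambda>x. integral {0..x} g) g"
  unfolding ac_deriv_def
proof
  show "abs_continuous_on_Icc 0 pi (\<lambda>x. integral {0..x} g)" by (rule abs_continuous_on_integral[OF assms])
  show "AE x in lebesgue_on {0<..<pi}. ((\<lambda>x. integral {0..x} g) has_vector_derivative g x) (at x)"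
    using integral_derivative_ae[OF set_lebesgue_integral_eq_integral(1)[OF assms]]
    by (simp add: AE_lebesgue_on_iff_negligible)
qed

lemma ac_deriv_antimono:
  assumes "ac_deriv f f'" "AE x in lebesgue_on {0<..<pi}. Re (f' x) \<le> 0" "0 \<le> a" "a \<le> b" "b \<le> pi"
  shows "Re (f b) \<le> Re (f a)"
proof -
  have "((\<lambda>x. Re (f' x)) has_integral Re (f b - f a)) {a..b}"
    using has_integral_linear[OF ac_deriv_has_integral[OF assms(1,3-5)] bounded_linear_Re] by (simp add: o_def)
  moreover have "((\<lambda>x. 0::real) has_integral 0) {a..b}" by simp
  moreover have "negligible ({x \<in> {0<..<pi}. \<not> Re (f' x) \<le> 0} \<union> {0,pi})"
    using assms(2) by (auto simp: AE_lebesgue_on_iff_negligible)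
  \<comment> \<open>Replacing the derivative by its minimum with 0 changes it on a null set only and
    makes the sign hold everywhere.\<close>
  ultimately have "Re (f b - f a) \<le> 0"
    using has_integral_spike[of "{x \<in> {0<..<pi}. \<not> Re (f' x) \<le> 0} \<union> {0,pi}" "{a..b}" "\<lambda>x. min 0 (Re (f' x))" "\<lambda>x. Re (f' x)" "Re (f b - f a)"]
    by (rule_tac has_integral_le[of "\<lambda>x. min 0 (Re (f' x))" _ "{a..b}" "\<lambda>x. 0"]) (use assms in auto)
  thus ?thesis by simp
qed

section \<open>Solutions of the pencil equation\<close>

lemma absolutely_integrable_mult_continuous:
  fixes k f :: "real \<Rightarrow> complex"
  assumes k: "k absolutely_integrable_on {0..pi}" and f: "continuous_on {0..pi} f"
  shows "(\<lambda>t. k t * f t) absolutely_integrable_on {0..pi}"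
proof -
  have "f \<in> borel_measurable (lebesgue_on {0..pi})"
    by (rule continuous_imp_measurable_on_sets_lebesgue[OF f]) simp
  moreover have "bounded (f ` {0..pi})" using f by (intro compact_imp_bounded compact_continuous_image) auto
  ultimately have "(\<lambda>t. f t * k t) absolutely_integrable_on {0..pi}"
    by (intro absolutely_integrable_bounded_measurable_product[OF bilinear_times] k) auto
  thus ?thesis by (simp add: mult.commute)
qed

lemma absolutely_integrable_imp_integrable:
  fixes f :: "real \<Rightarrow> 'a::euclidean_space"
  assumes "f absolutely_integrable_on {0..pi}" "x \<in> {0..pi}"
  shows "f integrable_on {0..x}"
  using assms by (intro integrable_on_subinterval[OF set_lebesgue_integral_eq_integral(1)[OF assms(1)]]) auto

text \<open>Polynomials in the spectral parameter with coefficients continuous in \<open>x\<close>.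
  Every Picard iterate has this form, so its holomorphy in \<mu> is visible without differentiating
  under an integral sign. The last rule is there because only values on \<open>{0..pi}\<close>
  matter.\<close>

inductive poly_cont :: "(complex \<Rightarrow> real \<Rightarrow> complex) \<Rightarrow> bool" where
  poly_cont_const: "continuous_on {0..pi} c \<Longrightarrow> poly_cont (\<lambda>\<mu>. c)"
| poly_cont_mult: "poly_cont f \<Longrightarrow> poly_cont (\<lambda>\<mu> x. \<mu> * f \<mu> x)"
| poly_cont_add: "poly_cont f \<Longrightarrow> poly_cont g \<Longrightarrow> poly_cont (\<lambda>\<mu> x. f \<mu> x + g \<mu> x)"
| poly_cont_cong: "poly_cont f \<Longrightarrow> (\<And>\<mu> x. x \<in> {0..pi} \<Longrightarrow> f \<mu> x = g \<mu> x) \<Longrightarrow> poly_cont g"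

lemma poly_cont_continuous_on: "poly_cont f \<Longrightarrow> continuous_on {0..pi} (f \<mu>)"
proof (induction rule: poly_cont.induct)
  case (poly_cont_cong f g)
  thus ?case using continuous_on_eq[of "{0..pi}" "f \<mu>" "g \<mu>"] by auto
qed (auto intro!: continuous_intros)

lemma poly_cont_holomorphic_on:
  assumes "poly_cont f" "x \<in> {0..pi}"
  shows "(\<lambda>\<mu>. f \<mu> x) holomorphic_on A"
  using assms
proof (induction rule: poly_cont.induct)
  case (poly_cont_cong f g)
  thus ?case using holomorphic_cong[of A A "\<lambda>\<mu>. f \<mu> x" "\<lambda>\<mu>. g \<mu> x"] by auto
qed (auto intro!: holomorphic_intros)

lemma poly_cont_integral:
  assumes "poly_cont f" and k: "k absolutely_integrable_on {0..pi}"
  shows "poly_cont (\<lambda>\<mu> x. integral {0..x} (\<lambda>t. k t * f \<mu> t))"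
  using assms(1)
proof (induction rule: poly_cont.induct)
  case (poly_cont_const c)
  show ?case
    by (rule poly_cont.poly_cont_const)
      (rule ac_deriv_continuous_on[OF ac_deriv_integral[OF absolutely_integrable_mult_continuous[OF k poly_cont_const]]])
next
  case (poly_cont_mult f)
  show ?case
    by (rule poly_cont.poly_cont_cong[OF poly_cont.poly_cont_mult[OF poly_cont_mult.IH]])
       (simp add: mult.left_commute flip: integral_mult_right)
next
  case (poly_cont_add f g)
  have *: "(\<lambda>t. k t * f \<mu> t) integrable_on {0..x}" "(\<lambda>t. k t * g \<mu> t) integrable_on {0..x}" if "x \<in> {0..pi}" for \<mu> x
    using that poly_cont_add
    by (auto intro!: absolutely_integrable_imp_integrable absolutely_integrable_mult_continuous k poly_cont_continuous_on)
  show ?case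
    by (rule poly_cont.poly_cont_cong[OF poly_cont.poly_cont_add[OF poly_cont_add.IH]])
       (simp add: distrib_left Henstock_Kurzweil_Integration.integral_add[OF *])
next
  case (poly_cont_cong f g)
  show ?case
  proof (rule poly_cont.poly_cont_cong[OF poly_cont_cong.IH])
    fix \<mu> x assume "x \<in> {0..pi}"
    thus "integral {0..x} (\<lambda>t. k t * f \<mu> t) = integral {0..x} (\<lambda>t. k t * g \<mu> t)"
      using poly_cont_cong.hyps by (intro integral_cong) auto
  qed
qed

lemma real_primitive_ac_deriv:
  assumes h: "h absolutely_integrable_on {0..pi}"
  shows "ac_deriv (\<lambda>x. complex_of_real (integral {0..x} h)) (\<lambda>x. complex_of_real (h x))"
proof -
  have kc: "(\<lambda>t. complex_of_real (h t)) absolutely_integrable_on {0..pi}"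
    using absolutely_integrable_linear[OF h bounded_linear_of_real[where 'a=complex]] by (simp add: o_def)
  show ?thesis
  proof (rule ac_deriv_cong[OF ac_deriv_integral[OF kc]])
    fix y assume y: "y \<in> {0..pi}"
    show "integral {0..y} (\<lambda>t. complex_of_real (h t)) = complex_of_real (integral {0..y} h)"
      by (rule integral_unique, rule has_integral_of_real, rule integrable_integral, rule absolutely_integrable_imp_integrable[OF h y])
  qed simp
qed

text \<open>Source of the factorials in the Picard bounds: \<open>N ^ Suc n\<close> is absolutely
  continuous, so its derivative, valid only almost everywhere, still integrates back to it.\<close>

lemma integral_primitive_power:
  fixes \<kappa> :: "real \<Rightarrow> real"
  assumes k: "\<kappa> absolutely_integrable_on {0..pi}" and x: "x \<in> {0..pi}"
  defines "N \<equiv> \<lambda>x. integral {0..x} \<kappa>"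
  shows "((\<lambda>t. \<kappa> t * (N t ^ n / fact n)) has_integral (N x ^ Suc n / fact (Suc n))) {0..x}"
proof -
  have "ac_deriv (\<lambda>x. complex_of_real (N x)) (\<lambda>x. complex_of_real (\<kappa> x))"
    unfolding N_def by (rule real_primitive_ac_deriv[OF k])
  from ac_deriv_has_integral[OF ac_deriv_cmult[OF ac_deriv_power[OF this, of n], of "1 / fact (Suc n)"], of 0 x] x
  have "((\<lambda>t. complex_of_real (\<kappa> t * (N t ^ n / fact n))) has_integral complex_of_real (N x ^ Suc n / fact (Suc n))) {0..x}"
    by (simp add: N_def field_simps del: of_nat_Suc)
  from has_integral_linear[OF this bounded_linear_Re] show ?thesis by (simp only: o_def Re_complex_of_real)
qed

text \<open>The interval has finite measure, so \<open>t \<le> 1 + t\<^sup>2\<close> yields the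
  first claim. The second is what the regularized equation calls for, since \<sigma> enters it
  through its square.\<close>

lemma L2_0pi_integrable:
  assumes "f \<in> L2_0pi"
  shows "f absolutely_integrable_on {0..pi}" "(\<lambda>x. (f x)\<^sup>2) absolutely_integrable_on {0..pi}"
proof -
  have m: "f \<in> borel_measurable (lebesgue_on {0<..<pi})" and i: "integrable (lebesgue_on {0<..<pi}) (\<lambda>x. (cmod (f x))\<^sup>2)"
    using assms by (auto simp: L2_0pi_def)
  have m2: "(\<lambda>x. (f x)\<^sup>2) \<in> borel_measurable (lebesgue_on {0<..<pi})" using m by measurable
  have fm: "{0<..<pi} \<in> lmeasurable" by (metis box_real(1) lmeasurable_box)
  have c: "integrable (lebesgue_on {0<..<pi}) (\<lambda>x. 1 :: real)"
    using fm by (simp add: integrable_on_const lmeasurable_iff_integrable_on set_integrable_def integrable_restrict_space)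
  have "integrable (lebesgue_on {0<..<pi}) (\<lambda>x. cmod (f x))"
  proof (rule Bochner_Integration.integrable_bound[OF Bochner_Integration.integrable_add[OF c i]])
    show "(\<lambda>x. cmod (f x)) \<in> borel_measurable (lebesgue_on {0<..<pi})" using m by measurable
    have "t \<le> 1 + t\<^sup>2" for t :: real using sum_squares_bound[of t 1] by (smt (verit) power2_eq_square zero_le_square mult_1 one_power2)
    thus "AE x in lebesgue_on {0<..<pi}. norm (cmod (f x)) \<le> norm (1 + (cmod (f x))\<^sup>2)" by simp
  qed
  hence "f absolutely_integrable_on {0<..<pi}" "(\<lambda>x. (f x)\<^sup>2) absolutely_integrable_on {0<..<pi}"
    using m m2 i by (auto simp: absolutely_integrable_measurable o_def norm_power)
  thus "f absolutely_integrable_on {0..pi}" "(\<lambda>x. (f x)\<^sup>2) absolutely_integrable_on {0..pi}"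
    using absolutely_integrable_on_open_interval[of "0::real" pi] unfolding box_real by blast+
qed

text \<open>With \<open>rhs1\<close>, the right-hand side of the equivalent first-order system for
  \<open>y\<close> and its quasi-derivative \<open>z\<close>. No derivative of \<sigma> occurs,
  which is the purpose of the quasi-derivative.\<close>

abbreviation rhs0 :: "(real \<Rightarrow> complex) \<Rightarrow> (real \<Rightarrow> complex) \<Rightarrow> (real \<Rightarrow> complex) \<Rightarrow> real \<Rightarrow> complex" where
  "rhs0 \<sigma> y z \<equiv> \<lambda>x. \<sigma> x * y x + z x"

abbreviation rhs1 :: "(real \<Rightarrow> complex) \<Rightarrow> (real \<Rightarrow> complex) \<Rightarrow> complex \<Rightarrow> (real \<Rightarrow> complex) \<Rightarrow> (real \<Rightarrow> complex) \<Rightarrow> real \<Rightarrow> complex" where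
  "rhs1 \<sigma> q \<mu> y z \<equiv> \<lambda>x. (2 * \<mu> * q x - (\<sigma> x)\<^sup>2 - \<mu>\<^sup>2) * y x - \<sigma> x * z x"

lemma ac_deriv_unique_AE:
  assumes "ac_deriv f f'" "ac_deriv f g'"
  shows "AE x in lebesgue_on {0<..<pi}. f' x = g' x"
proof -
  have "AE x in lebesgue_on {0<..<pi}. (f has_vector_derivative f' x) (at x)"
       "AE x in lebesgue_on {0<..<pi}. (f has_vector_derivative g' x) (at x)" using assms by (auto simp: ac_deriv_def)
  thus ?thesis by eventually_elim (rule vector_derivative_unique_at)
qed

lemma is_solution_iff:
  "is_solution \<sigma> q1 \<mu> y y1 \<longleftrightarrow> ac_deriv y (rhs0 \<sigma> y y1) \<and>
     ac_deriv y1 (rhs1 \<sigma> q1 \<mu> y y1)"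
proof -
  have 1: "(\<exists>y'. (y has_vector_derivative y') (at x) \<and> y1 x = y' - \<sigma> x * y x) \<longleftrightarrow>
        (y has_vector_derivative (\<sigma> x * y x + y1 x)) (at x)" for x
    by (auto simp: algebra_simps)
  have 2: "(\<exists>d. (y1 has_vector_derivative d) (at x) \<and>
            - d - \<sigma> x * y1 x - (\<sigma> x)\<^sup>2 * y x + 2 * \<mu> * q1 x * y x = \<mu>\<^sup>2 * y x) \<longleftrightarrow>
        (y1 has_vector_derivative ((2 * \<mu> * q1 x - (\<sigma> x)\<^sup>2 - \<mu>\<^sup>2) * y x - \<sigma> x * y1 x)) (at x)" for x
  proof -
    have "- d - \<sigma> x * y1 x - (\<sigma> x)\<^sup>2 * y x + 2 * \<mu> * q1 x * y x = \<mu>\<^sup>2 * y x \<longleftrightarrow>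
       d = (2 * \<mu> * q1 x - (\<sigma> x)\<^sup>2 - \<mu>\<^sup>2) * y x - \<sigma> x * y1 x" for d by (simp add: algebra_simps) (metis add_diff_cancel_left' add.commute diff_add_eq)
    thus ?thesis by auto
  qed
  show ?thesis unfolding is_solution_def is_quasi_derivative_def ac_deriv_def 1 2 by auto
qed

lemma uniform_limit_section:
  assumes "uniform_limit (A \<times> B) (\<lambda>n (\<mu>,x). f n \<mu> x) (\<lambda>(\<mu>,x). g \<mu> x) F"
  shows "\<mu> \<in> A \<Longrightarrow> uniform_limit B (\<lambda>n x. f n \<mu> x) (g \<mu>) F"
    "x \<in> B \<Longrightarrow> uniform_limit A (\<lambda>n \<mu>. f n \<mu> x) (\<lambda>\<mu>. g \<mu> x) F"
proof -
  show "uniform_limit B (\<lambda>n x. f n \<mu> x) (g \<mu>) F" if "\<mu> \<in> A"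
    unfolding uniform_limit_iff
  proof (intro allI impI)
    fix e :: real assume "e > 0"
    from uniform_limitD[OF assms this] show "\<forall>\<^sub>F n in F. \<forall>x\<in>B. dist (f n \<mu> x) (g \<mu> x) < e"
      by eventually_elim (use that in auto)
  qed
  show "uniform_limit A (\<lambda>n \<mu>. f n \<mu> x) (\<lambda>\<mu>. g \<mu> x) F" if "x \<in> B"
    unfolding uniform_limit_iff
  proof (intro allI impI)
    fix e :: real assume "e > 0"
    from uniform_limitD[OF assms this] show "\<forall>\<^sub>F n in F. \<forall>\<mu>\<in>A. dist (f n \<mu> x) (g \<mu> x) < e"
      by eventually_elim (use that in auto)
  qed
qed

section \<open>Construction of solutions by Picard iteration\<close>

locale pencil =
  fixes \<sigma> q1 :: "real \<Rightarrow> complex"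
  assumes \<sigma>: "\<sigma> \<in> L2_0pi" and q1: "q1 \<in> L2_0pi"
begin

text \<open>An integrable majorant for the coefficients of the first-order system, uniform over the
  disc \<open>cmod \<mu> \<le> R\<close>.\<close>

definition kappa :: "real \<Rightarrow> real \<Rightarrow> real" where
  "kappa R t = 1 + cmod (\<sigma> t) + (cmod (\<sigma> t))\<^sup>2 + 2 * R * cmod (q1 t) + R\<^sup>2"

lemma kappa_nonneg: "0 \<le> R \<Longrightarrow> 0 \<le> kappa R t"
  by (simp add: kappa_def)

lemma kappa_integrable: "kappa R absolutely_integrable_on {0..pi}"
proof -
  have "(\<lambda>t. cmod (\<sigma> t)) absolutely_integrable_on {0..pi}" "(\<lambda>t. cmod (q1 t)) absolutely_integrable_on {0..pi}"
       "(\<lambda>t. cmod ((\<sigma> t)\<^sup>2)) absolutely_integrable_on {0..pi}"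
    using absolutely_integrable_norm[OF L2_0pi_integrable(1)[OF \<sigma>]] absolutely_integrable_norm[OF L2_0pi_integrable(1)[OF q1]]
      absolutely_integrable_norm[OF L2_0pi_integrable(2)[OF \<sigma>]] by (simp_all add: o_def)
  moreover have "(\<lambda>t. c) absolutely_integrable_on {0..pi}" for c :: real
    by (rule absolutely_integrable_continuous_real) simp
  ultimately show ?thesis unfolding kappa_def[abs_def] norm_power mult.assoc
    by (intro set_integral_add(1) set_integrable_mult_right) auto
qed

text \<open>These are the terms of the Neumann series rather than its partial sums: each is the
  integral operator applied to its predecessor, and the initial values \<alpha>, \<beta> enter only
  through the zeroth term.\<close>

primrec picard :: "complex \<Rightarrow> complex \<Rightarrow> nat \<Rightarrow> (complex \<Rightarrow> real \<Rightarrow> complex) \<times> (complex \<Rightarrow> real \<Rightarrow> complex)" where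
  "picard \<alpha> \<beta> 0 = ((\<lambda>\<mu> x. \<alpha>), (\<lambda>\<mu> x. \<beta>))"
| "picard \<alpha> \<beta> (Suc n) = 
     ((\<lambda>\<mu> x. integral {0..x} (rhs0 \<sigma> (fst (picard \<alpha> \<beta> n) \<mu>) (snd (picard \<alpha> \<beta> n) \<mu>))),
      (\<lambda>\<mu> x. integral {0..x} (rhs1 \<sigma> q1 \<mu> (fst (picard \<alpha> \<beta> n) \<mu>) (snd (picard \<alpha> \<beta> n) \<mu>))))"

lemma coeff_integrable:
  assumes "continuous_on {0..pi} f" "continuous_on {0..pi} g" "x \<in> {0..pi}"
  shows "(\<lambda>t. \<sigma> t * f t) integrable_on {0..x}" "(\<lambda>t. (- \<sigma> t) * f t) integrable_on {0..x}" 
    "(\<lambda>t. (2 * q1 t) * f t) integrable_on {0..x}" "(\<lambda>t. (- (\<sigma> t)\<^sup>2) * f t) integrable_on {0..x}"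
    "(\<lambda>t. 1 * f t) integrable_on {0..x}" "(\<lambda>t. (-1) * f t) integrable_on {0..x}"
    "(rhs0 \<sigma> f g) absolutely_integrable_on {0..pi}"
    "(rhs1 \<sigma> q1 \<mu> f g) absolutely_integrable_on {0..pi}"
proof -
  note s = L2_0pi_integrable[OF \<sigma>] and q = L2_0pi_integrable[OF q1]
  have c: "(\<lambda>t. c) absolutely_integrable_on {0..pi}" for c :: complex
    by (rule absolutely_integrable_continuous_real) simp
  have mi: "(\<lambda>t. - h t) absolutely_integrable_on {0..pi}" if "h absolutely_integrable_on {0..pi}" for h :: "real \<Rightarrow> complex"
    using set_integrable_mult_right[of "-1" lebesgue "{0..pi}" h] that by simp
  have 2: "(\<lambda>t. 2 * q1 t) absolutely_integrable_on {0..pi}" by (intro set_integrable_mult_right q)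
  have 3: "(\<lambda>t. 2 * \<mu> * q1 t - (\<sigma> t)\<^sup>2 - \<mu>\<^sup>2) absolutely_integrable_on {0..pi}"
    by (intro set_integral_diff(1) set_integrable_mult_right q s c)
  note am = absolutely_integrable_mult_continuous
  show "(\<lambda>t. \<sigma> t * f t) integrable_on {0..x}" "(\<lambda>t. (- \<sigma> t) * f t) integrable_on {0..x}" 
    "(\<lambda>t. (2 * q1 t) * f t) integrable_on {0..x}" "(\<lambda>t. (- (\<sigma> t)\<^sup>2) * f t) integrable_on {0..x}"
    "(\<lambda>t. 1 * f t) integrable_on {0..x}" "(\<lambda>t. (-1) * f t) integrable_on {0..x}"
    by (rule absolutely_integrable_imp_integrable[OF am[OF _ assms(1)] assms(3)], intro s mi 2 c)+
  show "(rhs0 \<sigma> f g) absolutely_integrable_on {0..pi}"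
    using assms by (intro set_integral_add(1) am s absolutely_integrable_continuous_real)
  show "(rhs1 \<sigma> q1 \<mu> f g) absolutely_integrable_on {0..pi}"
    using assms by (intro set_integral_diff(1) am s 3)
qed

lemma poly_cont_picard: "poly_cont (fst (picard \<alpha> \<beta> n)) \<and> poly_cont (snd (picard \<alpha> \<beta> n))"
proof (induction n)
  case 0
  show ?case by (auto intro!: poly_cont_const)
next
  case (Suc n)
  define f g where "f = fst (picard \<alpha> \<beta> n)" and "g = snd (picard \<alpha> \<beta> n)"
  have fg: "poly_cont f" "poly_cont g" using Suc by (auto simp: f_def g_def)
  note ci = coeff_integrable[OF poly_cont_continuous_on poly_cont_continuous_on]
  note s = L2_0pi_integrable[OF \<sigma>] and q = L2_0pi_integrable[OF q1]
  have c: "(\<lambda>t. c) absolutely_integrable_on {0..pi}" for c :: complex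
    by (rule absolutely_integrable_continuous_real) simp
  have mi: "(\<lambda>t. - h t) absolutely_integrable_on {0..pi}" if "h absolutely_integrable_on {0..pi}" for h :: "real \<Rightarrow> complex"
    using set_integrable_mult_right[of "-1" lebesgue "{0..pi}" h] that by simp
  have "poly_cont (\<lambda>\<mu> x. integral {0..x} (\<lambda>t. \<sigma> t * f \<mu> t) + integral {0..x} (\<lambda>t. 1 * g \<mu> t))"
    by (intro poly_cont_add poly_cont_integral fg s c)
  hence 1: "poly_cont (\<lambda>\<mu> x. integral {0..x} (rhs0 \<sigma> (f \<mu>) (g \<mu>)))"
  proof (rule poly_cont_cong)
    fix \<mu> x assume x: "x \<in> {0..pi}"
    show "integral {0..x} (\<lambda>t. \<sigma> t * f \<mu> t) + integral {0..x} (\<lambda>t. 1 * g \<mu> t) = integral {0..x} (rhs0 \<sigma> (f \<mu>) (g \<mu>))"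
      using Henstock_Kurzweil_Integration.integral_add[OF ci(1)[OF fg(1) fg(1) x] ci(5)[OF fg(2) fg(2) x]] by simp
  qed
  have "poly_cont (\<lambda>\<mu> x. (\<mu> * integral {0..x} (\<lambda>t. (2 * q1 t) * f \<mu> t) + integral {0..x} (\<lambda>t. (- (\<sigma> t)\<^sup>2) * f \<mu> t)) + 
      (\<mu> * (\<mu> * integral {0..x} (\<lambda>t. (-1) * f \<mu> t)) + integral {0..x} (\<lambda>t. (- \<sigma> t) * g \<mu> t)))"
    by (intro poly_cont_add poly_cont_mult poly_cont_integral fg s c mi set_integrable_mult_right q)
  hence 2: "poly_cont (\<lambda>\<mu> x. integral {0..x} (rhs1 \<sigma> q1 \<mu> (f \<mu>) (g \<mu>)))"
  proof (rule poly_cont_cong)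
    fix \<mu> x assume x: "x \<in> {0..pi}"
    have hi: "((\<lambda>t. (\<mu> * ((2 * q1 t) * f \<mu> t) + (- (\<sigma> t)\<^sup>2) * f \<mu> t) + (\<mu> * (\<mu> * ((-1) * f \<mu> t)) + (- \<sigma> t) * g \<mu> t)) has_integral
      ((\<mu> * integral {0..x} (\<lambda>t. (2 * q1 t) * f \<mu> t) + integral {0..x} (\<lambda>t. (- (\<sigma> t)\<^sup>2) * f \<mu> t)) + 
      (\<mu> * (\<mu> * integral {0..x} (\<lambda>t. (-1) * f \<mu> t)) + integral {0..x} (\<lambda>t. (- \<sigma> t) * g \<mu> t)))) {0..x}"
      by (intro has_integral_add has_integral_mult_right integrable_integral ci[OF fg(1) fg(1) x] ci[OF fg(2) fg(2) x])
    have eq: "(\<lambda>t. (\<mu> * ((2 * q1 t) * f \<mu> t) + (- (\<sigma> t)\<^sup>2) * f \<mu> t) + (\<mu> * (\<mu> * ((-1) * f \<mu> t)) + (- \<sigma> t) * g \<mu> t)) =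
      (rhs1 \<sigma> q1 \<mu> (f \<mu>) (g \<mu>))" by (simp add: fun_eq_iff algebra_simps power2_eq_square)
    show "(\<mu> * integral {0..x} (\<lambda>t. (2 * q1 t) * f \<mu> t) + integral {0..x} (\<lambda>t. (- (\<sigma> t)\<^sup>2) * f \<mu> t)) + 
      (\<mu> * (\<mu> * integral {0..x} (\<lambda>t. (-1) * f \<mu> t)) + integral {0..x} (\<lambda>t. (- \<sigma> t) * g \<mu> t)) = 
      integral {0..x} (rhs1 \<sigma> q1 \<mu> (f \<mu>) (g \<mu>))"
      by (rule sym) (rule integral_unique[OF hi[unfolded eq]])
  qed
  show ?case using 1 2 by (simp add: f_def g_def)
qed

lemma coeff_bound:
  assumes "cmod \<mu> \<le> R"
  shows "cmod (\<sigma> t * y + z) \<le> kappa R t * (cmod y + cmod z)"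
    "cmod ((2 * \<mu> * q1 t - (\<sigma> t)\<^sup>2 - \<mu>\<^sup>2) * y - \<sigma> t * z) \<le> kappa R t * (cmod y + cmod z)"
    "cmod (\<sigma> t * y + z) + cmod ((2 * \<mu> * q1 t - (\<sigma> t)\<^sup>2 - \<mu>\<^sup>2) * y - \<sigma> t * z) \<le> kappa R t * (cmod y + cmod z)"
proof -
  have R: "R \<ge> 0" using assms norm_ge_zero order_trans by blast
  have 1: "cmod (\<sigma> t * y + z) \<le> cmod (\<sigma> t) * cmod y + cmod z" by (metis norm_triangle_ineq norm_mult)
  have "cmod (2 * \<mu> * q1 t - (\<sigma> t)\<^sup>2 - \<mu>\<^sup>2) \<le> cmod (2 * \<mu> * q1 t) + cmod ((\<sigma> t)\<^sup>2) + cmod (\<mu>\<^sup>2)"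
    by (meson add_right_mono norm_triangle_ineq4 order_trans)
  also have "\<dots> \<le> 2 * R * cmod (q1 t) + (cmod (\<sigma> t))\<^sup>2 + R\<^sup>2"
    using assms by (intro add_mono) (auto simp: norm_mult norm_power intro!: mult_right_mono power_mono)
  finally have 2: "cmod (2 * \<mu> * q1 t - (\<sigma> t)\<^sup>2 - \<mu>\<^sup>2) \<le> 2 * R * cmod (q1 t) + (cmod (\<sigma> t))\<^sup>2 + R\<^sup>2" .
  have "cmod ((2 * \<mu> * q1 t - (\<sigma> t)\<^sup>2 - \<mu>\<^sup>2) * y - \<sigma> t * z) \<le> cmod (2 * \<mu> * q1 t - (\<sigma> t)\<^sup>2 - \<mu>\<^sup>2) * cmod y + cmod (\<sigma> t) * cmod z"
    by (rule order_trans[OF norm_triangle_ineq4]) (simp add: norm_mult)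
  also have "\<dots> \<le> (2 * R * cmod (q1 t) + (cmod (\<sigma> t))\<^sup>2 + R\<^sup>2) * cmod y + cmod (\<sigma> t) * cmod z"
    using 2 by (intro add_mono mult_right_mono) auto
  finally have 3: "cmod ((2 * \<mu> * q1 t - (\<sigma> t)\<^sup>2 - \<mu>\<^sup>2) * y - \<sigma> t * z) \<le> \<dots>" .
  have "(cmod (\<sigma> t) * cmod y + cmod z) + ((2 * R * cmod (q1 t) + (cmod (\<sigma> t))\<^sup>2 + R\<^sup>2) * cmod y + cmod (\<sigma> t) * cmod z)
     = (cmod (\<sigma> t) + (cmod (\<sigma> t))\<^sup>2 + 2 * R * cmod (q1 t) + R\<^sup>2) * cmod y + (1 + cmod (\<sigma> t)) * cmod z"
    by (simp add: algebra_simps)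
  also have "\<dots> \<le> kappa R t * cmod y + kappa R t * cmod z"
    using R by (intro add_mono mult_right_mono) (auto simp: kappa_def)
  also have "\<dots> = kappa R t * (cmod y + cmod z)" by (simp add: distrib_left)
  finally show 4: "cmod (\<sigma> t * y + z) + cmod ((2 * \<mu> * q1 t - (\<sigma> t)\<^sup>2 - \<mu>\<^sup>2) * y - \<sigma> t * z) \<le> kappa R t * (cmod y + cmod z)"
    using 1 3 by linarith
  show "cmod (\<sigma> t * y + z) \<le> kappa R t * (cmod y + cmod z)" using 4 by (smt (verit) norm_ge_zero)
  show "cmod ((2 * \<mu> * q1 t - (\<sigma> t)\<^sup>2 - \<mu>\<^sup>2) * y - \<sigma> t * z) \<le> kappa R t * (cmod y + cmod z)" using 4 by (smt (verit) norm_ge_zero)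
qed

text \<open>The base is twice the integral of \<open>kappa R\<close> because each of the two
  components is estimated separately by the full right-hand side.\<close>

lemma picard_bound:
  assumes "cmod \<mu> \<le> R" "x \<in> {0..pi}"
  shows "cmod (fst (picard \<alpha> \<beta> n) \<mu> x) + cmod (snd (picard \<alpha> \<beta> n) \<mu> x) \<le>
    (cmod \<alpha> + cmod \<beta>) * (2 * integral {0..x} (kappa R)) ^ n / fact n"
  using assms(2)
proof (induction n arbitrary: x)
  case 0
  show ?case by simp
next
  case (Suc n)
  define f g where "f = fst (picard \<alpha> \<beta> n) \<mu>" and "g = snd (picard \<alpha> \<beta> n) \<mu>"
  have cont: "continuous_on {0..pi} f" "continuous_on {0..pi} g"
    using poly_cont_picard poly_cont_continuous_on by (auto simp: f_def g_def)
  define N where "N = (\<lambda>x. integral {0..x} (kappa R))"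
  define c where "c = cmod \<alpha> + cmod \<beta>"
  have IH: "cmod (f t) + cmod (g t) \<le> c * (2 * N t) ^ n / fact n" if "t \<in> {0..pi}" for t
    using Suc.IH[OF that] by (simp add: f_def g_def N_def c_def)
  have k0: "kappa R t \<ge> 0" for t using kappa_nonneg norm_ge_zero order_trans assms(1) by blast
  have hi: "((\<lambda>t. (c * 2 ^ n) * (kappa R t * (N t ^ n / fact n))) has_integral (c * 2 ^ n) * (N x ^ Suc n / fact (Suc n))) {0..x}"
    unfolding N_def by (rule has_integral_mult_right[OF integral_primitive_power[OF kappa_integrable Suc.prems]])
  have b: "kappa R t * (cmod (f t) + cmod (g t)) \<le> (c * 2 ^ n) * (kappa R t * (N t ^ n / fact n))" if "t \<in> {0..x}" for t
  proof -
    have "kappa R t * (cmod (f t) + cmod (g t)) \<le> kappa R t * (c * (2 * N t) ^ n / fact n)"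
      using that Suc.prems by (intro mult_left_mono IH k0) auto
    thus ?thesis by (simp add: power_mult_distrib field_simps)
  qed
  have "cmod (integral {0..x} (rhs0 \<sigma> f g)) \<le> integral {0..x} (\<lambda>t. (c * 2 ^ n) * (kappa R t * (N t ^ n / fact n)))"
    by (rule integral_norm_bound_integral[OF absolutely_integrable_imp_integrable[OF coeff_integrable(7)[OF cont Suc.prems] Suc.prems] has_integral_integrable[OF hi]])
       (rule order_trans[OF coeff_bound(1)[OF assms(1)] b])
  moreover have "cmod (integral {0..x} (rhs1 \<sigma> q1 \<mu> f g)) \<le> integral {0..x} (\<lambda>t. (c * 2 ^ n) * (kappa R t * (N t ^ n / fact n)))"
    by (rule integral_norm_bound_integral[OF absolutely_integrable_imp_integrable[OF coeff_integrable(8)[OF cont Suc.prems] Suc.prems] has_integral_integrable[OF hi]])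
       (rule order_trans[OF coeff_bound(2)[OF assms(1)] b])
  moreover have "integral {0..x} (\<lambda>t. (c * 2 ^ n) * (kappa R t * (N t ^ n / fact n))) = (c * 2 ^ n) * (N x ^ Suc n / fact (Suc n))"
    by (rule integral_unique[OF hi])
  ultimately have "cmod (integral {0..x} (rhs0 \<sigma> f g)) + cmod (integral {0..x} (rhs1 \<sigma> q1 \<mu> f g))
     \<le> 2 * ((c * 2 ^ n) * (N x ^ Suc n / fact (Suc n)))" by linarith
  also have "\<dots> = c * (2 * N x) ^ Suc n / fact (Suc n)" unfolding power_mult_distrib by simp
  finally show ?case unfolding f_def g_def N_def c_def by simp
qed

definition Ysol where "Ysol \<alpha> \<beta> \<mu> x = (\<Sum>n. fst (picard \<alpha> \<beta> n) \<mu> x)"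
definition Zsol where "Zsol \<alpha> \<beta> \<mu> x = (\<Sum>n. snd (picard \<alpha> \<beta> n) \<mu> x)"

text \<open>Convergence is uniform jointly in \<mu> and \<open>x\<close>, so that sections in
  \<open>x\<close> yield continuity of the solutions and sections in \<mu> yield holomorphy.\<close>

lemma picard_uniform:
  "uniform_limit (cball 0 R \<times> {0..pi}) (\<lambda>n (\<mu>,x). \<Sum>i<n. fst (picard \<alpha> \<beta> i) \<mu> x) (\<lambda>(\<mu>,x). Ysol \<alpha> \<beta> \<mu> x) sequentially"
  "uniform_limit (cball 0 R \<times> {0..pi}) (\<lambda>n (\<mu>,x). \<Sum>i<n. snd (picard \<alpha> \<beta> i) \<mu> x) (\<lambda>(\<mu>,x). Zsol \<alpha> \<beta> \<mu> x) sequentially"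
proof -
  define c where "c = cmod \<alpha> + cmod \<beta>"
  define N where "N = integral {0..pi} (kappa R)"
  define M where "M = (\<lambda>n. c * ((2 * N) ^ n /\<^sub>R fact n))"
  have sM: "summable M" unfolding M_def by (intro summable_mult summable_exp_generic)
  have bd: "cmod (fst (picard \<alpha> \<beta> n) \<mu> x) \<le> M n \<and> cmod (snd (picard \<alpha> \<beta> n) \<mu> x) \<le> M n" if "(\<mu>,x) \<in> cball 0 R \<times> {0..pi}" for n \<mu> x
  proof -
    have mx: "cmod \<mu> \<le> R" "x \<in> {0..pi}" using that by auto
    have k0: "kappa R t \<ge> 0" for t using kappa_nonneg norm_ge_zero order_trans mx(1) by blast
    have "integral {0..x} (kappa R) \<le> N" unfolding N_def
      using mx(2) k0 by (intro integral_subset_le absolutely_integrable_imp_integrable[OF kappa_integrable]) auto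
    moreover have "integral {0..x} (kappa R) \<ge> 0" by (intro Henstock_Kurzweil_Integration.integral_nonneg absolutely_integrable_imp_integrable[OF kappa_integrable] mx k0)
    ultimately have "(2 * integral {0..x} (kappa R)) ^ n \<le> (2 * N) ^ n" by (intro power_mono) auto
    hence "c * (2 * integral {0..x} (kappa R)) ^ n / fact n \<le> c * (2 * N) ^ n / fact n"
      by (intro divide_right_mono mult_left_mono) (auto simp: c_def)
    also have "\<dots> = M n" by (simp add: M_def field_simps)
    finally show ?thesis using picard_bound[OF mx, of \<alpha> \<beta> n] unfolding c_def by (smt (verit) norm_ge_zero)
  qed
  show "uniform_limit (cball 0 R \<times> {0..pi}) (\<lambda>n (\<mu>,x). \<Sum>i<n. fst (picard \<alpha> \<beta> i) \<mu> x) (\<lambda>(\<mu>,x). Ysol \<alpha> \<beta> \<mu> x) sequentially"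
    using Weierstrass_m_test[of "cball 0 R \<times> {0..pi}" "\<lambda>n (\<mu>,x). fst (picard \<alpha> \<beta> n) \<mu> x" M] bd sM
    unfolding Ysol_def case_prod_unfold by auto
  show "uniform_limit (cball 0 R \<times> {0..pi}) (\<lambda>n (\<mu>,x). \<Sum>i<n. snd (picard \<alpha> \<beta> i) \<mu> x) (\<lambda>(\<mu>,x). Zsol \<alpha> \<beta> \<mu> x) sequentially"
    using Weierstrass_m_test[of "cball 0 R \<times> {0..pi}" "\<lambda>n (\<mu>,x). snd (picard \<alpha> \<beta> n) \<mu> x" M] bd sM
    unfolding Zsol_def case_prod_unfold by auto
qed

lemma sol_holomorphic:
  assumes "x \<in> {0..pi}"
  shows "(\<lambda>\<mu>. Ysol \<alpha> \<beta> \<mu> x) holomorphic_on UNIV" "(\<lambda>\<mu>. Zsol \<alpha> \<beta> \<mu> x) holomorphic_on UNIV"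
proof -
  have sub: "\<exists>d>0. cball z d \<subseteq> UNIV \<and> uniform_limit (cball z d) f g sequentially"
    if "\<And>R. uniform_limit (cball 0 R) f g sequentially" for z :: complex and f :: "nat \<Rightarrow> complex \<Rightarrow> complex" and g
  proof (intro exI[of _ 1] conjI)
    show "uniform_limit (cball z 1) f g sequentially"
    proof (rule uniform_limit_on_subset[OF that[of "cmod z + 1"]])
      show "cball z 1 \<subseteq> cball 0 (cmod z + 1)" by (auto simp: dist_norm) (smt (verit) norm_minus_commute norm_triangle_sub)
    qed
  qed auto
  show "(\<lambda>\<mu>. Ysol \<alpha> \<beta> \<mu> x) holomorphic_on UNIV"
  proof (rule holomorphic_uniform_sequence[OF open_UNIV])
    show "(\<lambda>\<mu>. \<Sum>i<n. fst (picard \<alpha> \<beta> i) \<mu> x) holomorphic_on UNIV" for n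
      by (intro holomorphic_on_sum poly_cont_holomorphic_on assms) (use poly_cont_picard in auto)
    show "\<exists>d>0. cball z d \<subseteq> UNIV \<and> uniform_limit (cball z d) (\<lambda>n \<mu>. \<Sum>i<n. fst (picard \<alpha> \<beta> i) \<mu> x) (\<lambda>\<mu>. Ysol \<alpha> \<beta> \<mu> x) sequentially" for z
      by (rule sub, rule uniform_limit_section(2)[OF picard_uniform(1) assms])
  qed
  show "(\<lambda>\<mu>. Zsol \<alpha> \<beta> \<mu> x) holomorphic_on UNIV"
  proof (rule holomorphic_uniform_sequence[OF open_UNIV])
    show "(\<lambda>\<mu>. \<Sum>i<n. snd (picard \<alpha> \<beta> i) \<mu> x) holomorphic_on UNIV" for n
      by (intro holomorphic_on_sum poly_cont_holomorphic_on assms) (use poly_cont_picard in auto)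
    show "\<exists>d>0. cball z d \<subseteq> UNIV \<and> uniform_limit (cball z d) (\<lambda>n \<mu>. \<Sum>i<n. snd (picard \<alpha> \<beta> i) \<mu> x) (\<lambda>\<mu>. Zsol \<alpha> \<beta> \<mu> x) sequentially" for z
      by (rule sub, rule uniform_limit_section(2)[OF picard_uniform(2) assms])
  qed
qed

text \<open>The partial sums satisfy the equation with the index shifted by one, and dominated
  convergence passes to the limit; the majorant is \<open>kappa R\<close> times a common bound of
  the partial sums.\<close>

lemma sol_integral_equation:
  assumes x: "x \<in> {0..pi}"
  shows "Ysol \<alpha> \<beta> \<mu> x = \<alpha> + integral {0..x} (rhs0 \<sigma> (Ysol \<alpha> \<beta> \<mu>) (Zsol \<alpha> \<beta> \<mu>))"
    "Zsol \<alpha> \<beta> \<mu> x = \<beta> + integral {0..x} (rhs1 \<sigma> q1 \<mu> (Ysol \<alpha> \<beta> \<mu>) (Zsol \<alpha> \<beta> \<mu>))"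
    "continuous_on {0..pi} (Ysol \<alpha> \<beta> \<mu>)" "continuous_on {0..pi} (Zsol \<alpha> \<beta> \<mu>)"
proof -
  define R where "R = cmod \<mu>"
  define f where "f = (\<lambda>n x. \<Sum>i<n. fst (picard \<alpha> \<beta> i) \<mu> x)"
  define g where "g = (\<lambda>n x. \<Sum>i<n. snd (picard \<alpha> \<beta> i) \<mu> x)"
  define Y Z where "Y = Ysol \<alpha> \<beta> \<mu>" and "Z = Zsol \<alpha> \<beta> \<mu>"
  have m: "\<mu> \<in> cball 0 R" by (simp add: R_def)
  have ul: "uniform_limit {0..pi} f Y sequentially" "uniform_limit {0..pi} g Z sequentially"
    using uniform_limit_section(1)[OF picard_uniform(1)[where R=R and \<alpha>=\<alpha> and \<beta>=\<beta>] m] uniform_limit_section(1)[OF picard_uniform(2)[where R=R and \<alpha>=\<alpha> and \<beta>=\<beta>] m]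
    unfolding f_def g_def Y_def Z_def by simp_all
  have cp: "continuous_on {0..pi} (fst (picard \<alpha> \<beta> i) \<mu>)" "continuous_on {0..pi} (snd (picard \<alpha> \<beta> i) \<mu>)" for i
    using poly_cont_picard poly_cont_continuous_on by blast+
  have cf: "continuous_on {0..pi} (f n)" "continuous_on {0..pi} (g n)" for n
    unfolding f_def g_def using cp by (auto intro!: continuous_on_sum)
  show cY: "continuous_on {0..pi} (Ysol \<alpha> \<beta> \<mu>)" and cZ: "continuous_on {0..pi} (Zsol \<alpha> \<beta> \<mu>)"
    using uniform_limit_theorem[OF _ ul(1)] uniform_limit_theorem[OF _ ul(2)] cf unfolding Y_def Z_def by auto
  have ptw: "(\<lambda>n. f n t) \<longlonglongrightarrow> Y t" "(\<lambda>n. g n t) \<longlonglongrightarrow> Z t" if "t \<in> {0..pi}" for t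
    using tendsto_uniform_limitI[OF ul(1) that] tendsto_uniform_limitI[OF ul(2) that] by auto
  obtain B where B: "\<And>t. t \<in> {0..pi} \<Longrightarrow> cmod (Y t) + cmod (Z t) \<le> B"
  proof -
    have "compact ((\<lambda>t. cmod (Y t) + cmod (Z t)) ` {0..pi})" using cY cZ unfolding Y_def Z_def by (intro compact_continuous_image continuous_intros) auto
    then obtain B where "\<forall>y\<in>(\<lambda>t. cmod (Y t) + cmod (Z t)) ` {0..pi}. norm y \<le> B" using compact_imp_bounded bounded_iff by metis
    thus ?thesis using that[of B] by auto
  qed
  have "\<forall>\<^sub>F n in sequentially. (\<forall>t\<in>{0..pi}. dist (f n t) (Y t) < 1) \<and> (\<forall>t\<in>{0..pi}. dist (g n t) (Z t) < 1)"
    by (intro eventually_conj uniform_limitD[OF ul(1)] uniform_limitD[OF ul(2)]) auto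
  \<comment> \<open>Only a tail of the partial sums is known to stay within 1 of the limit. Each of
    the two components contributes such a 1, hence the bound \<open>B + 2\<close> below.\<close>
  then obtain n0 where n0: "\<And>n t. n \<ge> n0 \<Longrightarrow> t \<in> {0..pi} \<Longrightarrow> dist (f n t) (Y t) < 1 \<and> dist (g n t) (Z t) < 1"
    unfolding eventually_sequentially by blast
  have fgB: "cmod (f (n + n0) t) + cmod (g (n + n0) t) \<le> B + 2" if t: "t \<in> {0..pi}" for t n
  proof -
    have "cmod (f (n + n0) t) \<le> cmod (Y t) + 1" "cmod (g (n + n0) t) \<le> cmod (Z t) + 1"
      using n0[OF _ t, of "n + n0"] norm_triangle_sub[of "f (n + n0) t" "Y t"] norm_triangle_sub[of "g (n + n0) t" "Z t"]
      by (auto simp: dist_norm)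
    thus ?thesis using B[OF t] by linarith
  qed
  have k0: "kappa R t \<ge> 0" for t by (auto simp: kappa_def R_def)
  have kB: "(\<lambda>t. kappa R t * (B + 2)) integrable_on {0..x}"
    using absolutely_integrable_imp_integrable[OF kappa_integrable x, of R] by (intro integrable_on_mult_left)
  note ii = absolutely_integrable_imp_integrable[OF _ x]
  have stepf: "f (Suc n) x = \<alpha> + integral {0..x} (rhs0 \<sigma> (f n) (g n))" for n
  proof -
    have "f (Suc n) x = \<alpha> + (\<Sum>i<n. integral {0..x} (rhs0 \<sigma> (fst (picard \<alpha> \<beta> i) \<mu>) (snd (picard \<alpha> \<beta> i) \<mu>)))"
      unfolding f_def by (subst sum.lessThan_Suc_shift) simp
    also have "(\<Sum>i<n. integral {0..x} (rhs0 \<sigma> (fst (picard \<alpha> \<beta> i) \<mu>) (snd (picard \<alpha> \<beta> i) \<mu>))) =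
       integral {0..x} (\<lambda>t. \<Sum>i<n. \<sigma> t * fst (picard \<alpha> \<beta> i) \<mu> t + snd (picard \<alpha> \<beta> i) \<mu> t)"
      using poly_cont_picard by (subst Henstock_Kurzweil_Integration.integral_sum) (auto intro!: ii coeff_integrable poly_cont_continuous_on)
    finally show ?thesis by (simp add: f_def g_def sum_distrib_left sum.distrib)
  qed
  have stepg: "g (Suc n) x = \<beta> + integral {0..x} (rhs1 \<sigma> q1 \<mu> (f n) (g n))" for n
  proof -
    have "g (Suc n) x = \<beta> + (\<Sum>i<n. integral {0..x} (rhs1 \<sigma> q1 \<mu> (fst (picard \<alpha> \<beta> i) \<mu>) (snd (picard \<alpha> \<beta> i) \<mu>)))"
      unfolding g_def by (subst sum.lessThan_Suc_shift) simp
    also have "(\<Sum>i<n. integral {0..x} (rhs1 \<sigma> q1 \<mu> (fst (picard \<alpha> \<beta> i) \<mu>) (snd (picard \<alpha> \<beta> i) \<mu>))) =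
       integral {0..x} (\<lambda>t. \<Sum>i<n. (2 * \<mu> * q1 t - (\<sigma> t)\<^sup>2 - \<mu>\<^sup>2) * fst (picard \<alpha> \<beta> i) \<mu> t - \<sigma> t * snd (picard \<alpha> \<beta> i) \<mu> t)"
      using poly_cont_picard by (subst Henstock_Kurzweil_Integration.integral_sum) (auto intro!: ii coeff_integrable poly_cont_continuous_on)
    finally show ?thesis by (simp add: f_def g_def sum_distrib_left sum_subtractf)
  qed
  have "(\<lambda>n. \<alpha> + integral {0..x} (rhs0 \<sigma> (f (n + n0)) (g (n + n0)))) \<longlonglongrightarrow> \<alpha> + integral {0..x} (rhs0 \<sigma> Y Z)"
  proof (rule tendsto_add[OF tendsto_const dominated_convergence(2)[OF _ kB]])
    show "(rhs0 \<sigma> (f (n + n0)) (g (n + n0))) integrable_on {0..x}" for n by (rule ii[OF coeff_integrable(7)[OF cf x]])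
    show "norm (\<sigma> t * f (n + n0) t + g (n + n0) t) \<le> kappa R t * (B + 2)" if "t \<in> {0..x}" for n t
      using that x by (intro order_trans[OF coeff_bound(1)[of \<mu> R] mult_left_mono[OF fgB k0]]) (auto simp: R_def)
    show "(\<lambda>n. \<sigma> t * f (n + n0) t + g (n + n0) t) \<longlonglongrightarrow> \<sigma> t * Y t + Z t" if "t \<in> {0..x}" for t
      using that x by (intro tendsto_intros LIMSEQ_ignore_initial_segment ptw) auto
  qed
  moreover have "(\<lambda>n. f (Suc (n + n0)) x) \<longlonglongrightarrow> Y x"
    using LIMSEQ_ignore_initial_segment[OF ptw(1)[OF x], of "Suc n0"] by simp
  ultimately show "Ysol \<alpha> \<beta> \<mu> x = \<alpha> + integral {0..x} (rhs0 \<sigma> (Ysol \<alpha> \<beta> \<mu>) (Zsol \<alpha> \<beta> \<mu>))"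
    unfolding stepf Y_def Z_def using LIMSEQ_unique by blast
  have "(\<lambda>n. \<beta> + integral {0..x} (rhs1 \<sigma> q1 \<mu> (f (n + n0)) (g (n + n0)))) \<longlonglongrightarrow>
     \<beta> + integral {0..x} (rhs1 \<sigma> q1 \<mu> Y Z)"
  proof (rule tendsto_add[OF tendsto_const dominated_convergence(2)[OF _ kB]])
    show "(rhs1 \<sigma> q1 \<mu> (f (n + n0)) (g (n + n0))) integrable_on {0..x}" for n
      by (rule ii[OF coeff_integrable(8)[OF cf x]])
    show "norm ((2 * \<mu> * q1 t - (\<sigma> t)\<^sup>2 - \<mu>\<^sup>2) * f (n + n0) t - \<sigma> t * g (n + n0) t) \<le> kappa R t * (B + 2)" if "t \<in> {0..x}" for n t
      using that x by (intro order_trans[OF coeff_bound(2)[of \<mu> R] mult_left_mono[OF fgB k0]]) (auto simp: R_def)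
    show "(\<lambda>n. (2 * \<mu> * q1 t - (\<sigma> t)\<^sup>2 - \<mu>\<^sup>2) * f (n + n0) t - \<sigma> t * g (n + n0) t) \<longlonglongrightarrow>
       (2 * \<mu> * q1 t - (\<sigma> t)\<^sup>2 - \<mu>\<^sup>2) * Y t - \<sigma> t * Z t" if "t \<in> {0..x}" for t
      using that x by (intro tendsto_intros LIMSEQ_ignore_initial_segment ptw) auto
  qed
  moreover have "(\<lambda>n. g (Suc (n + n0)) x) \<longlonglongrightarrow> Z x"
    using LIMSEQ_ignore_initial_segment[OF ptw(2)[OF x], of "Suc n0"] by simp
  ultimately show "Zsol \<alpha> \<beta> \<mu> x = \<beta> + integral {0..x} (rhs1 \<sigma> q1 \<mu> (Ysol \<alpha> \<beta> \<mu>) (Zsol \<alpha> \<beta> \<mu>))"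
    unfolding stepg Y_def Z_def using LIMSEQ_unique by blast
qed

lemma sol_initial: "Ysol \<alpha> \<beta> \<mu> 0 = \<alpha>" "Zsol \<alpha> \<beta> \<mu> 0 = \<beta>"
  using sol_integral_equation(1,2)[of 0 \<alpha> \<beta> \<mu>] by auto

lemma sol_is_solution: "is_solution \<sigma> q1 \<mu> (Ysol \<alpha> \<beta> \<mu>) (Zsol \<alpha> \<beta> \<mu>)"
  unfolding is_solution_iff
proof
  have z: "(0::real) \<in> {0..pi}" by simp
  note c = sol_integral_equation(3,4)[OF z, of \<alpha> \<beta> \<mu>]
  have *: "ac_deriv (\<lambda>x. c + integral {0..x} f) f" if "f absolutely_integrable_on {0..pi}" for f c
    using ac_deriv_add[OF ac_deriv_const[of c] ac_deriv_integral[OF that]] by simp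
  show "ac_deriv (Ysol \<alpha> \<beta> \<mu>) (rhs0 \<sigma> (Ysol \<alpha> \<beta> \<mu>) (Zsol \<alpha> \<beta> \<mu>))"
    by (rule ac_deriv_cong[OF *[of _ \<alpha>]], rule coeff_integrable(7)[OF c z])
       (use sol_integral_equation(1)[of _ \<alpha> \<beta> \<mu>] in auto)
  show "ac_deriv (Zsol \<alpha> \<beta> \<mu>) (rhs1 \<sigma> q1 \<mu> (Ysol \<alpha> \<beta> \<mu>) (Zsol \<alpha> \<beta> \<mu>))"
    by (rule ac_deriv_cong[OF *[of _ \<beta>]], rule coeff_integrable(8)[OF c z])
       (use sol_integral_equation(2)[of _ \<alpha> \<beta> \<mu>] in auto)
qed

end

section \<open>Gronwall estimate, Wronskian and uniqueness\<close>

text \<open>Gronwall's inequality: with \<open>H\<close> a primitive of \<open>h\<close>, the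
  product \<open>E * exp (- H)\<close> decreases and \<open>E * exp H\<close> increases. The second
  inequality allows estimates to run backwards from \<open>pi\<close> as well as forwards from
  \<open>0\<close>.\<close>

lemma energy_estimate:
  fixes h :: "real \<Rightarrow> real"
  assumes a: "ac_deriv a a'" and b: "ac_deriv b b'" and h: "h absolutely_integrable_on {0..pi}"
    and bound: "AE x in lebesgue_on {0<..<pi}. \<bar>2 * Re (a' x * cnj (a x) + b' x * cnj (b x))\<bar> \<le> h x * ((cmod (a x))\<^sup>2 + (cmod (b x))\<^sup>2)"
    and st: "0 \<le> s" "s \<le> t" "t \<le> pi"
  shows "(cmod (a t))\<^sup>2 + (cmod (b t))\<^sup>2 \<le> ((cmod (a s))\<^sup>2 + (cmod (b s))\<^sup>2) * exp (integral {s..t} h)"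
    "(cmod (a s))\<^sup>2 + (cmod (b s))\<^sup>2 \<le> ((cmod (a t))\<^sup>2 + (cmod (b t))\<^sup>2) * exp (integral {s..t} h)"
proof -
  define E where "E = (\<lambda>x. (cmod (a x))\<^sup>2 + (cmod (b x))\<^sup>2)"
  define H where "H = (\<lambda>x. integral {0..x} h)"
  have "h integrable_on {0..t}" using absolutely_integrable_imp_integrable[OF h] st by auto
  from Henstock_Kurzweil_Integration.integral_combine[OF st(1,2) this]
  have Hd: "integral {s..t} h = H t - H s" by (simp add: H_def)
  have HH: "ac_deriv (\<lambda>x. complex_of_real (H x)) (\<lambda>x. complex_of_real (h x))"
    unfolding H_def by (rule real_primitive_ac_deriv[OF h])
  define w where "w = (\<lambda>x. 2 * Re (a' x * cnj (a x) + b' x * cnj (b x)))"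
  have E: "ac_deriv (\<lambda>x. complex_of_real (E x)) (\<lambda>x. complex_of_real (w x))"
  proof (rule ac_deriv_cong[OF ac_deriv_add[OF ac_deriv_mult[OF a ac_deriv_cnj[OF a]] ac_deriv_mult[OF b ac_deriv_cnj[OF b]]]])
    show "a x * cnj (a x) + b x * cnj (b x) = complex_of_real (E x)" for x
      by (simp add: E_def complex_norm_square[symmetric])
    show "AE x in lebesgue_on {0<..<pi}. a x * cnj (a' x) + a' x * cnj (a x) + (b x * cnj (b' x) + b' x * cnj (b x)) =
        complex_of_real (w x)"
      by (intro always_eventually allI) (simp add: complex_eq_iff w_def)
  qed
  have P: "ac_deriv (\<lambda>x. complex_of_real (E x * exp (c * H x))) (\<lambda>x. complex_of_real ((c * h x * E x + w x) * exp (c * H x)))" for c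
    by (rule ac_deriv_cong[OF ac_deriv_mult[OF E ac_deriv_exp[OF ac_deriv_cmult[OF HH, of "complex_of_real c"]]]])
       (simp_all add: exp_of_real[symmetric] algebra_simps)
  have mono: "E t * exp (-1 * H t) \<le> E s * exp (-1 * H s)"
  proof -
    have "AE x in lebesgue_on {0<..<pi}. Re (complex_of_real ((-1 * h x * E x + w x) * exp (-1 * H x))) \<le> 0"
      using bound by eventually_elim (auto simp: w_def E_def intro!: mult_nonpos_nonneg)
    from ac_deriv_antimono[OF P this st] show ?thesis by simp
  qed
  have mono2: "E s * exp (1 * H s) \<le> E t * exp (1 * H t)"
  proof -
    have "AE x in lebesgue_on {0<..<pi}. Re (-1 * complex_of_real ((1 * h x * E x + w x) * exp (1 * H x))) \<le> 0"
      using bound by eventually_elim (auto simp: w_def E_def intro!: mult_nonneg_nonneg)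
    from ac_deriv_antimono[OF ac_deriv_cmult[OF P] this st] show ?thesis by simp
  qed
  have "E t = E t * exp (-1 * H t) * exp (H t)" by (simp add: mult.assoc exp_add[symmetric])
  also have "\<dots> \<le> E s * exp (-1 * H s) * exp (H t)" by (intro mult_right_mono mono) auto
  also have "\<dots> = E s * exp (integral {s..t} h)" unfolding Hd by (simp add: mult.assoc exp_add[symmetric])
  finally show "(cmod (a t))\<^sup>2 + (cmod (b t))\<^sup>2 \<le> ((cmod (a s))\<^sup>2 + (cmod (b s))\<^sup>2) * exp (integral {s..t} h)" by (simp add: E_def)
  have "E s = E s * exp (1 * H s) * exp (- H s)" by (simp add: mult.assoc exp_add[symmetric])
  also have "\<dots> \<le> E t * exp (1 * H t) * exp (- H s)" by (intro mult_right_mono mono2) auto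
  also have "\<dots> = E t * exp (integral {s..t} h)" unfolding Hd by (simp add: mult.assoc exp_add[symmetric])
  finally show "(cmod (a s))\<^sup>2 + (cmod (b s))\<^sup>2 \<le> ((cmod (a t))\<^sup>2 + (cmod (b t))\<^sup>2) * exp (integral {s..t} h)" by (simp add: E_def)
qed

lemma is_solution_lincomb:
  assumes "is_solution \<sigma> q1 \<mu> y y1" "is_solution \<sigma> q1 \<mu> z z1"
  shows "is_solution \<sigma> q1 \<mu> (\<lambda>x. c * y x + d * z x) (\<lambda>x. c * y1 x + d * z1 x)"
proof -
  have y: "ac_deriv y (rhs0 \<sigma> y y1)" "ac_deriv y1 (rhs1 \<sigma> q1 \<mu> y y1)"
   and z: "ac_deriv z (rhs0 \<sigma> z z1)" "ac_deriv z1 (rhs1 \<sigma> q1 \<mu> z z1)"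
    using assms by (auto simp: is_solution_iff)
  show ?thesis unfolding is_solution_iff
    using ac_deriv_add[OF ac_deriv_cmult[OF y(1)] ac_deriv_cmult[OF z(1)], of c d]
      ac_deriv_add[OF ac_deriv_cmult[OF y(2)] ac_deriv_cmult[OF z(2)], of c d] by (simp add: algebra_simps)
qed

lemma ac_deriv_zero_imp_const:
  assumes "ac_deriv f (\<lambda>x. 0)" "x \<in> {0..pi}"
  shows "f x = f 0"
  using ac_deriv_has_integral[OF assms(1), of 0 x] assms(2) by (auto simp: has_integral_0_eq)

text \<open>The coefficient matrix of the first-order system has trace zero, its diagonal entries
  being \<open>\<sigma>\<close> and \<open>- \<sigma>\<close>.\<close>

lemma wronskian_const:
  assumes "is_solution \<sigma> q1 \<mu> y y1" "is_solution \<sigma> q1 \<mu> z z1" "x \<in> {0..pi}"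
  shows "y x * z1 x - y1 x * z x = y 0 * z1 0 - y1 0 * z 0"
proof -
  have y: "ac_deriv y (rhs0 \<sigma> y y1)" "ac_deriv y1 (rhs1 \<sigma> q1 \<mu> y y1)"
   and z: "ac_deriv z (rhs0 \<sigma> z z1)" "ac_deriv z1 (rhs1 \<sigma> q1 \<mu> z z1)"
    using assms by (auto simp: is_solution_iff)
  have "ac_deriv (\<lambda>x. y x * z1 x - y1 x * z x) (\<lambda>x. 0)"
    by (rule ac_deriv_cong[OF ac_deriv_diff[OF ac_deriv_mult[OF y(1) z(2)] ac_deriv_mult[OF y(2) z(1)]]])
       (auto simp: algebra_simps)
  from ac_deriv_zero_imp_const[OF this assms(3)] show ?thesis .
qed

context pencil begin

lemma solution_zero:
  assumes y: "is_solution \<sigma> q1 \<mu> y y1" and 0: "y 0 = 0" "y1 0 = 0" and x: "x \<in> {0..pi}"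
  shows "y x = 0 \<and> y1 x = 0"
proof -
  define R where "R = cmod \<mu>"
  have k0: "kappa R t \<ge> 0" for t by (rule kappa_nonneg) (simp add: R_def)
  \<comment> \<open>In the factor 4, one 2 comes from differentiating a squared modulus, the other
    from \<open>(u + v)\<^sup>2 \<le> 2 * (u\<^sup>2 + v\<^sup>2)\<close>.\<close>
  have "(cmod (y x))\<^sup>2 + (cmod (y1 x))\<^sup>2 \<le> ((cmod (y 0))\<^sup>2 + (cmod (y1 0))\<^sup>2) * exp (integral {0..x} (\<lambda>t. 4 * kappa R t))"
  proof (rule energy_estimate(1))
    show "ac_deriv y (rhs0 \<sigma> y y1)" "ac_deriv y1 (rhs1 \<sigma> q1 \<mu> y y1)"
      using y by (auto simp: is_solution_iff)
    show "(\<lambda>t. 4 * kappa R t) absolutely_integrable_on {0..pi}" by (intro set_integrable_mult_right kappa_integrable)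
    have "\<bar>2 * Re ((\<sigma> x * y x + y1 x) * cnj (y x) + ((2 * \<mu> * q1 x - (\<sigma> x)\<^sup>2 - \<mu>\<^sup>2) * y x - \<sigma> x * y1 x) * cnj (y1 x))\<bar>
        \<le> 4 * kappa R x * ((cmod (y x))\<^sup>2 + (cmod (y1 x))\<^sup>2)" for x
    proof -
      define u v where "u = \<sigma> x * y x + y1 x" and "v = (2 * \<mu> * q1 x - (\<sigma> x)\<^sup>2 - \<mu>\<^sup>2) * y x - \<sigma> x * y1 x"
      have cb: "cmod u + cmod v \<le> kappa R x * (cmod (y x) + cmod (y1 x))"
        unfolding u_def v_def by (rule coeff_bound(3)) (simp add: R_def)
      have "\<bar>Re (u * cnj (y x) + v * cnj (y1 x))\<bar> \<le> cmod (u * cnj (y x) + v * cnj (y1 x))" by (rule abs_Re_le_cmod)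
      also have "\<dots> \<le> cmod u * cmod (y x) + cmod v * cmod (y1 x)" 
        by (rule order_trans[OF norm_triangle_ineq]) (simp add: norm_mult)
      also have "\<dots> \<le> (cmod u + cmod v) * (cmod (y x) + cmod (y1 x))" by (simp add: algebra_simps)
      also have "\<dots> \<le> (kappa R x * (cmod (y x) + cmod (y1 x))) * (cmod (y x) + cmod (y1 x))"
        by (intro mult_right_mono cb) auto
      also have "\<dots> = kappa R x * (cmod (y x) + cmod (y1 x))\<^sup>2" by (simp add: power2_eq_square)
      also have "\<dots> \<le> kappa R x * (2 * ((cmod (y x))\<^sup>2 + (cmod (y1 x))\<^sup>2))"
        using sum_squares_bound[of "cmod (y x)" "cmod (y1 x)"] by (intro mult_left_mono k0) (simp add: power2_sum)
      finally have "\<bar>Re (u * cnj (y x) + v * cnj (y1 x))\<bar> \<le> kappa R x * (2 * ((cmod (y x))\<^sup>2 + (cmod (y1 x))\<^sup>2))" .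
      moreover have "\<bar>2 * r\<bar> \<le> 4 * k * e" if "\<bar>r\<bar> \<le> k * (2 * e)" for r k e :: real
        using that by (simp add: abs_mult mult_ac)
      ultimately have "\<bar>2 * Re (u * cnj (y x) + v * cnj (y1 x))\<bar> \<le> 4 * kappa R x * ((cmod (y x))\<^sup>2 + (cmod (y1 x))\<^sup>2)"
        by blast
      thus ?thesis unfolding u_def v_def .
    qed
    thus "AE x in lebesgue_on {0<..<pi}. \<bar>2 * Re ((\<sigma> x * y x + y1 x) * cnj (y x) + ((2 * \<mu> * q1 x - (\<sigma> x)\<^sup>2 - \<mu>\<^sup>2) * y x - \<sigma> x * y1 x) * cnj (y1 x))\<bar>
        \<le> 4 * kappa R x * ((cmod (y x))\<^sup>2 + (cmod (y1 x))\<^sup>2)" by simp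
  qed (use x in auto)
  hence "(cmod (y x))\<^sup>2 + (cmod (y1 x))\<^sup>2 \<le> 0" using 0 by simp
  thus ?thesis by (simp add: sum_power2_le_zero_iff)
qed

lemma solution_unique:
  assumes y: "is_solution \<sigma> q1 \<mu> y y1" and x: "x \<in> {0..pi}"
  shows "y x = Ysol (y 0) (y1 0) \<mu> x" "y1 x = Zsol (y 0) (y1 0) \<mu> x"
  using solution_zero[OF is_solution_lincomb[OF y sol_is_solution[of \<mu> "y 0" "y1 0"], of 1 "-1"] _ _ x]
  by (auto simp: sol_initial)

definition "S \<mu> x = Ysol 0 1 \<mu> x"
definition "S1 \<mu> x = Zsol 0 1 \<mu> x"
definition "C \<mu> x = Ysol 1 0 \<mu> x"
definition "C1 \<mu> x = Zsol 1 0 \<mu> x"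

lemma S_solution: "is_solution \<sigma> q1 \<mu> (S \<mu>) (S1 \<mu>)" and C_solution: "is_solution \<sigma> q1 \<mu> (C \<mu>) (C1 \<mu>)"
  using sol_is_solution by (simp_all add: S_def[abs_def] S1_def[abs_def] C_def[abs_def] C1_def[abs_def])

lemma SC_initial [simp]: "S \<mu> 0 = 0" "S1 \<mu> 0 = 1" "C \<mu> 0 = 1" "C1 \<mu> 0 = 0"
  by (simp_all add: S_def S1_def C_def C1_def sol_initial)

lemma SC_holomorphic:
  assumes "x \<in> {0..pi}"
  shows "(\<lambda>\<mu>. S \<mu> x) holomorphic_on UNIV" "(\<lambda>\<mu>. C \<mu> x) holomorphic_on UNIV"
  using sol_holomorphic(1)[OF assms] by (simp_all add: S_def C_def)

lemma SC_wronskian: "x \<in> {0..pi} \<Longrightarrow> C \<mu> x * S1 \<mu> x - C1 \<mu> x * S \<mu> x = 1"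
  using wronskian_const[OF C_solution S_solution] by simp

lemma solution_eq_lincomb:
  assumes y: "is_solution \<sigma> q1 \<mu> y y1" and x: "x \<in> {0..pi}"
  shows "y x = y 0 * C \<mu> x + y1 0 * S \<mu> x"
proof -
  have "is_solution \<sigma> q1 \<mu> (\<lambda>x. y 0 * C \<mu> x + y1 0 * S \<mu> x) (\<lambda>x. y 0 * C1 \<mu> x + y1 0 * S1 \<mu> x)"
    by (rule is_solution_lincomb[OF C_solution S_solution])
  from solution_unique(1)[OF this x] solution_unique(1)[OF y x] show ?thesis by simp
qed

lemma sol_S_eq:
  assumes "x \<in> {0..pi}"
  shows "sol_S \<sigma> q1 x \<mu> = S \<mu> x"
  unfolding sol_S_def
proof (rule the_equality)
  show "\<exists>y y1. is_solution \<sigma> q1 \<mu> y y1 \<and> y 0 = 0 \<and> y1 0 = 1 \<and> S \<mu> x = y x"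
    using S_solution by (intro exI[of _ "S \<mu>"] exI[of _ "S1 \<mu>"]) auto
next
  fix v assume "\<exists>y y1. is_solution \<sigma> q1 \<mu> y y1 \<and> y 0 = 0 \<and> y1 0 = 1 \<and> v = y x"
  then obtain y y1 where y: "is_solution \<sigma> q1 \<mu> y y1" "y 0 = 0" "y1 0 = 1" "v = y x" by blast
  show "v = S \<mu> x" using solution_eq_lincomb[OF y(1) assms] y by simp
qed

lemma char_fun_eq: "char_fun \<sigma> q1 = (\<lambda>\<mu>. S \<mu> pi)"
  using sol_S_eq by (auto simp: char_fun_def fun_eq_iff)

text \<open>A solution with value 1 at \<open>0\<close> and quasi-derivative \<open>v\<close> there
  is \<open>C + v * S\<close>, and vanishing at \<open>pi\<close> determines
  \<open>v\<close>.\<close>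

lemma Weyl_fun_eq:
  assumes "S \<mu> pi \<noteq> 0"
  shows "Weyl_fun \<sigma> q1 \<mu> = - C \<mu> pi / S \<mu> pi"
  unfolding Weyl_fun_def
proof (rule the_equality)
  show "\<exists>y y1. is_solution \<sigma> q1 \<mu> y y1 \<and> y 0 = 1 \<and> y pi = 0 \<and> - C \<mu> pi / S \<mu> pi = y1 0"
    using is_solution_lincomb[OF C_solution S_solution, of \<mu> 1 "- C \<mu> pi / S \<mu> pi"] assms
    by (intro exI[of _ "\<lambda>x. 1 * C \<mu> x + (- C \<mu> pi / S \<mu> pi) * S \<mu> x"] exI[of _ "\<lambda>x. 1 * C1 \<mu> x + (- C \<mu> pi / S \<mu> pi) * S1 \<mu> x"]) auto
next
  fix v assume "\<exists>y y1. is_solution \<sigma> q1 \<mu> y y1 \<and> y 0 = 1 \<and> y pi = 0 \<and> v = y1 0"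
  then obtain y y1 where y: "is_solution \<sigma> q1 \<mu> y y1" "y 0 = 1" "y pi = 0" "v = y1 0" by blast
  have "0 = C \<mu> pi + v * S \<mu> pi" using solution_eq_lincomb[OF y(1), of pi] y by simp
  thus "v = - C \<mu> pi / S \<mu> pi" using assms by (simp add: field_simps eq_neg_iff_add_eq_0)
qed

end

section \<open>Solutions along rays in the spectral plane\<close>

lemma absolutely_integrable_continuous_mult_real:
  fixes f k :: "real \<Rightarrow> real"
  assumes "continuous_on {0..pi} f" "k absolutely_integrable_on {0..pi}"
  shows "(\<lambda>s. f s * k s) absolutely_integrable_on {0..pi}"
  by (rule absolutely_integrable_bounded_measurable_product_real[OF continuous_imp_measurable_on_sets_lebesgue[OF assms(1)]])
     (use assms in \<open>auto intro!: compact_imp_bounded compact_continuous_image\<close>)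

section \<open>Diagonalized system and upper bounds\<close>

context pencil begin

text \<open>An integrable majorant for the coefficients left after diagonalization. In contrast to
  \<open>kappa\<close> it is independent of \<mu>, as long as
  \<open>1 \<le> cmod \<mu>\<close>.\<close>

definition k0 :: "real \<Rightarrow> real" where
  "k0 t = cmod (q1 t) + (cmod (\<sigma> t))\<^sup>2 + cmod (\<sigma> t)"

definition K0 :: real where "K0 = integral {0..pi} k0"

lemma k0_nonneg: "0 \<le> k0 t" by (simp add: k0_def)

lemma k0_integrable: "k0 absolutely_integrable_on {0..pi}"
proof -
  have "(\<lambda>t. cmod (\<sigma> t)) absolutely_integrable_on {0..pi}" "(\<lambda>t. cmod (q1 t)) absolutely_integrable_on {0..pi}"
       "(\<lambda>t. cmod ((\<sigma> t)\<^sup>2)) absolutely_integrable_on {0..pi}"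
    using absolutely_integrable_norm[OF L2_0pi_integrable(1)[OF \<sigma>]] absolutely_integrable_norm[OF L2_0pi_integrable(1)[OF q1]]
      absolutely_integrable_norm[OF L2_0pi_integrable(2)[OF \<sigma>]] by (simp_all add: o_def)
  thus ?thesis unfolding k0_def[abs_def] norm_power by (intro set_integral_add(1)) auto
qed

lemma k0_integral_le: 
  assumes "0 \<le> s" "s \<le> t" "t \<le> pi"
  shows "integral {s..t} k0 \<le> K0" "0 \<le> integral {s..t} k0" "k0 integrable_on {s..t}"
proof -
  show i: "k0 integrable_on {s..t}"
    using assms by (intro integrable_on_subinterval[OF set_lebesgue_integral_eq_integral(1)[OF k0_integrable]]) auto
  show "integral {s..t} k0 \<le> K0" unfolding K0_def
    using assms k0_nonneg by (intro integral_subset_le i set_lebesgue_integral_eq_integral(1)[OF k0_integrable]) auto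
  show "0 \<le> integral {s..t} k0" by (intro Henstock_Kurzweil_Integration.integral_nonneg i k0_nonneg)
qed

text \<open>This is \<open>(2 * \<mu> * q1 - \<sigma>\<^sup>2) / (2 * \<i> * \<mu>)\<close>: the
  potential term of the system, rewritten for the difference \<open>2 * \<i> * \<mu> * y\<close> of
  the two diagonal components instead of \<open>y\<close>.\<close>

definition pp :: "complex \<Rightarrow> real \<Rightarrow> complex" where
  "pp \<mu> t = - \<i> * q1 t + \<i> * (\<sigma> t)\<^sup>2 / (2 * \<mu>)"

lemma pp_bound:
  assumes "1 \<le> cmod \<mu>"
  shows "cmod (pp \<mu> t) + cmod (\<sigma> t) \<le> k0 t"
proof -
  have "cmod (pp \<mu> t) \<le> cmod (q1 t) + (cmod (\<sigma> t))\<^sup>2 / (2 * cmod \<mu>)"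
    unfolding pp_def by (rule order_trans[OF norm_triangle_ineq]) (simp add: norm_mult norm_divide norm_power)
  also have "(cmod (\<sigma> t))\<^sup>2 / (2 * cmod \<mu>) \<le> (cmod (\<sigma> t))\<^sup>2"
    using assms by (simp add: divide_le_eq mult_le_cancel_left1)
  finally show ?thesis by (simp add: k0_def)
qed

text \<open>Diagonalizing the free part: the component \<open>y1 - i \<mu> y\<close> grows like \<open>exp (- i \<mu> x)\<close>
  and \<open>y1 + i \<mu> y\<close> like \<open>exp (i \<mu> x)\<close>, up to perturbations that stay bounded
  in \<open>L1\<close> as \<open>\<mu>\<close> tends to infinity.\<close>

lemma diagonal_system:
  assumes y: "is_solution \<sigma> q1 \<mu> y y1" and \<mu>: "\<mu> \<noteq> 0"
  defines "a \<equiv> \<lambda>x. y1 x - \<i> * \<mu> * y x" and "b \<equiv> \<lambda>x. y1 x + \<i> * \<mu> * y x"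
  shows "ac_deriv a (\<lambda>x. - \<i> * \<mu> * a x - pp \<mu> x * a x + (pp \<mu> x - \<sigma> x) * b x)"
    "ac_deriv b (\<lambda>x. \<i> * \<mu> * b x + pp \<mu> x * b x - (pp \<mu> x + \<sigma> x) * a x)"
proof -
  have y': "ac_deriv y (\<lambda>x. \<sigma> x * y x + y1 x)" "ac_deriv y1 (\<lambda>x. (2 * \<mu> * q1 x - (\<sigma> x)\<^sup>2 - \<mu>\<^sup>2) * y x - \<sigma> x * y1 x)"
    using y by (auto simp: is_solution_iff)
  have ii: "\<i> * (\<i> * z) = - z" for z by (simp add: mult.assoc[symmetric])
  have pb: "pp \<mu> x * (b x - a x) = (2 * \<mu> * q1 x - (\<sigma> x)\<^sup>2) * y x" for x
  proof -
    have "b x - a x = 2 * \<i> * \<mu> * y x" by (simp add: a_def b_def)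
    thus ?thesis using \<mu> by (simp add: pp_def field_simps ii)
  qed
  show "ac_deriv a (\<lambda>x. - \<i> * \<mu> * a x - pp \<mu> x * a x + (pp \<mu> x - \<sigma> x) * b x)"
  proof (rule ac_deriv_cong[OF ac_deriv_diff[OF y'(2) ac_deriv_cmult[OF y'(1), of "\<i> * \<mu>"]]])
    have "(2 * \<mu> * q1 x - (\<sigma> x)\<^sup>2 - \<mu>\<^sup>2) * y x - \<sigma> x * y1 x - \<i> * \<mu> * (\<sigma> x * y x + y1 x) =
      - \<i> * \<mu> * a x - pp \<mu> x * a x + (pp \<mu> x - \<sigma> x) * b x" for x
    proof -
      have "- \<i> * \<mu> * a x - pp \<mu> x * a x + (pp \<mu> x - \<sigma> x) * b x = - \<i> * \<mu> * a x - \<sigma> x * b x + pp \<mu> x * (b x - a x)"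
        by (simp add: algebra_simps)
      thus ?thesis unfolding pb by (simp add: a_def b_def algebra_simps ii power2_eq_square)
    qed
    thus "AE x in lebesgue_on {0<..<pi}. (2 * \<mu> * q1 x - (\<sigma> x)\<^sup>2 - \<mu>\<^sup>2) * y x - \<sigma> x * y1 x - \<i> * \<mu> * (\<sigma> x * y x + y1 x) =
      - \<i> * \<mu> * a x - pp \<mu> x * a x + (pp \<mu> x - \<sigma> x) * b x" by simp
  qed (simp add: a_def)
  show "ac_deriv b (\<lambda>x. \<i> * \<mu> * b x + pp \<mu> x * b x - (pp \<mu> x + \<sigma> x) * a x)"
  proof (rule ac_deriv_cong[OF ac_deriv_add[OF y'(2) ac_deriv_cmult[OF y'(1), of "\<i> * \<mu>"]]])
    have "(2 * \<mu> * q1 x - (\<sigma> x)\<^sup>2 - \<mu>\<^sup>2) * y x - \<sigma> x * y1 x + \<i> * \<mu> * (\<sigma> x * y x + y1 x) =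
      \<i> * \<mu> * b x + pp \<mu> x * b x - (pp \<mu> x + \<sigma> x) * a x" for x
    proof -
      have "\<i> * \<mu> * b x + pp \<mu> x * b x - (pp \<mu> x + \<sigma> x) * a x = \<i> * \<mu> * b x - \<sigma> x * a x + pp \<mu> x * (b x - a x)"
        by (simp add: algebra_simps)
      thus ?thesis unfolding pb by (simp add: a_def b_def algebra_simps ii power2_eq_square)
    qed
    thus "AE x in lebesgue_on {0<..<pi}. (2 * \<mu> * q1 x - (\<sigma> x)\<^sup>2 - \<mu>\<^sup>2) * y x - \<sigma> x * y1 x + \<i> * \<mu> * (\<sigma> x * y x + y1 x) =
      \<i> * \<mu> * b x + pp \<mu> x * b x - (pp \<mu> x + \<sigma> x) * a x" by simp
  qed (simp add: b_def)
qed

text \<open>By the parallelogram law \<open>E\<close> is half the sum of the squared moduli of the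
  diagonal components. For these the free part changes the energy only through
  \<open>Im \<mu>\<close>, and everything else is absorbed by \<open>k0\<close>, whose integral does
  not depend on \<mu>. The weight \<open>cmod \<mu>\<close> in \<open>E\<close> later gains the
  factor \<open>1 / cmod \<mu>\<close> for \<open>S\<close>.\<close>

lemma energy_growth:
  assumes y: "is_solution \<sigma> q1 \<mu> y y1" and \<mu>: "1 \<le> cmod \<mu>" and st: "0 \<le> s" "s \<le> t" "t \<le> pi"
  defines "E \<equiv> \<lambda>x. (cmod (y1 x))\<^sup>2 + (cmod \<mu> * cmod (y x))\<^sup>2"
  shows "E t \<le> E s * (exp (\<bar>Im \<mu>\<bar> * (t - s) + 2 * K0))\<^sup>2" "E s \<le> E t * (exp (\<bar>Im \<mu>\<bar> * (t - s) + 2 * K0))\<^sup>2"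
proof -
  define a b where "a = (\<lambda>x. y1 x - \<i> * \<mu> * y x)" and "b = (\<lambda>x. y1 x + \<i> * \<mu> * y x)"
  \<comment> \<open>The first term is the free growth rate of a squared modulus; the 4 is a 2 from
    differentiating a square and a 2 from expanding the square of a sum.\<close>
  define h where "h = (\<lambda>t. 2 * \<bar>Im \<mu>\<bar> + 4 * k0 t)"
  have nz: "\<mu> \<noteq> 0" using \<mu> by auto
  have ds: "ac_deriv a (\<lambda>x. - \<i> * \<mu> * a x - pp \<mu> x * a x + (pp \<mu> x - \<sigma> x) * b x)"
    "ac_deriv b (\<lambda>x. \<i> * \<mu> * b x + pp \<mu> x * b x - (pp \<mu> x + \<sigma> x) * a x)"
    unfolding a_def b_def by (rule diagonal_system[OF y nz])+
  have hc: "(\<lambda>t. 2 * \<bar>Im \<mu>\<bar>) absolutely_integrable_on {0..pi}"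
    by (rule absolutely_integrable_continuous_real) simp
  have h: "h absolutely_integrable_on {0..pi}"
    unfolding h_def by (intro set_integral_add(1) set_integrable_mult_right k0_integrable hc)
  have E2: "(cmod (a x))\<^sup>2 + (cmod (b x))\<^sup>2 = 2 * E x" for x
  proof -
    have "(cmod (u - v))\<^sup>2 + (cmod (u + v))\<^sup>2 = 2 * ((cmod u)\<^sup>2 + (cmod v)\<^sup>2)" for u v
      unfolding cmod_power2 by (simp add: power2_eq_square algebra_simps)
    from this[of "y1 x" "\<i> * \<mu> * y x"] show ?thesis by (simp add: a_def b_def E_def norm_mult)
  qed
  have bound: "\<bar>2 * Re ((- \<i> * \<mu> * a x - pp \<mu> x * a x + (pp \<mu> x - \<sigma> x) * b x) * cnj (a x) +
     (\<i> * \<mu> * b x + pp \<mu> x * b x - (pp \<mu> x + \<sigma> x) * a x) * cnj (b x))\<bar> \<le> h x * ((cmod (a x))\<^sup>2 + (cmod (b x))\<^sup>2)" for x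
  proof -
    define A B where "A = a x" and "B = b x"
    define u v where "u = - pp \<mu> x * A + (pp \<mu> x - \<sigma> x) * B" and "v = pp \<mu> x * B - (pp \<mu> x + \<sigma> x) * A"
    have split: "Re ((- \<i> * \<mu> * A - pp \<mu> x * A + (pp \<mu> x - \<sigma> x) * B) * cnj A + (\<i> * \<mu> * B + pp \<mu> x * B - (pp \<mu> x + \<sigma> x) * A) * cnj B)
      = Im \<mu> * ((cmod A)\<^sup>2 - (cmod B)\<^sup>2) + Re (u * cnj A + v * cnj B)"
      unfolding u_def v_def cmod_power2 by (simp add: algebra_simps power2_eq_square)
    have p: "cmod (pp \<mu> x) + cmod (\<sigma> x) \<le> k0 x" by (rule pp_bound[OF \<mu>])
    have "cmod u \<le> cmod (- pp \<mu> x) * cmod A + cmod (pp \<mu> x - \<sigma> x) * cmod B"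
      unfolding u_def by (metis norm_triangle_ineq norm_mult)
    also have "\<dots> \<le> k0 x * cmod A + k0 x * cmod B"
      using p norm_triangle_ineq4[of "pp \<mu> x" "\<sigma> x"] by (intro add_mono mult_right_mono) (auto intro: order_trans[OF _ p])
    finally have u: "cmod u \<le> k0 x * (cmod A + cmod B)" by (simp add: distrib_left)
    have "cmod v \<le> cmod (pp \<mu> x) * cmod B + cmod (pp \<mu> x + \<sigma> x) * cmod A"
      unfolding v_def by (metis norm_triangle_ineq4 norm_mult)
    also have "\<dots> \<le> k0 x * cmod B + k0 x * cmod A"
      using p norm_triangle_ineq[of "pp \<mu> x" "\<sigma> x"] by (intro add_mono mult_right_mono) (auto intro: order_trans[OF _ p])
    finally have v: "cmod v \<le> k0 x * (cmod A + cmod B)" by (simp add: distrib_left)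
    have "\<bar>Re (u * cnj A + v * cnj B)\<bar> \<le> cmod (u * cnj A + v * cnj B)" by (rule abs_Re_le_cmod)
    also have "\<dots> \<le> cmod u * cmod A + cmod v * cmod B" by (rule order_trans[OF norm_triangle_ineq]) (simp add: norm_mult)
    also have "\<dots> \<le> (k0 x * (cmod A + cmod B)) * cmod A + (k0 x * (cmod A + cmod B)) * cmod B"
      by (intro add_mono mult_right_mono u v) auto
    also have "\<dots> = k0 x * (cmod A + cmod B)\<^sup>2" by (simp add: power2_eq_square algebra_simps)
    also have "\<dots> \<le> k0 x * (2 * ((cmod A)\<^sup>2 + (cmod B)\<^sup>2))"
      using sum_squares_bound[of "cmod A" "cmod B"] by (intro mult_left_mono k0_nonneg) (simp add: power2_sum)
    finally have 1: "\<bar>Re (u * cnj A + v * cnj B)\<bar> \<le> k0 x * (2 * ((cmod A)\<^sup>2 + (cmod B)\<^sup>2))" .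
    have "\<bar>Im \<mu> * ((cmod A)\<^sup>2 - (cmod B)\<^sup>2)\<bar> \<le> \<bar>Im \<mu>\<bar> * ((cmod A)\<^sup>2 + (cmod B)\<^sup>2)"
      unfolding abs_mult by (intro mult_left_mono) (auto simp: abs_le_iff)
    hence "\<bar>2 * (Im \<mu> * ((cmod A)\<^sup>2 - (cmod B)\<^sup>2) + Re (u * cnj A + v * cnj B))\<bar> \<le> h x * ((cmod A)\<^sup>2 + (cmod B)\<^sup>2)"
    proof -
      have "\<bar>2 * (i + r)\<bar> \<le> (2 * m + 4 * k) * e" if "\<bar>r\<bar> \<le> k * (2 * e)" "\<bar>i\<bar> \<le> m * e" for i r k m e :: real
        using that by (simp add: abs_mult algebra_simps)
      from this[OF 1 \<open>\<bar>Im \<mu> * ((cmod A)\<^sup>2 - (cmod B)\<^sup>2)\<bar> \<le> \<bar>Im \<mu>\<bar> * ((cmod A)\<^sup>2 + (cmod B)\<^sup>2)\<close>] show ?thesis by (simp add: h_def)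
    qed
    thus ?thesis unfolding A_def[symmetric] B_def[symmetric] split .
  qed
  have ih: "integral {s..t} h \<le> 2 * (\<bar>Im \<mu>\<bar> * (t - s) + 2 * K0)"
  proof -
    have "integral {s..t} h = integral {s..t} (\<lambda>t. 2 * \<bar>Im \<mu>\<bar>) + integral {s..t} (\<lambda>t. 4 * k0 t)"
      unfolding h_def by (intro Henstock_Kurzweil_Integration.integral_add integrable_const_ivl integrable_on_mult_right k0_integral_le st)
    also have "\<dots> = 2 * \<bar>Im \<mu>\<bar> * (t - s) + 4 * integral {s..t} k0" using st by simp
    finally show ?thesis using k0_integral_le(1)[OF st] by (simp add: algebra_simps)
  qed
  have ex: "exp (integral {s..t} h) \<le> (exp (\<bar>Im \<mu>\<bar> * (t - s) + 2 * K0))\<^sup>2"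
    using ih by (simp add: exp_double[symmetric])
  have E0: "E x \<ge> 0" for x by (simp add: E_def)
  have "AE x in lebesgue_on {0<..<pi}. \<bar>2 * Re ((- \<i> * \<mu> * a x - pp \<mu> x * a x + (pp \<mu> x - \<sigma> x) * b x) * cnj (a x) +
     (\<i> * \<mu> * b x + pp \<mu> x * b x - (pp \<mu> x + \<sigma> x) * a x) * cnj (b x))\<bar> \<le> h x * ((cmod (a x))\<^sup>2 + (cmod (b x))\<^sup>2)"
    by (intro always_eventually allI bound)
  note ee = energy_estimate[OF ds h this st, unfolded E2]
  have "E t \<le> E s * exp (integral {s..t} h)" "E s \<le> E t * exp (integral {s..t} h)"
    using ee by simp_all
  thus "E t \<le> E s * (exp (\<bar>Im \<mu>\<bar> * (t - s) + 2 * K0))\<^sup>2" "E s \<le> E t * (exp (\<bar>Im \<mu>\<bar> * (t - s) + 2 * K0))\<^sup>2"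
    using mult_left_mono[OF ex E0] order_trans by blast+
qed

text \<open>For the last bound the energy estimate runs backwards: by the Wronskian the combination
  vanishes at \<open>pi\<close> with quasi-derivative \<open>-1\<close>, so it grows only over the
  distance \<open>pi - x\<close>. This is the numerator of the Weyl solution.\<close>

lemma SC_bounds:
  assumes \<mu>: "1 \<le> cmod \<mu>" and x: "x \<in> {0..pi}"
  shows "cmod (S \<mu> x) \<le> exp (\<bar>Im \<mu>\<bar> * x + 2 * K0) / cmod \<mu>" "cmod (S1 \<mu> x) \<le> exp (\<bar>Im \<mu>\<bar> * x + 2 * K0)"
    "cmod (C \<mu> x) \<le> exp (\<bar>Im \<mu>\<bar> * x + 2 * K0)"
    "cmod (C \<mu> x * S \<mu> pi - C \<mu> pi * S \<mu> x) \<le> exp (\<bar>Im \<mu>\<bar> * (pi - x) + 2 * K0) / cmod \<mu>"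
proof -
  have st: "0 \<le> (0::real)" "0 \<le> x" "x \<le> pi" using x by auto
  have m0: "cmod \<mu> > 0" using \<mu> by linarith
  have sq: "u \<le> e" if "u\<^sup>2 + w \<le> e\<^sup>2" "w \<ge> 0" "e \<ge> 0" for u w e :: real
  proof -
    have "u\<^sup>2 \<le> e\<^sup>2" using that by linarith
    thus ?thesis using power2_le_imp_le that by blast
  qed
  define e where "e = exp (\<bar>Im \<mu>\<bar> * (x - 0) + 2 * K0)"
  have S: "(cmod (S1 \<mu> x))\<^sup>2 + (cmod \<mu> * cmod (S \<mu> x))\<^sup>2 \<le> e\<^sup>2"
    using energy_growth(1)[OF S_solution \<mu> st] by (simp add: e_def)
  have e0: "e \<ge> 0" by (simp add: e_def)
  show "cmod (S1 \<mu> x) \<le> exp (\<bar>Im \<mu>\<bar> * x + 2 * K0)" using sq[OF S _ e0] by (simp add: e_def)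
  have "cmod \<mu> * cmod (S \<mu> x) \<le> e" using sq[OF S[unfolded add.commute[of "(cmod (S1 \<mu> x))\<^sup>2"]] _ e0] by simp
  thus "cmod (S \<mu> x) \<le> exp (\<bar>Im \<mu>\<bar> * x + 2 * K0) / cmod \<mu>" using m0 by (simp add: e_def field_simps)
  have C: "(cmod \<mu> * cmod (C \<mu> x))\<^sup>2 + (cmod (C1 \<mu> x))\<^sup>2 \<le> (cmod \<mu> * e)\<^sup>2"
    using energy_growth(1)[OF C_solution \<mu> st] by (simp add: e_def power_mult_distrib add.commute)
  have "cmod \<mu> * cmod (C \<mu> x) \<le> cmod \<mu> * e" using sq[OF C] e0 m0 by simp
  thus "cmod (C \<mu> x) \<le> exp (\<bar>Im \<mu>\<bar> * x + 2 * K0)" using m0 by (simp add: e_def)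
  define f where "f = exp (\<bar>Im \<mu>\<bar> * (pi - x) + 2 * K0)"
  define y where "y = (\<lambda>x. S \<mu> pi * C \<mu> x + (- C \<mu> pi) * S \<mu> x)"
  define y1 where "y1 = (\<lambda>x. S \<mu> pi * C1 \<mu> x + (- C \<mu> pi) * S1 \<mu> x)"
  have sol: "is_solution \<sigma> q1 \<mu> y y1" unfolding y_def y1_def by (rule is_solution_lincomb[OF C_solution S_solution])
  have "y pi = 0" "y1 pi = -1" using SC_wronskian[of pi \<mu>] by (auto simp: y_def y1_def algebra_simps)
  hence "(cmod (y1 x))\<^sup>2 + (cmod \<mu> * cmod (y x))\<^sup>2 \<le> f\<^sup>2"
    using energy_growth(2)[OF sol \<mu> _ st(3)] st by (simp add: f_def)
  hence "cmod \<mu> * cmod (y x) \<le> f" using sq[of "cmod \<mu> * cmod (y x)" "(cmod (y1 x))\<^sup>2" f] by (simp add: add.commute f_def)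
  thus "cmod (C \<mu> x * S \<mu> pi - C \<mu> pi * S \<mu> x) \<le> exp (\<bar>Im \<mu>\<bar> * (pi - x) + 2 * K0) / cmod \<mu>" 
    using m0 by (simp add: f_def y_def field_simps)
qed

section \<open>Lower bounds along rays\<close>

text \<open>Normalized by \<open>exp (\<i> * \<mu> * x)\<close>, which decays in the upper
  half-plane, the component \<open>B\<close> tends to 0, and \<open>A\<close> times an integrating
  factor tends to 1. Since \<open>B - A\<close> is \<open>2 * \<i> * \<mu> * S\<close> up to the
  normalization, \<open>S\<close> cannot be much smaller than
  \<open>exp (r * Im \<omega> * x) / r\<close>. Dominated convergence takes the place of pointwise
  control of the potentials.\<close>

lemma S_lower_bound_upper_half:
  fixes \<omega> :: complex
  assumes \<omega>: "cmod \<omega> = 1" "Im \<omega> > 0" and x: "0 < x" "x \<le> pi"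
  shows "\<exists>c>0. \<forall>\<^sub>F r in at_top. c * exp (r * Im \<omega> * x) / r \<le> cmod (S (of_real r * \<omega>) x)"
proof -
  define a b where "a = (\<lambda>\<mu> x. S1 \<mu> x - \<i> * \<mu> * S \<mu> x)" and "b = (\<lambda>\<mu> x. S1 \<mu> x + \<i> * \<mu> * S \<mu> x)"
  define A B where "A = (\<lambda>\<mu> x. a \<mu> x * exp (\<i> * \<mu> * of_real x))" and "B = (\<lambda>\<mu> x. b \<mu> x * exp (\<i> * \<mu> * of_real x))"
  \<comment> \<open>The bound of \<open>SC_bounds\<close>, taken once for \<open>S1\<close> and once
    for \<open>\<mu> * S\<close>.\<close>
  define M where "M = 2 * exp (2 * K0)"
  have dlin: "ac_deriv (\<lambda>x. c * of_real x) (\<lambda>x. c)" for c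
  proof -
    have "ac_deriv (\<lambda>x. integral {0..x} (\<lambda>x. c)) (\<lambda>x. c)"
      by (rule ac_deriv_integral, rule absolutely_integrable_continuous_real) simp
    thus ?thesis by (rule ac_deriv_cong) (auto simp: scaleR_conv_of_real mult.commute)
  qed
  have dexp: "ac_deriv (\<lambda>x. exp (c * of_real x)) (\<lambda>x. c * exp (c * of_real x))" for c
    by (rule ac_deriv_exp[OF dlin])
  have nexp: "cmod (exp (\<i> * \<mu> * of_real x)) = exp (- Im \<mu> * x)" for \<mu> x by (simp add: norm_exp_eq_Re)
  have AB: "cmod (A \<mu> t) \<le> M" "cmod (B \<mu> t) \<le> M" if "1 \<le> cmod \<mu>" "Im \<mu> \<ge> 0" "t \<in> {0..pi}" for \<mu> t
  proof -
    have "cmod \<mu> > 0" using that by linarith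
    hence 1: "cmod (S1 \<mu> t) + cmod (\<i> * \<mu> * S \<mu> t) \<le> M * exp (Im \<mu> * t)"
      using SC_bounds(1,2)[OF that(1,3)] that(2) by (simp add: norm_mult M_def exp_add field_simps)
    have "cmod (a \<mu> t) \<le> M * exp (Im \<mu> * t)" "cmod (b \<mu> t) \<le> M * exp (Im \<mu> * t)" unfolding a_def b_def
      by (rule order_trans[OF norm_triangle_ineq4 1] order_trans[OF norm_triangle_ineq 1])+
    hence "cmod (A \<mu> t) \<le> M * exp (Im \<mu> * t) * exp (- Im \<mu> * t)" "cmod (B \<mu> t) \<le> M * exp (Im \<mu> * t) * exp (- Im \<mu> * t)"
      unfolding A_def B_def norm_mult nexp by (intro mult_right_mono; simp)+
    thus "cmod (A \<mu> t) \<le> M" "cmod (B \<mu> t) \<le> M" by (simp_all add: mult.assoc exp_add[symmetric])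
  qed
  have ab0: "a \<mu> 0 = 1" "b \<mu> 0 = 1" "A \<mu> 0 = 1" "B \<mu> 0 = 1" for \<mu> by (simp_all add: a_def b_def A_def B_def)
  have ds: "ac_deriv (a \<mu>) (\<lambda>x. - \<i> * \<mu> * a \<mu> x - pp \<mu> x * a \<mu> x + (pp \<mu> x - \<sigma> x) * b \<mu> x)"
    "ac_deriv (b \<mu>) (\<lambda>x. \<i> * \<mu> * b \<mu> x + pp \<mu> x * b \<mu> x - (pp \<mu> x + \<sigma> x) * a \<mu> x)" if "\<mu> \<noteq> 0" for \<mu>
    unfolding a_def b_def by (rule diagonal_system[OF S_solution that])+
  \<comment> \<open>Variation of constants for \<open>b\<close>: its own exponential yields the
    first term, and the perturbation enters with the kernel
    \<open>exp (- 2 * Im \<mu> * (t - s))\<close>, which concentrates at \<open>s = t\<close> when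
    \<open>Im \<mu>\<close> is large.\<close>
  have Bd: "cmod (B \<mu> t) \<le> exp (- 2 * Im \<mu> * t) + integral {0..t} (\<lambda>s. 2 * M * (exp (- 2 * Im \<mu> * (t - s)) * k0 s))"
    if \<mu>: "1 \<le> cmod \<mu>" "Im \<mu> \<ge> 0" and t: "t \<in> {0..pi}" for \<mu> t
  proof -
    have "\<mu> \<noteq> 0" using \<mu> by auto
    define D where "D = (\<lambda>s. (pp \<mu> s * B \<mu> s - (pp \<mu> s + \<sigma> s) * A \<mu> s) * exp (- 2 * \<i> * \<mu> * of_real s))"
    have "ac_deriv (\<lambda>s. b \<mu> s * exp (- \<i> * \<mu> * of_real s)) D"
    proof (rule ac_deriv_cong[OF ac_deriv_mult[OF ds(2)[OF \<open>\<mu> \<noteq> 0\<close>] dexp[of "- \<i> * \<mu>"]]])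
      have "b \<mu> s * (- \<i> * \<mu> * exp (- \<i> * \<mu> * complex_of_real s)) +
        (\<i> * \<mu> * b \<mu> s + pp \<mu> s * b \<mu> s - (pp \<mu> s + \<sigma> s) * a \<mu> s) * exp (- \<i> * \<mu> * complex_of_real s) = D s" for s
      proof -
        have "exp (- \<i> * \<mu> * complex_of_real s) = exp (\<i> * \<mu> * of_real s) * exp (- 2 * \<i> * \<mu> * of_real s)"
          by (simp add: exp_add[symmetric] algebra_simps)
        hence "D s = (pp \<mu> s * b \<mu> s - (pp \<mu> s + \<sigma> s) * a \<mu> s) * exp (- \<i> * \<mu> * complex_of_real s)"
          unfolding D_def A_def B_def by (simp add: algebra_simps)
        thus ?thesis by (simp add: algebra_simps)
      qed
      thus "AE s in lebesgue_on {0<..<pi}. b \<mu> s * (- \<i> * \<mu> * exp (- \<i> * \<mu> * complex_of_real s)) +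
        (\<i> * \<mu> * b \<mu> s + pp \<mu> s * b \<mu> s - (pp \<mu> s + \<sigma> s) * a \<mu> s) * exp (- \<i> * \<mu> * complex_of_real s) = D s" by simp
    qed simp
    from ac_deriv_has_integral[OF this, of 0 t] t ab0
    have hi: "(D has_integral (b \<mu> t * exp (- \<i> * \<mu> * of_real t) - 1)) {0..t}" by auto
    have int: "(\<lambda>s. 2 * M * (exp (2 * Im \<mu> * s) * k0 s)) integrable_on {0..t}"
    proof -
      have "(\<lambda>s. exp (2 * Im \<mu> * s) * k0 s) absolutely_integrable_on {0..pi}"
      by (intro absolutely_integrable_continuous_mult_real k0_integrable continuous_intros)
      from absolutely_integrable_imp_integrable[OF set_integrable_mult_right[OF this, of "2 * M"] t] show ?thesis by simp
    qed
    have "cmod (b \<mu> t * exp (- \<i> * \<mu> * of_real t) - 1) \<le> integral {0..t} (\<lambda>s. 2 * M * (exp (2 * Im \<mu> * s) * k0 s))"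
      unfolding integral_unique[OF hi, symmetric]
    proof (rule integral_norm_bound_integral[OF has_integral_integrable[OF hi] int])
      fix s assume s: "s \<in> {0..t}"
      have "cmod (pp \<mu> s * B \<mu> s - (pp \<mu> s + \<sigma> s) * A \<mu> s) \<le> cmod (pp \<mu> s) * cmod (B \<mu> s) + cmod (pp \<mu> s + \<sigma> s) * cmod (A \<mu> s)"
        by (metis norm_triangle_ineq4 norm_mult)
      also have "\<dots> \<le> k0 s * M + k0 s * M"
        using pp_bound[OF \<mu>(1), of s] norm_triangle_ineq[of "pp \<mu> s" "\<sigma> s"] AB[OF \<mu>, of s] s t k0_nonneg[of s]
        by (intro add_mono mult_mono) (auto intro: order_trans[OF _ pp_bound[OF \<mu>(1)]])
      finally have "cmod (pp \<mu> s * B \<mu> s - (pp \<mu> s + \<sigma> s) * A \<mu> s) * exp (2 * Im \<mu> * s) \<le> (k0 s * M + k0 s * M) * exp (2 * Im \<mu> * s)"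
        by (intro mult_right_mono) auto
      moreover have "cmod (D s) = cmod (pp \<mu> s * B \<mu> s - (pp \<mu> s + \<sigma> s) * A \<mu> s) * exp (2 * Im \<mu> * s)"
        unfolding D_def norm_mult by (simp add: norm_exp_eq_Re)
      ultimately show "cmod (D s) \<le> 2 * M * (exp (2 * Im \<mu> * s) * k0 s)" by (simp add: algebra_simps)
    qed
    hence "cmod (b \<mu> t * exp (- \<i> * \<mu> * of_real t)) \<le> 1 + integral {0..t} (\<lambda>s. 2 * M * (exp (2 * Im \<mu> * s) * k0 s))"
      using norm_triangle_sub[of "b \<mu> t * exp (- \<i> * \<mu> * of_real t)" 1] by simp
    hence "exp (- 2 * Im \<mu> * t) * cmod (b \<mu> t * exp (- \<i> * \<mu> * of_real t)) \<le> exp (- 2 * Im \<mu> * t) * (1 + integral {0..t} (\<lambda>s. 2 * M * (exp (2 * Im \<mu> * s) * k0 s)))"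
      by (intro mult_left_mono) auto
    also have "\<dots> = exp (- 2 * Im \<mu> * t) + integral {0..t} (\<lambda>s. exp (- 2 * Im \<mu> * t) * (2 * M * (exp (2 * Im \<mu> * s) * k0 s)))"
      by (simp only: distrib_left integral_mult_right mult_1_right)
    also have "(\<lambda>s. exp (- 2 * Im \<mu> * t) * (2 * M * (exp (2 * Im \<mu> * s) * k0 s))) = (\<lambda>s. 2 * M * (exp (- 2 * Im \<mu> * (t - s)) * k0 s))"
      by (simp add: fun_eq_iff algebra_simps exp_add exp_diff exp_minus field_simps)
    also have "exp (- 2 * Im \<mu> * t) * cmod (b \<mu> t * exp (- \<i> * \<mu> * of_real t)) = cmod (B \<mu> t)"
      by (simp add: B_def norm_mult norm_exp_eq_Re exp_add[symmetric])
    finally show ?thesis .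
  qed
  define \<mu>r where "\<mu>r = (\<lambda>r::real. complex_of_real r * \<omega>)"
  have \<mu>r: "cmod (\<mu>r r) = r" "Im (\<mu>r r) = r * Im \<omega>" if "r \<ge> 0" for r using that \<omega> by (auto simp: \<mu>r_def norm_mult)
  have Bto0: "(\<lambda>n. B (\<mu>r (X n)) t) \<longlonglongrightarrow> 0" if X: "filterlim X at_top sequentially" "\<And>n. 1 \<le> X n" and t: "t \<in> {0<..pi}" for X t
  proof -
    have X0: "X n \<ge> 0" for n using X(2)[of n] by linarith
    define \<tau> where "\<tau> = (\<lambda>n. Im (\<mu>r (X n)))"
    have \<tau>: "filterlim \<tau> at_top sequentially" 
      unfolding \<tau>_def \<mu>r(2)[OF X0] using filterlim_tendsto_pos_mult_at_top[OF tendsto_const \<omega>(2) X(1)] by (simp add: mult.commute)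
    have \<tau>0: "\<tau> n \<ge> 0" for n using X0[of n] \<omega>(2) by (simp add: \<tau>_def \<mu>r)
    have et: "(\<lambda>n. exp (- 2 * \<tau> n * d)) \<longlonglongrightarrow> 0" if "d > 0" for d :: real
    proof -
      have "filterlim (\<lambda>n. (2 * d) * \<tau> n) at_top sequentially"
        using that by (intro filterlim_tendsto_pos_mult_at_top[OF tendsto_const _ \<tau>]) auto
      hence "filterlim (\<lambda>n. - ((2 * d) * \<tau> n)) at_bot sequentially" by (simp add: filterlim_uminus_at_top)
      from filterlim_compose[OF exp_at_bot this] show ?thesis by (simp add: algebra_simps)
    qed
    \<comment> \<open>The kernel tends to 0 except at \<open>s = t\<close>, so the limit integrand
      vanishes outside a single point.\<close>
    have "(\<lambda>n. integral {0..t} (\<lambda>s. 2 * M * (exp (- 2 * \<tau> n * (t - s)) * k0 s))) \<longlonglongrightarrow> integral {0..t} (\<lambda>s. if s = t then 2 * M * k0 t else 0)"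
    proof (rule dominated_convergence(2))
      fix n
      have "(\<lambda>s. exp (- 2 * \<tau> n * (t - s)) * k0 s) absolutely_integrable_on {0..pi}"
      by (intro absolutely_integrable_continuous_mult_real k0_integrable continuous_intros)
      from absolutely_integrable_imp_integrable[OF set_integrable_mult_right[OF this, of "2 * M"], of t] t
      show "(\<lambda>s. 2 * M * (exp (- 2 * \<tau> n * (t - s)) * k0 s)) integrable_on {0..t}" by simp
      show "norm (2 * M * (exp (- 2 * \<tau> n * (t - s)) * k0 s)) \<le> 2 * M * k0 s" if "s \<in> {0..t}" for s
      proof -
        have "exp (- 2 * \<tau> n * (t - s)) \<le> 1" using that \<tau>0[of n] by (simp add: mult_nonneg_nonneg)
        hence "exp (- 2 * \<tau> n * (t - s)) * k0 s \<le> 1 * k0 s" by (intro mult_right_mono k0_nonneg)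
        thus ?thesis using k0_nonneg[of s] by (simp add: M_def abs_mult)
      qed
    next
      show "(\<lambda>s. 2 * M * k0 s) integrable_on {0..t}" using k0_integral_le(3)[of 0 t] t by (intro integrable_on_mult_right) auto
    next
      fix s assume s: "s \<in> {0..t}"
      show "(\<lambda>n. 2 * M * (exp (- 2 * \<tau> n * (t - s)) * k0 s)) \<longlonglongrightarrow> (if s = t then 2 * M * k0 t else 0)"
      proof (cases "s = t")
        case False
        hence "(\<lambda>n. 2 * M * (exp (- 2 * \<tau> n * (t - s)) * k0 s)) \<longlonglongrightarrow> 2 * M * (0 * k0 s)"
          using s by (intro tendsto_mult tendsto_const et) auto
        thus ?thesis using False by simp
      qed simp
    qed
    moreover have "integral {0..t} (\<lambda>s. if s = t then 2 * M * k0 t else 0) = 0"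
      by (rule integral_unique, rule has_integral_spike[of "{t}" _ _ "\<lambda>_. 0"]) auto
    ultimately have "(\<lambda>n. exp (- 2 * \<tau> n * t) + integral {0..t} (\<lambda>s. 2 * M * (exp (- 2 * \<tau> n * (t - s)) * k0 s))) \<longlonglongrightarrow> 0 + 0"
      using t by (intro tendsto_add et) auto
    hence lim: "(\<lambda>n. exp (- 2 * \<tau> n * t) + integral {0..t} (\<lambda>s. 2 * M * (exp (- 2 * \<tau> n * (t - s)) * k0 s))) \<longlonglongrightarrow> 0" by simp
    show ?thesis
    proof (rule Lim_null_comparison[OF _ lim], intro always_eventually allI)
      fix n show "norm (B (\<mu>r (X n)) t) \<le> exp (- 2 * \<tau> n * t) + integral {0..t} (\<lambda>s. 2 * M * (exp (- 2 * \<tau> n * (t - s)) * k0 s))"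
        unfolding \<tau>_def using \<tau>0[of n] X(2)[of n] t by (intro Bd) (auto simp: \<mu>r(1)[OF X0] \<tau>_def)
    qed
  qed
  have Bc: "continuous_on {0..pi} (B \<mu>)" and bc: "ac_deriv (b \<mu>) (\<lambda>x. \<i> * \<mu> * b \<mu> x + pp \<mu> x * b \<mu> x - (pp \<mu> x + \<sigma> x) * a \<mu> x)" if "\<mu> \<noteq> 0" for \<mu>
    using ac_deriv_continuous_on[OF ac_deriv_mult[OF ds(2)[OF that] dexp[of "\<i> * \<mu>"]]] ds(2)[OF that] by (simp_all add: B_def)
  \<comment> \<open>\<open>exp (P \<mu> t)\<close> is the integrating factor that removes the term
    \<open>- pp \<mu> * A\<close>; what remains in the derivative of \<open>G\<close> contains only
    \<open>B\<close>, which is already known to tend to 0.\<close>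
  define P where "P = (\<lambda>\<mu> t. integral {0..t} (pp \<mu>))"
  define G where "G = (\<lambda>\<mu> t. A \<mu> t * exp (P \<mu> t))"
  have ppi: "pp \<mu> absolutely_integrable_on {0..pi}" for \<mu>
  proof -
    have "(\<lambda>t. (- \<i>) * q1 t + (\<i> / (2 * \<mu>)) * (\<sigma> t)\<^sup>2) absolutely_integrable_on {0..pi}"
      by (intro set_integral_add(1) set_integrable_mult_right L2_0pi_integrable \<sigma> q1)
    thus ?thesis unfolding pp_def[abs_def] by simp
  qed
  have Pb: "cmod (P \<mu> t) \<le> K0" if "1 \<le> cmod \<mu>" "t \<in> {0..pi}" for \<mu> t
  proof -
    have "cmod (P \<mu> t) \<le> integral {0..t} k0" unfolding P_def
    proof (rule integral_norm_bound_integral)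
      show "pp \<mu> integrable_on {0..t}" by (rule absolutely_integrable_imp_integrable[OF ppi that(2)])
      show "k0 integrable_on {0..t}" by (rule absolutely_integrable_imp_integrable[OF k0_integrable that(2)])
      show "norm (pp \<mu> s) \<le> k0 s" for s using pp_bound[OF that(1), of s] by (smt (verit) norm_ge_zero)
    qed
    also have "\<dots> \<le> K0" using k0_integral_le(1)[of 0 t] that by simp
    finally show ?thesis .
  qed
  have Gd: "cmod (G \<mu> t - 1) \<le> exp K0 * integral {0..pi} (\<lambda>s. k0 s * cmod (B \<mu> s))"
    if \<mu>: "1 \<le> cmod \<mu>" and t: "t \<in> {0..pi}" for \<mu> t
  proof -
    have "\<mu> \<noteq> 0" using \<mu> by auto
    define D where "D = (\<lambda>s. (pp \<mu> s - \<sigma> s) * B \<mu> s * exp (P \<mu> s))"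
    have "ac_deriv (A \<mu>) (\<lambda>s. - pp \<mu> s * A \<mu> s + (pp \<mu> s - \<sigma> s) * B \<mu> s)"
      unfolding A_def by (rule ac_deriv_cong[OF ac_deriv_mult[OF ds(1)[OF \<open>\<mu> \<noteq> 0\<close>] dexp[of "\<i> * \<mu>"]]]) (auto simp: A_def B_def algebra_simps)
    from ac_deriv_mult[OF this ac_deriv_exp[OF ac_deriv_integral[OF ppi, of \<mu>, folded P_def]]]
    have "ac_deriv (G \<mu>) D" unfolding G_def
      by (rule ac_deriv_cong) (auto simp: P_def D_def algebra_simps)
    from ac_deriv_has_integral[OF this, of 0 t] t have hi: "(D has_integral (G \<mu> t - 1)) {0..t}"
      by (auto simp: G_def ab0 P_def)
    have kB: "(\<lambda>s. k0 s * cmod (B \<mu> s)) absolutely_integrable_on {0..pi}"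
    proof -
      have c: "continuous_on {0..pi} (\<lambda>s. cmod (B \<mu> s))" by (intro continuous_intros Bc \<open>\<mu> \<noteq> 0\<close>)
      have "(\<lambda>s. cmod (B \<mu> s) * k0 s) absolutely_integrable_on {0..pi}"
      by (rule absolutely_integrable_continuous_mult_real[OF c k0_integrable])
      thus ?thesis by (simp add: mult.commute)
    qed
    have int: "(\<lambda>s. exp K0 * (k0 s * cmod (B \<mu> s))) integrable_on {0..u}" if "u \<in> {0..pi}" for u
      by (intro integrable_on_mult_right absolutely_integrable_imp_integrable[OF kB that])
    have "cmod (G \<mu> t - 1) \<le> integral {0..t} (\<lambda>s. exp K0 * (k0 s * cmod (B \<mu> s)))"
      unfolding integral_unique[OF hi, symmetric]
    proof (rule integral_norm_bound_integral[OF has_integral_integrable[OF hi] int[OF t]])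
      fix s assume s: "s \<in> {0..t}"
      have "cmod (exp (P \<mu> s)) \<le> exp (cmod (P \<mu> s))" by (rule norm_exp)
      also have "\<dots> \<le> exp K0" using Pb[OF \<mu>, of s] s t by simp
      finally have 1: "cmod (exp (P \<mu> s)) \<le> exp K0" .
      have 2: "cmod (pp \<mu> s - \<sigma> s) \<le> k0 s" using norm_triangle_ineq4 pp_bound[OF \<mu>] order_trans by blast
      have "cmod (D s) = cmod (pp \<mu> s - \<sigma> s) * cmod (B \<mu> s) * cmod (exp (P \<mu> s))" by (simp only: D_def norm_mult)
      also have "\<dots> \<le> k0 s * cmod (B \<mu> s) * exp K0" by (intro mult_mono 1 2) (auto intro!: mult_nonneg_nonneg k0_nonneg)
      finally show "cmod (D s) \<le> exp K0 * (k0 s * cmod (B \<mu> s))" by (simp add: mult_ac)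
    qed
    also have "\<dots> \<le> integral {0..pi} (\<lambda>s. exp K0 * (k0 s * cmod (B \<mu> s)))"
      using t by (intro integral_subset_le int) (auto intro!: mult_nonneg_nonneg k0_nonneg)
    finally show ?thesis by (simp only: integral_mult_right)
  qed
  have Gto1: "(\<lambda>n. G (\<mu>r (X n)) x) \<longlonglongrightarrow> 1" if X: "filterlim X at_top sequentially" "\<And>n. 1 \<le> X n" for X
  proof -
    have X0: "X n \<ge> 0" for n using X(2)[of n] by linarith
    have X1: "1 \<le> cmod (\<mu>r (X n))" "Im (\<mu>r (X n)) \<ge> 0" "\<mu>r (X n) \<noteq> 0" for n using \<mu>r[OF X0, of n] X(2)[of n] \<omega>(2) X0[of n] by auto
    have "(\<lambda>n. integral {0..pi} (\<lambda>s. k0 s * cmod (B (\<mu>r (X n)) s))) \<longlonglongrightarrow> integral {0..pi} (\<lambda>s. if s = 0 then k0 0 else 0)"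
    proof (rule dominated_convergence(2))
      fix n
      have c: "continuous_on {0..pi} (\<lambda>s. cmod (B (\<mu>r (X n)) s))" by (intro continuous_intros Bc X1)
      have "(\<lambda>s. cmod (B (\<mu>r (X n)) s) * k0 s) absolutely_integrable_on {0..pi}"
      by (rule absolutely_integrable_continuous_mult_real[OF c k0_integrable])
      thus "(\<lambda>s. k0 s * cmod (B (\<mu>r (X n)) s)) integrable_on {0..pi}" 
        using set_lebesgue_integral_eq_integral(1) by (simp add: mult.commute)
      show "norm (k0 s * cmod (B (\<mu>r (X n)) s)) \<le> k0 s * M" if "s \<in> {0..pi}" for s
        using AB(2)[OF X1(1,2) that] k0_nonneg[of s] by (simp add: abs_mult mult_left_mono)
    next
      show "(\<lambda>s. k0 s * M) integrable_on {0..pi}" using k0_integral_le(3)[of 0 pi] by (intro integrable_on_mult_left) auto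
    next
      fix s assume s: "s \<in> {0..pi}"
      show "(\<lambda>n. k0 s * cmod (B (\<mu>r (X n)) s)) \<longlonglongrightarrow> (if s = 0 then k0 0 else 0)"
      proof (cases "s = 0")
        case False
        hence "(\<lambda>n. k0 s * cmod (B (\<mu>r (X n)) s)) \<longlonglongrightarrow> k0 s * 0"
          using s by (intro tendsto_mult tendsto_const tendsto_norm_zero Bto0 X) auto
        thus ?thesis using False by simp
      qed (simp add: ab0)
    qed
    moreover have "integral {0..pi} (\<lambda>s. if s = 0 then k0 0 else 0) = 0"
      by (rule integral_unique, rule has_integral_spike[of "{0}" _ _ "\<lambda>_. 0"]) auto
    ultimately have "(\<lambda>n. exp K0 * integral {0..pi} (\<lambda>s. k0 s * cmod (B (\<mu>r (X n)) s))) \<longlonglongrightarrow> exp K0 * 0"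
      by (intro tendsto_mult tendsto_const) auto
    hence lim: "(\<lambda>n. exp K0 * integral {0..pi} (\<lambda>s. k0 s * cmod (B (\<mu>r (X n)) s))) \<longlonglongrightarrow> 0" by simp
    have "(\<lambda>n. G (\<mu>r (X n)) x - 1) \<longlonglongrightarrow> 0"
      by (rule Lim_null_comparison[OF _ lim], intro always_eventually allI Gd X1) (use x in auto)
    thus ?thesis by (simp add: LIM_zero_iff)
  qed
  \<comment> \<open>Truncation at 1 enforces \<open>1 \<le> cmod \<mu>\<close> along every sequence
    without affecting the limit at infinity.\<close>
  have top: "filterlim (\<lambda>n. max 1 (X n)) at_top sequentially" if "filterlim X at_top sequentially" for X :: "nat \<Rightarrow> real"
    using that by (rule filterlim_at_top_mono) auto
  have "((\<lambda>r. B (\<mu>r (max 1 r)) x) \<longlongrightarrow> 0) at_top"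
    by (rule tendsto_at_topI_sequentially) (use x in \<open>auto intro!: Bto0 top\<close>)
  moreover have "((\<lambda>r. G (\<mu>r (max 1 r)) x) \<longlongrightarrow> 1) at_top"
    by (rule tendsto_at_topI_sequentially) (auto intro!: Gto1 top)
  ultimately have "\<forall>\<^sub>F r in at_top. dist (B (\<mu>r (max 1 r)) x) 0 < exp (- K0) / 4 \<and> dist (G (\<mu>r (max 1 r)) x) 1 < 1/2"
    by (intro eventually_conj tendstoD) auto
  \<comment> \<open>From \<open>1/2 \<le> cmod (G \<mu> x)\<close> and
    \<open>cmod (P \<mu> x) \<le> K0\<close> follows
    \<open>exp (- K0) / 2 \<le> cmod (A \<mu> x)\<close>. Subtracting \<open>B\<close> costs half of
    this, and the factor \<open>2 * r\<close> in front of \<open>S\<close> leaves one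
    eighth.\<close>
  hence "\<forall>\<^sub>F r in at_top. exp (- K0) / 8 * exp (r * Im \<omega> * x) / r \<le> cmod (S (of_real r * \<omega>) x)"
    using eventually_ge_at_top[of 1]
  proof eventually_elim
    case (elim r)
    define \<mu> where "\<mu> = \<mu>r r"
    have r0: "r \<ge> 0" using elim by simp
    have \<mu>: "cmod \<mu> = r" "Im \<mu> = r * Im \<omega>" "1 \<le> cmod \<mu>" using \<mu>r[OF r0] elim by (auto simp: \<mu>_def)
    have b: "cmod (B \<mu> x) < exp (- K0) / 4" and g: "cmod (G \<mu> x - 1) < 1/2" using elim by (auto simp: \<mu>_def dist_norm)
    have "1 \<le> cmod (G \<mu> x) + cmod (G \<mu> x - 1)" using norm_triangle_ineq4[of "G \<mu> x" "G \<mu> x - 1"] by simp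
    hence "1/2 \<le> cmod (G \<mu> x)" using g by linarith
    also have "\<dots> \<le> cmod (A \<mu> x) * exp K0"
      unfolding G_def norm_mult using Pb[OF \<mu>(3), of x] x by (intro mult_left_mono order_trans[OF norm_exp]) auto
    finally have "1/2 * exp (- K0) \<le> cmod (A \<mu> x) * exp K0 * exp (- K0)" by (intro mult_right_mono) auto
    hence "exp (- K0) / 2 \<le> cmod (A \<mu> x)" by (simp add: mult.assoc exp_add[symmetric])
    hence "exp (- K0) / 4 \<le> cmod (B \<mu> x - A \<mu> x)" using b norm_triangle_ineq3[of "B \<mu> x" "A \<mu> x"] by linarith
    also have "B \<mu> x - A \<mu> x = 2 * \<i> * \<mu> * S \<mu> x * exp (\<i> * \<mu> * of_real x)"
      by (simp add: A_def B_def a_def b_def algebra_simps)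
    also have "cmod \<dots> = 2 * r * cmod (S \<mu> x) * exp (- (r * Im \<omega> * x))"
      using \<mu> by (simp add: norm_mult nexp)
    finally have "exp (- K0) / 4 * exp (r * Im \<omega> * x) \<le> 2 * r * cmod (S \<mu> x) * exp (- (r * Im \<omega> * x)) * exp (r * Im \<omega> * x)"
      by (intro mult_right_mono) auto
    also have "\<dots> = 2 * r * cmod (S \<mu> x)" by (simp add: mult.assoc exp_add[symmetric])
    finally show ?case using elim by (simp add: \<mu>_def \<mu>r_def field_simps)
  qed
  thus ?thesis by (intro exI[of _ "exp (- K0) / 8"]) auto
qed

lemma neg_pencil: "pencil \<sigma> (\<lambda>x. - q1 x)"
proof
  show "\<sigma> \<in> L2_0pi" by (rule \<sigma>)
  show "(\<lambda>x. - q1 x) \<in> L2_0pi" using q1 by (auto simp: L2_0pi_def)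
qed

text \<open>The equation contains \<mu> only through \<open>\<mu> * q1\<close> and
  \<open>\<mu>\<^sup>2\<close>, so a reflection of \<mu> is compensated by a sign change of
  \<open>q1\<close>. This carries the bound from the upper half-plane to the lower one.\<close>

lemma S_neg_pencil:
  assumes "x \<in> {0..pi}"
  shows "pencil.S \<sigma> (\<lambda>x. - q1 x) (- \<mu>) x = S \<mu> x"
proof -
  interpret N: pencil \<sigma> "\<lambda>x. - q1 x" by (rule neg_pencil)
  have "is_solution \<sigma> (\<lambda>x. - q1 x) (- \<mu>) (S \<mu>) (S1 \<mu>)"
    using S_solution[of \<mu>] unfolding is_solution_iff by simp
  from N.solution_eq_lincomb[OF this assms] show ?thesis by simp
qed

lemma S_lower_bound:
  fixes \<omega> :: complex
  assumes \<omega>: "cmod \<omega> = 1" "Im \<omega> \<noteq> 0" and x: "0 < x" "x \<le> pi"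
  shows "\<exists>c>0. \<forall>\<^sub>F r in at_top. c * exp (r * \<bar>Im \<omega>\<bar> * x) / r \<le> cmod (S (of_real r * \<omega>) x)"
proof (cases "Im \<omega> > 0")
  case True
  thus ?thesis using S_lower_bound_upper_half[OF \<omega>(1) True x] by simp
next
  case False
  interpret N: pencil \<sigma> "\<lambda>x. - q1 x" by (rule neg_pencil)
  have "N.S (of_real r * (- \<omega>)) x = S (of_real r * \<omega>) x" for r
    using S_neg_pencil[of x "of_real r * \<omega>"] x by simp
  thus ?thesis using N.S_lower_bound_upper_half[of "- \<omega>" x] \<omega> x False by simp
qed

end

section \<open>Entire functions of order at most 3/2\<close>

text \<open>The base \<open>1 + cmod z\<close>, which is at least 1, and the sign of
  \<open>A\<close> make the class stable under sums, products, rotations and translations.\<close>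

definition growth32 :: "(complex \<Rightarrow> complex) \<Rightarrow> bool" where
  "growth32 f \<longleftrightarrow> (\<exists>A\<ge>0. \<forall>z. cmod (f z) \<le> exp (A * (1 + cmod z) powr (3/2)))"

lemma growth32_mult:
  assumes "growth32 f" "growth32 g"
  shows "growth32 (\<lambda>z. f z * g z)"
proof -
  obtain A B where A: "A \<ge> 0" "\<And>z. cmod (f z) \<le> exp (A * (1 + cmod z) powr (3/2))"
    and B: "B \<ge> 0" "\<And>z. cmod (g z) \<le> exp (B * (1 + cmod z) powr (3/2))"
    using assms unfolding growth32_def by blast
  have "cmod (f z * g z) \<le> exp ((A + B) * (1 + cmod z) powr (3/2))" for z
  proof -
    have "cmod (f z * g z) \<le> exp (A * (1 + cmod z) powr (3/2)) * exp (B * (1 + cmod z) powr (3/2))"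
      unfolding norm_mult by (intro mult_mono A B) auto
    thus ?thesis by (simp add: exp_add[symmetric] distrib_right)
  qed
  thus ?thesis unfolding growth32_def using A B by (intro exI[of _ "A + B"]) auto
qed

lemma growth32_add:
  assumes "growth32 f" "growth32 g"
  shows "growth32 (\<lambda>z. f z + g z)"
proof -
  obtain A B where A: "A \<ge> 0" "\<And>z. cmod (f z) \<le> exp (A * (1 + cmod z) powr (3/2))"
    and B: "B \<ge> 0" "\<And>z. cmod (g z) \<le> exp (B * (1 + cmod z) powr (3/2))"
    using assms unfolding growth32_def by blast
  have "cmod (f z + g z) \<le> exp ((A + B + 1) * (1 + cmod z) powr (3/2))" for z
  proof -
    define p where "p = (1 + cmod z) powr (3/2)"
    have p: "p \<ge> 1" unfolding p_def by (rule ge_one_powr_ge_zero) auto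
    have "cmod (f z + g z) \<le> exp (A * p) + exp (B * p)"
      unfolding p_def using norm_triangle_ineq A(2) B(2) by (meson add_mono order_trans)
    also have "\<dots> \<le> exp ((A + B) * p) + exp ((A + B) * p)"
      using A B p by (intro add_mono) (auto simp: distrib_right)
    also have "\<dots> = 2 * exp ((A + B) * p)" by simp
    also have "\<dots> \<le> exp p * exp ((A + B) * p)"
      using exp_ge_add_one_self[of p] p by (intro mult_right_mono) (linarith, simp)
    also have "\<dots> = exp ((A + B + 1) * p)" by (simp add: exp_add[symmetric] algebra_simps)
    finally show ?thesis by (simp add: p_def)
  qed
  thus ?thesis unfolding growth32_def using A B by (intro exI[of _ "A + B + 1"]) auto
qed

lemma growth32_uminus: "growth32 f \<Longrightarrow> growth32 (\<lambda>z. - f z)"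
  unfolding growth32_def by simp

lemma growth32_compose_affine:
  assumes f: "growth32 f" and c: "cmod c \<le> 1"
  shows "growth32 (\<lambda>z. f (c * z + d))"
proof -
  obtain A where A: "A \<ge> 0" "\<And>z. cmod (f z) \<le> exp (A * (1 + cmod z) powr (3/2))"
    using f unfolding growth32_def by blast
  have "cmod (f (c * z + d)) \<le> exp (A * (1 + cmod d) powr (3/2) * (1 + cmod z) powr (3/2))" for z
  proof -
    have "1 + cmod (c * z + d) \<le> 1 + (cmod z + cmod d)"
      using norm_triangle_ineq[of "c * z" d] mult_right_mono[OF c, of "cmod z"] by (simp add: norm_mult)
    also have "\<dots> \<le> (1 + cmod d) * (1 + cmod z)" by (simp add: algebra_simps)
    finally have "(1 + cmod (c * z + d)) powr (3/2) \<le> ((1 + cmod d) * (1 + cmod z)) powr (3/2)"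
      by (intro powr_mono2) auto
    also have "\<dots> = (1 + cmod d) powr (3/2) * (1 + cmod z) powr (3/2)" by (rule powr_mult)
    finally have "A * (1 + cmod (c * z + d)) powr (3/2) \<le> A * ((1 + cmod d) powr (3/2) * (1 + cmod z) powr (3/2))"
      using A(1) by (intro mult_left_mono) auto
    thus ?thesis using order_trans[OF A(2)[of "c * z + d"]] by (simp add: mult.assoc)
  qed
  thus ?thesis unfolding growth32_def using A(1) by (intro exI[of _ "A * (1 + cmod d) powr (3/2)"]) auto
qed

lemma entire_compose_affine:
  fixes f :: "complex \<Rightarrow> complex"
  assumes "f holomorphic_on UNIV"
  shows "(\<lambda>z. f (c * z + d)) holomorphic_on UNIV"
  by (rule holomorphic_on_compose_gen[OF _ assms, of "\<lambda>z. c * z + d" UNIV, unfolded o_def]) (auto intro!: holomorphic_intros)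

lemma growth32I:
  assumes "continuous_on UNIV f" and bd: "\<And>z. cmod z \<ge> 1 \<Longrightarrow> cmod (f z) \<le> exp (a * cmod z + b)"
  shows "growth32 f"
proof -
  have "compact (f ` cball 0 1)" using assms(1) by (intro compact_continuous_image) (auto intro: continuous_on_subset)
  then obtain K where K: "\<And>z. z \<in> cball 0 1 \<Longrightarrow> cmod (f z) \<le> K" using compact_imp_bounded bounded_iff by (metis imageI)
  define A where "A = \<bar>a\<bar> + \<bar>b\<bar> + \<bar>K\<bar>"
  have "cmod (f z) \<le> exp (A * (1 + cmod z) powr (3/2))" for z
  proof -
    have p: "1 + cmod z \<le> (1 + cmod z) powr (3/2)" using powr_mono[of 1 "3/2" "1 + cmod z"] by simp
    have "cmod (f z) \<le> exp (A * (1 + cmod z))"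
    proof (cases "cmod z \<ge> 1")
      case True
      have "a * cmod z \<le> \<bar>a\<bar> * (1 + cmod z)" by (intro mult_mono) auto
      moreover have "b \<le> \<bar>b\<bar> * (1 + cmod z)" using mult_left_mono[of 1 "1 + cmod z" "\<bar>b\<bar>"] by (smt (verit) abs_ge_self abs_ge_zero mult.right_neutral norm_ge_zero)
      moreover have "0 \<le> \<bar>K\<bar> * (1 + cmod z)" by simp
      ultimately have "a * cmod z + b \<le> A * (1 + cmod z)" unfolding A_def distrib_right by linarith
      thus ?thesis using bd[OF True] by (smt (verit) exp_le_cancel_iff)
    next
      case False
      have "cmod (f z) \<le> K" using False by (intro K) auto
      also have "\<dots> \<le> exp \<bar>K\<bar>" using exp_ge_add_one_self[of "\<bar>K\<bar>"] by linarith
      also have "\<bar>K\<bar> \<le> A" by (simp add: A_def)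
      also have "A \<le> A * (1 + cmod z)" by (simp add: A_def mult_le_cancel_left1)
      finally show ?thesis by simp
    qed
    also have "\<dots> \<le> exp (A * (1 + cmod z) powr (3/2))" using p by (simp add: A_def mult_left_mono)
    finally show ?thesis .
  qed
  thus ?thesis unfolding growth32_def by (intro exI[of _ A]) (auto simp: A_def)
qed

text \<open>Schwarz's lemma for the logarithm of \<open>f\<close>, composed with the Moebius map that sends
  the half-plane \<open>Re < L\<close> to the unit disc and \<open>ln (f 0)\<close> to \<open>0\<close>.\<close>

lemma zero_free_lower_bound:
  assumes hol: "f holomorphic_on ball 0 (2 * R)" and R: "R > 0" and nz: "\<And>z. z \<in> ball 0 (2 * R) \<Longrightarrow> f z \<noteq> 0"
    and bd: "\<And>z. z \<in> ball 0 (2 * R) \<Longrightarrow> cmod (f z) < exp L" and z: "cmod z \<le> R"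
  shows "exp (- 2 * L) * cmod (f 0) ^ 3 \<le> cmod (f z)"
proof -
  have 0: "0 \<in> ball 0 (2 * R)" using R by simp
  obtain h where h: "h holomorphic_on ball 0 (2 * R)" "\<And>x. x \<in> ball 0 (2 * R) \<Longrightarrow> exp (h x) = f x"
    using holomorphic_logarithm_exists[OF convex_ball open_ball hol nz 0] by blast
  have Reh: "Re (h x) < L" if "x \<in> ball 0 (2 * R)" for x
  proof -
    have "exp (Re (h x)) < exp L" using bd[OF that] h(2)[OF that] by (metis norm_exp_eq_Re)
    thus ?thesis by simp
  qed
  define w where "w = 2 * of_real L - cnj (h 0)"
  have less: "cmod (h x - h 0) < cmod (h x - w)" if "x \<in> ball 0 (2 * R)" for x
  proof -
    have "(cmod (h x - w))\<^sup>2 - (cmod (h x - h 0))\<^sup>2 = 4 * (L - Re (h x)) * (L - Re (h 0))"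
      unfolding cmod_power2 by (simp add: w_def power2_eq_square algebra_simps)
    also have "\<dots> > 0" using Reh[OF that] Reh[OF 0] by simp
    finally show ?thesis by (simp add: power2_less_imp_less)
  qed
  define \<phi> where "\<phi> = (\<lambda>u. (h (of_real (2 * R) * u) - h 0) / (h (of_real (2 * R) * u) - w))"
  have inb: "of_real (2 * R) * u \<in> ball 0 (2 * R)" if "cmod u < 1" for u :: complex
    using that R by (simp add: norm_mult)
  have h': "(\<lambda>u. h (of_real (2 * R) * u)) holomorphic_on ball 0 1"
    by (rule holomorphic_on_compose_gen[OF _ h(1), of "\<lambda>u. of_real (2 * R) * u" "ball 0 1", unfolded o_def])
       (use inb in \<open>auto intro!: holomorphic_intros\<close>)
  have nzd: "h (of_real (2 * R) * u) - w \<noteq> 0" if "cmod u < 1" for u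
    using less[OF inb[OF that]] by (metis norm_not_less_zero norm_zero)
  have "\<phi> holomorphic_on ball 0 1" unfolding \<phi>_def
    by (intro holomorphic_intros h') (use nzd in auto)
  moreover have "\<phi> 0 = 0" by (simp add: \<phi>_def)
  moreover have "cmod (\<phi> u) < 1" if "cmod u < 1" for u
  proof -
    have "cmod (h (of_real (2 * R) * u) - w) > 0" using nzd[OF that] by simp
    thus ?thesis using less[OF inb[OF that]] unfolding \<phi>_def norm_divide by (simp add: divide_less_eq)
  qed
  \<comment> \<open>As \<open>z\<close> lies within half the radius \<open>2 * R\<close>, Schwarz's
    lemma gives \<open>cmod (\<phi> u) \<le> 1/2\<close>. Solving this for \<open>h z - h 0\<close>
    produces the 2 and the 3 in the claim.\<close>
  moreover define u where "u = z / of_real (2 * R)"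
  moreover have u: "cmod u \<le> 1/2" using z R by (simp add: u_def norm_divide divide_le_eq)
  ultimately have "cmod (\<phi> u) \<le> cmod u" by (intro Schwarz_Lemma(1)) auto
  hence phi: "cmod (\<phi> u) \<le> 1/2" using u by linarith
  have zu: "of_real (2 * R) * u = z" using R by (simp add: u_def)
  have u1: "cmod u < 1" using u by linarith
  define d where "d = h z - h 0"
  have "cmod d \<le> 1/2 * cmod (h z - w)"
    using phi nzd[OF u1] unfolding \<phi>_def zu d_def norm_divide by (simp add: divide_le_eq)
  also have "h z - w = d - of_real (2 * (L - Re (h 0)))" by (simp add: w_def d_def complex_eq_iff)
  also have "cmod \<dots> \<le> cmod d + 2 * (L - Re (h 0))"
    using Reh[OF 0] by (intro order_trans[OF norm_triangle_ineq4]) (simp only: norm_of_real, simp)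
  finally have "cmod d \<le> 2 * (L - Re (h 0))" by simp
  moreover have "- cmod d \<le> Re d" using abs_Re_le_cmod[of d] by linarith
  ultimately have "3 * Re (h 0) - 2 * L \<le> Re (h z)" by (simp add: d_def)
  hence "exp (3 * Re (h 0) - 2 * L) \<le> exp (Re (h z))" by simp
  also have "\<dots> = cmod (f z)" using h(2)[OF inb[OF u1]] unfolding zu by (metis norm_exp_eq_Re)
  also have "exp (3 * Re (h 0) - 2 * L) = exp (- 2 * L) * cmod (f 0) ^ 3"
  proof -
    have "cmod (f 0) = exp (Re (h 0))" using h(2)[OF 0] by (metis norm_exp_eq_Re)
    thus ?thesis by (simp add: exp_add[symmetric] exp_of_nat_mult[symmetric])
  qed
  finally show ?thesis .
qed

section \<open>Growth of quotients of entire functions\<close>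

text \<open>Induction on the index set rather than on the set of zeros: one index accounts for one
  linear factor, so a zero of multiplicity \<open>k\<close> is removed through its \<open>k\<close>
  indices. At points of \<open>W\<close> that are not zeros the order stays 0.\<close>

lemma entire_factor_zeros:
  fixes lam :: "'i \<Rightarrow> complex"
  assumes "finite F" "f holomorphic_on UNIV" "\<exists>z. f z \<noteq> 0" "lam ` F \<subseteq> W"
    "\<And>w. w \<in> W \<Longrightarrow> zorder f w = int (card {n \<in> F. lam n = w})"
  shows "\<exists>g. g holomorphic_on UNIV \<and> (\<forall>z. f z = (\<Prod>n\<in>F. z - lam n) * g z) \<and> (\<forall>w\<in>W. g w \<noteq> 0)"
  using assms
proof (induction F arbitrary: f rule: finite_induct)
  case empty
  have "f w \<noteq> 0" if "w \<in> W" for w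
  proof -
    obtain \<beta> where "f \<beta> \<noteq> 0" using empty by blast
    have "\<forall>\<^sub>F z in at w. f z \<noteq> 0 \<and> z \<in> UNIV" by (rule non_zero_neighbour_alt[OF empty(1) _ _ _ _ \<open>f \<beta> \<noteq> 0\<close>]) auto
    hence "\<exists>\<^sub>F z in at w. f z \<noteq> 0" by (intro eventually_frequently) (auto elim: eventually_mono)
    moreover have "f analytic_on {w}" using empty(1) analytic_on_holomorphic by blast
    ultimately show ?thesis using zorder_eq_0_iff[of f w] empty(4)[OF that] by simp
  qed
  thus ?case using empty by auto
next
  case (insert n F)
  define w0 where "w0 = lam n"
  have w0: "w0 \<in> W" using insert by (auto simp: w0_def)
  obtain \<beta> where \<beta>: "f \<beta> \<noteq> 0" using insert by blast
  have ev: "\<forall>\<^sub>F z in at w. f z \<noteq> 0" for w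
    using non_zero_neighbour_alt[OF insert.prems(1) _ _ _ _ \<beta>, of w] by (auto elim: eventually_mono)
  have anal: "f analytic_on {w}" for w using insert.prems(1) analytic_on_holomorphic by blast
  have "n \<in> {m \<in> insert n F. lam m = w0}" by (simp add: w0_def)
  hence "card {m \<in> insert n F. lam m = w0} > 0" using insert by (intro card_gt_0_iff[THEN iffD2]) auto
  hence "zorder f w0 > 0" using insert.prems(4)[OF w0] by linarith
  hence fw0: "f w0 = 0" using zorder_eq_0I[OF anal, of w0] by auto
  define g where "g = (\<lambda>z. if z = w0 then deriv f w0 else (f z - f w0) / (z - w0))"
  have g: "g holomorphic_on UNIV" unfolding g_def by (rule pole_lemma_open[OF insert.prems(1) open_UNIV])
  have fg: "f z = (z - w0) * g z" for z using fw0 by (simp add: g_def)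
  have ganal: "g analytic_on {w}" for w using g analytic_on_holomorphic by blast
  have lanal: "(\<lambda>z. z - w0) analytic_on {w}" for w by (intro analytic_intros)
  have zo: "zorder f w = zorder (\<lambda>z. z - w0) w + zorder g w" for w
  proof -
    have "zorder (\<lambda>z. (z - w0) * g z) w = zorder (\<lambda>z. z - w0) w + zorder g w"
      by (rule zorder_times_analytic[OF lanal ganal]) (use ev[of w] fg in simp)
    moreover have "f = (\<lambda>z. (z - w0) * g z)" using fg by auto
    ultimately show ?thesis by simp
  qed
  have z1: "zorder (\<lambda>z. z - w0) w0 = 1"
    by (rule zorder_eqI[of UNIV _ "\<lambda>_. 1"]) auto
  have z0: "zorder (\<lambda>z. z - w0) w = 0" if "w \<noteq> w0" for w
    using that by (intro zorder_eq_0I lanal) auto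
  have "\<exists>h. h holomorphic_on UNIV \<and> (\<forall>z. g z = (\<Prod>n\<in>F. z - lam n) * h z) \<and> (\<forall>w\<in>W. h w \<noteq> 0)"
  proof (rule insert.IH[OF g])
    show "\<exists>z. g z \<noteq> 0" using \<beta> fg by (metis mult_zero_right)
    show "lam ` F \<subseteq> W" using insert by auto
    show "zorder g w = int (card {n \<in> F. lam n = w})" if w: "w \<in> W" for w
    proof (cases "w = w0")
      case True
      have "{m \<in> insert n F. lam m = w0} = insert n {m \<in> F. lam m = w0}" by (auto simp: w0_def)
      hence "card {m \<in> insert n F. lam m = w0} = Suc (card {m \<in> F. lam m = w0})" using insert by simp
      thus ?thesis using zo[of w] z1 insert.prems(4)[OF w] True by simp
    next
      case False
      have "{m \<in> insert n F. lam m = w} = {m \<in> F. lam m = w}" using False by (auto simp: w0_def)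
      thus ?thesis using zo[of w] z0[OF False] insert.prems(4)[OF w] by simp
    qed
  qed
  then obtain h where "h holomorphic_on UNIV" "\<And>z. g z = (\<Prod>n\<in>F. z - lam n) * h z" "\<And>w. w \<in> W \<Longrightarrow> h w \<noteq> 0" by blast
  thus ?case using insert fg by (intro exI[of _ h]) (auto simp: w0_def mult.assoc)
qed

lemma bound_from_sphere:
  assumes "f holomorphic_on UNIV" "\<And>z. cmod z = r \<Longrightarrow> cmod (f z) \<le> B" "cmod z \<le> r"
  shows "cmod (f z) \<le> B"
proof (rule maximum_modulus_frontier[of f "cball 0 r"])
  show "f holomorphic_on interior (cball 0 r)" using assms(1) holomorphic_on_subset by blast
  show "continuous_on (closure (cball 0 r)) f" using assms(1) holomorphic_on_imp_continuous_on continuous_on_subset by blast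
  show "cmod (f z) \<le> B" if "z \<in> frontier (cball 0 r)" for z
    using that assms(2) frontier_cball[of "0::complex" r] by auto
qed (use assms in auto)

text \<open>On the circle of radius \<open>4 * R\<close> the polynomial with the zeros in the disc
  of radius \<open>2 * R\<close> has modulus at least 1. Dividing it out therefore preserves the
  bounds for \<open>D\<close> and for \<open>H * D\<close> there, and the maximum principle brings
  them inside. The quotient \<open>g\<close> of \<open>D\<close> has no zeros in the smaller disc,
  hence is bounded below there in terms of \<open>g 0\<close>, and \<open>H = (H * g) / g\<close> is
  bounded above.\<close>

lemma growth32_quotient_centered:
  fixes lam :: "'i \<Rightarrow> complex"
  assumes H: "H holomorphic_on UNIV" and D: "D holomorphic_on UNIV"
    and growth: "growth32 (\<lambda>z. H z * D z)" "growth32 D" and D0: "D 0 \<noteq> 0"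
    and zo: "\<And>z. zorder D z = int (card {n \<in> I. lam n = z})"
    and count: "\<And>R. R \<ge> 1 \<Longrightarrow> finite {n \<in> I. cmod (lam n) \<le> R} \<and> real (card {n \<in> I. cmod (lam n) \<le> R}) \<le> a * R"
  shows "growth32 H"
proof -
  obtain A B where A: "A \<ge> 0" "\<And>z. cmod (H z * D z) \<le> exp (A * (1 + cmod z) powr (3/2))"
    and B: "B \<ge> 0" "\<And>z. cmod (D z) \<le> exp (B * (1 + cmod z) powr (3/2))"
    using growth unfolding growth32_def by blast
  have a0: "a \<ge> 0" using count[of 1] of_nat_0_le_iff order_trans by fastforce
  define c where "c = \<bar>ln (cmod (D 0))\<bar>"
  \<comment> \<open>Here 5 stems from \<open>1 + 4 * R \<le> 5 * (1 + cmod z)\<close>,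
    \<open>2 * B\<close> and the summand 2 from the factor \<open>exp (- 2 * (L + 1))\<close> and
    the final 3 from the cube of \<open>cmod (g 0)\<close> in the lower bound for \<open>g\<close>;
    \<open>16 * a\<close> accounts for the removed zeros and \<open>c\<close> for the size of
    \<open>D 0\<close>.\<close>
  define K where "K = (A + 2 * B) * 5 powr (3/2) + 2 + 3 * (16 * a + c)"
  have main: "cmod (H z) \<le> exp (K * (1 + cmod z) powr (3/2))" for z
  proof -
    define R where "R = max 1 (cmod z)"
    have R: "R \<ge> 1" "cmod z \<le> R" by (auto simp: R_def)
    define W where "W = cball (0::complex) (2 * R)"
    define F where "F = {n \<in> I. cmod (lam n) \<le> 2 * R}"
    define m where "m = card F"
    have F: "finite F" "real m \<le> a * (2 * R)" using count[of "2 * R"] R by (auto simp: F_def m_def)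
    have "\<exists>g. g holomorphic_on UNIV \<and> (\<forall>z. D z = (\<Prod>n\<in>F. z - lam n) * g z) \<and> (\<forall>w\<in>W. g w \<noteq> 0)"
    proof (rule entire_factor_zeros[OF F(1) D])
      show "\<exists>z. D z \<noteq> 0" using D0 by blast
      show "lam ` F \<subseteq> W" by (auto simp: F_def W_def)
      show "zorder D w = int (card {n \<in> F. lam n = w})" if "w \<in> W" for w
      proof -
        have "{n \<in> F. lam n = w} = {n \<in> I. lam n = w}" using that by (auto simp: F_def W_def)
        thus ?thesis using zo by simp
      qed
    qed
    then obtain g where g: "g holomorphic_on UNIV" and Dg: "\<And>z. D z = (\<Prod>n\<in>F. z - lam n) * g z" and gnz: "\<And>w. w \<in> W \<Longrightarrow> g w \<noteq> 0"
      by blast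
    define L where "L = B * (1 + 4 * R) powr (3/2)"
    have P: "1 \<le> cmod (\<Prod>n\<in>F. u - lam n)" if "cmod u = 4 * R" for u
    proof -
      have "1 \<le> cmod (u - lam n)" if n: "n \<in> F" for n
      proof -
        have "cmod u - cmod (lam n) \<le> cmod (u - lam n)" by (rule norm_triangle_ineq2)
        moreover have "cmod (lam n) \<le> 2 * R" using n by (simp add: F_def)
        ultimately show ?thesis using R \<open>cmod u = 4 * R\<close> by linarith
      qed
      thus ?thesis by (simp add: prod_norm[symmetric] prod_ge_1)
    qed
    have gb: "cmod (g u) \<le> exp L" if "cmod u \<le> 4 * R" for u
    proof (rule bound_from_sphere[OF g _ that])
      fix v :: complex assume v: "cmod v = 4 * R"
      have "1 * cmod (g v) \<le> cmod (\<Prod>n\<in>F. v - lam n) * cmod (g v)" using P[OF v] by (intro mult_right_mono) auto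
      also have "\<dots> = cmod (D v)" by (simp add: Dg norm_mult)
      also have "\<dots> \<le> exp L" using B(2)[of v] v by (simp add: L_def)
      finally show "cmod (g v) \<le> exp L" by simp
    qed
    have Hgb: "cmod (H z * g z) \<le> exp (A * (1 + 4 * R) powr (3/2))"
    proof (rule bound_from_sphere[of "\<lambda>z. H z * g z" "4 * R"])
      show "(\<lambda>z. H z * g z) holomorphic_on UNIV" by (intro holomorphic_intros H g)
      show "cmod z \<le> 4 * R" using R by linarith
      fix v :: complex assume v: "cmod v = 4 * R"
      have "1 * cmod (H v * g v) \<le> cmod (\<Prod>n\<in>F. v - lam n) * cmod (H v * g v)" using P[OF v] by (intro mult_right_mono) auto
      also have "\<dots> = cmod (H v * D v)" by (simp add: Dg norm_mult)
      also have "\<dots> \<le> exp (A * (1 + 4 * R) powr (3/2))" using A(2)[of v] v by simp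
      finally show "cmod (H v * g v) \<le> exp (A * (1 + 4 * R) powr (3/2))" by simp
    qed
    \<comment> \<open>\<open>L + 1\<close> in place of \<open>L\<close>, since the bound for
      zero-free functions starts from a strict inequality.\<close>
    have low: "exp (- 2 * (L + 1)) * cmod (g 0) ^ 3 \<le> cmod (g z)"
    proof (rule zero_free_lower_bound[of g R])
      show "g holomorphic_on ball 0 (2 * R)" using g holomorphic_on_subset by blast
      show "g u \<noteq> 0" if "u \<in> ball 0 (2 * R)" for u using that gnz by (auto simp: W_def)
      show "cmod (g u) < exp (L + 1)" if "u \<in> ball 0 (2 * R)" for u
        using gb[of u] that by (smt (verit) exp_less_cancel_iff mem_ball_0 norm_ge_zero)
    qed (use R in auto)
    \<comment> \<open>Trading the logarithm for a square root is what fits a linear number of zeros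
      under the exponent 3/2.\<close>
    have lnR: "ln (2 * R) \<le> 2 * (2 * R) powr (1/2)"
    proof -
      have "ln ((2 * R) powr (1/2)) \<le> (2 * R) powr (1/2)" using R by (intro order_trans[OF ln_le_minus_one]) auto
      thus ?thesis using R by (simp add: ln_powr)
    qed
    \<comment> \<open>The removed polynomial has modulus at most \<open>(2 * R) ^ m\<close> at the
      origin, so \<open>g 0\<close> can fall below \<open>D 0\<close> only by this factor.\<close>
    have g0: "exp (- (real m * ln (2 * R)) - c) \<le> cmod (g 0)"
    proof -
      have "cmod (\<Prod>n\<in>F. 0 - lam n) = (\<Prod>n\<in>F. cmod (lam n))" by (simp add: prod_norm[symmetric])
      also have "\<dots> \<le> (\<Prod>n\<in>F. 2 * R)" by (intro prod_mono) (auto simp: F_def)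
      also have "\<dots> = exp (real m * ln (2 * R))" using R by (simp add: m_def exp_of_nat_mult)
      finally have "cmod (\<Prod>n\<in>F. 0 - lam n) \<le> exp (real m * ln (2 * R))" .
      hence "cmod (D 0) \<le> exp (real m * ln (2 * R)) * cmod (g 0)"
        unfolding Dg[of 0] norm_mult by (intro mult_right_mono) auto
      moreover have "exp (- c) \<le> cmod (D 0)" 
      proof -
        have "exp (- c) \<le> exp (ln (cmod (D 0)))" by (simp add: c_def)
        thus ?thesis using D0 by simp
      qed
      ultimately have "exp (- (real m * ln (2 * R))) * exp (- c) \<le> exp (- (real m * ln (2 * R))) * (exp (real m * ln (2 * R)) * cmod (g 0))"
        by (intro mult_left_mono) auto
      thus ?thesis by (simp add: mult.assoc[symmetric] exp_add[symmetric])
    qed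
    have gz: "exp (- 2 * (L + 1) - 3 * (real m * ln (2 * R) + c)) \<le> cmod (g z)"
    proof -
      have "exp (- 2 * (L + 1) - 3 * (real m * ln (2 * R) + c)) = exp (- 2 * (L + 1)) * exp (- (real m * ln (2 * R)) - c) ^ 3"
        by (simp add: exp_of_nat_mult[symmetric] exp_add[symmetric] algebra_simps)
      also have "\<dots> \<le> exp (- 2 * (L + 1)) * cmod (g 0) ^ 3"
        by (intro mult_left_mono power_mono g0) auto
      finally show ?thesis using low by linarith
    qed
    define q where "q = (1 + cmod z) powr (3/2)"
    have q1: "q \<ge> 1" unfolding q_def by (rule ge_one_powr_ge_zero) auto
    have R1: "R \<le> 1 + cmod z" by (simp add: R_def)
    have "1 + 4 * R \<le> 5 * (1 + cmod z)" by (rule order_trans[of _ "1 + 4 * (1 + cmod z)"]) (use R1 in simp_all)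
    hence "(1 + 4 * R) powr (3/2) \<le> (5 * (1 + cmod z)) powr (3/2)" using R by (intro powr_mono2) auto
    also have "\<dots> = 5 powr (3/2) * q" unfolding q_def by (rule powr_mult)
    finally have e1: "(1 + 4 * R) powr (3/2) \<le> 5 powr (3/2) * q" .
    have p3: "(2 * R) powr (3/2) \<le> 8 * q"
    proof -
      have "(2 * R) powr (3/2) \<le> (2 * (1 + cmod z)) powr (3/2)" using R R1 by (intro powr_mono2) auto
      also have "\<dots> = 2 powr (3/2) * q" unfolding q_def by (rule powr_mult)
      also have "\<dots> \<le> (2::real) powr 3 * q" using q1 by (intro mult_right_mono powr_mono) auto
      finally show ?thesis by simp
    qed
    have e2: "real m * ln (2 * R) \<le> 16 * a * q"
    proof -
      have "real m * ln (2 * R) \<le> (a * (2 * R)) * (2 * (2 * R) powr (1/2))"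
        using F(2) lnR R a0 by (intro mult_mono) auto
      also have "\<dots> = 2 * a * (2 * R) powr (3/2)"
      proof -
        have "(2 * R) powr (1 + 1/2) = (2 * R) * (2 * R) powr (1/2)" using R by (subst powr_add) simp
        thus ?thesis by simp
      qed
      also have "\<dots> \<le> 2 * a * (8 * q)" using p3 a0 by (intro mult_left_mono) auto
      finally show ?thesis by simp
    qed
    have "cmod (H z) * exp (- 2 * (L + 1) - 3 * (real m * ln (2 * R) + c)) \<le> cmod (H z) * cmod (g z)"
      by (intro mult_left_mono gz) auto
    also have "\<dots> \<le> exp (A * (1 + 4 * R) powr (3/2))" using Hgb by (simp add: norm_mult)
    finally have "cmod (H z) * exp (- 2 * (L + 1) - 3 * (real m * ln (2 * R) + c)) * exp (2 * (L + 1) + 3 * (real m * ln (2 * R) + c))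
       \<le> exp (A * (1 + 4 * R) powr (3/2)) * exp (2 * (L + 1) + 3 * (real m * ln (2 * R) + c))"
      by (intro mult_right_mono) auto
    hence "cmod (H z) \<le> exp (A * (1 + 4 * R) powr (3/2) + 2 * (L + 1) + 3 * (real m * ln (2 * R) + c))"
      by (simp add: mult.assoc exp_add[symmetric] add.assoc)
    also have "\<dots> \<le> exp (K * q)"
    proof -
      have "A * (1 + 4 * R) powr (3/2) \<le> A * (5 powr (3/2) * q)" by (intro mult_left_mono e1 A)
      moreover have "L \<le> B * (5 powr (3/2) * q)" unfolding L_def by (intro mult_left_mono e1 B)
      moreover have "c \<le> c * q" using q1 by (simp add: c_def mult_le_cancel_left1)
      ultimately have "A * (1 + 4 * R) powr (3/2) + 2 * (L + 1) + 3 * (real m * ln (2 * R) + c) \<le>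
        A * (5 powr (3/2) * q) + 2 * (B * (5 powr (3/2) * q) + q) + 3 * (16 * a * q + c * q)"
        using e1 e2 q1 A(1) by (intro add_mono mult_left_mono) auto
      also have "\<dots> = K * q" by (simp add: K_def algebra_simps)
      finally show ?thesis by simp
    qed
    finally show ?thesis by (simp add: q_def)
  qed
  have "K \<ge> 0" using A B a0 by (simp add: K_def c_def)
  thus ?thesis unfolding growth32_def using main by blast
qed

text \<open>The characteristic function may vanish at the origin, so the centre is moved to a point
  where it does not; the counting bound survives with a larger constant.\<close>

lemma growth32_quotient:
  fixes lam :: "'i \<Rightarrow> complex"
  assumes H: "H holomorphic_on UNIV" and D: "D holomorphic_on UNIV"
    and growth: "growth32 (\<lambda>z. H z * D z)" "growth32 D" and D0: "D z0 \<noteq> 0"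
    and zo: "\<And>z. zorder D z = int (card {n \<in> I. lam n = z})"
    and count: "\<And>R. R \<ge> 1 \<Longrightarrow> finite {n \<in> I. cmod (lam n) \<le> R} \<and> real (card {n \<in> I. cmod (lam n) \<le> R}) \<le> a * R"
  shows "growth32 H"
proof -
  have "growth32 (\<lambda>z. H (z + z0))"
  proof (rule growth32_quotient_centered[of _ "\<lambda>z. D (z + z0)" I "\<lambda>n. lam n - z0" "a * (1 + cmod z0)"])
    show "(\<lambda>z. H (z + z0)) holomorphic_on UNIV" "(\<lambda>z. D (z + z0)) holomorphic_on UNIV"
      using entire_compose_affine[OF H, of 1 z0] entire_compose_affine[OF D, of 1 z0] by simp_all
    show "growth32 (\<lambda>z. H (z + z0) * D (z + z0))" "growth32 (\<lambda>z. D (z + z0))"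
      using growth32_compose_affine[OF growth(1), of 1 z0] growth32_compose_affine[OF growth(2), of 1 z0] by simp_all
    show "D (0 + z0) \<noteq> 0" using D0 by simp
    show "zorder (\<lambda>z. D (z + z0)) z = int (card {n \<in> I. lam n - z0 = z})" for z
    proof -
      have "zorder (\<lambda>z. D (z + z0)) z = zorder (\<lambda>u. D (u + z + z0)) 0" by (rule zorder_shift)
      also have "\<dots> = zorder D (z + z0)" by (subst zorder_shift[of D "z + z0"]) (simp add: add.assoc)
      finally have "zorder (\<lambda>z. D (z + z0)) z = zorder D (z + z0)" .
      moreover have "{n \<in> I. lam n = z + z0} = {n \<in> I. lam n - z0 = z}" by (auto simp: algebra_simps)
      ultimately show ?thesis using zo[of "z + z0"] by simp
    qed
    show "finite {n \<in> I. cmod (lam n - z0) \<le> R} \<and> real (card {n \<in> I. cmod (lam n - z0) \<le> R}) \<le> a * (1 + cmod z0) * R"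
      if R: "R \<ge> 1" for R
    proof -
      have "cmod z0 \<le> R * cmod z0" using R by (simp add: mult_le_cancel_right1)
      hence sub: "{n \<in> I. cmod (lam n - z0) \<le> R} \<subseteq> {n \<in> I. cmod (lam n) \<le> R * (1 + cmod z0)}"
        by (auto simp: algebra_simps) (smt (verit) norm_triangle_sub norm_minus_commute)
      have "R * (1 + cmod z0) \<ge> 1" using R by (smt (verit) mult_le_cancel_left1 norm_ge_zero)
      from count[OF this] have fin: "finite {n \<in> I. cmod (lam n) \<le> R * (1 + cmod z0)}"
        and "real (card {n \<in> I. cmod (lam n) \<le> R * (1 + cmod z0)}) \<le> a * (R * (1 + cmod z0))" by auto
      thus ?thesis using card_mono[OF fin sub] finite_subset[OF sub fin] by (auto simp: mult_ac)
    qed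
  qed
  from growth32_compose_affine[OF this, of 1 "- z0"] show ?thesis by simp
qed

section \<open>Phragmen-Lindeloef principle in quarter planes\<close>

text \<open>In the shifted quarter plane the argument is at most \<open>pi / 4\<close>, and 7/4 of
  it at most \<open>7 * pi / 16 < pi / 2\<close>, so the cosine stays positive. The exponent 7/4
  lies strictly between the growth 3/2 and the critical order 2; the shift by 1 keeps the apex away
  from the branch cut.\<close>

lemma sector_powr_lower_bound:
  assumes "\<bar>Im z\<bar> \<le> Re z"
  shows "cos (7 * pi / 16) * cmod z powr (7/4) \<le> Re ((z + 1) powr (7/4))"
proof -
  define w where "w = z + 1"
  have w: "Re w > 0" "\<bar>Im w\<bar> \<le> Re w" using assms by (auto simp: w_def)
  hence "w \<noteq> 0" by auto
  note w = w this
  have "Im (Ln w) = arctan (Im w / Re w)" using Im_Ln_eq[OF w(3)] w(1) by simp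
  moreover have "\<bar>arctan (Im w / Re w)\<bar> \<le> pi / 4"
  proof -
    have "-1 \<le> Im w / Re w" "Im w / Re w \<le> 1" using w(1,2) by (auto simp: field_simps)
    hence "arctan (-1) \<le> arctan (Im w / Re w)" "arctan (Im w / Re w) \<le> arctan 1" by (simp_all only: arctan_le_iff)
    thus ?thesis using arctan_minus[of 1] arctan_one by linarith
  qed
  ultimately have arg: "\<bar>7/4 * Im (Ln w)\<bar> \<le> 7 * pi / 16" by (simp add: abs_mult)
  have "cos (7 * pi / 16) \<le> cos \<bar>7/4 * Im (Ln w)\<bar>" using arg pi_gt_zero by (intro cos_monotone_0_pi_le) auto
  hence c: "cos (7 * pi / 16) \<le> cos (7/4 * Im (Ln w))" by (simp only: cos_abs_real)
  have c0: "cos (7 * pi / 16) \<ge> 0" using pi_gt_zero by (intro cos_ge_zero) auto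
  have "Re (w powr (7/4)) = exp (7/4 * ln (cmod w)) * cos (7/4 * Im (Ln w))"
    using w(3) by (simp add: powr_def Re_exp)
  also have "exp (7/4 * ln (cmod w)) = cmod w powr (7/4)" using w(3) by (simp add: powr_def)
  finally have eq: "Re (w powr (7/4)) = cmod w powr (7/4) * cos (7/4 * Im (Ln w))" .
  have "cmod z \<le> cmod w"
  proof -
    have "Re z \<ge> 0" using assms by linarith
    hence "(cmod z)\<^sup>2 \<le> (cmod w)\<^sup>2" unfolding cmod_power2 w_def by (simp add: power2_eq_square algebra_simps)
    thus ?thesis by (rule power2_le_imp_le) simp
  qed
  hence "cmod z powr (7/4) * cos (7 * pi / 16) \<le> cmod w powr (7/4) * cos (7/4 * Im (Ln w))"
    using c c0 by (intro mult_mono powr_mono2) auto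
  thus ?thesis unfolding eq[symmetric] by (simp add: w_def mult.commute)
qed

text \<open>The factor \<open>exp (- \<delta> * (z + 1) powr (7/4))\<close> has modulus at most 1 on
  the edges and outweighs growth of order 3/2 on a large arc. The maximum principle on the truncated
  sector bounds the product, and then \<delta> tends to 0.\<close>

lemma phragmen_lindelof_quarter:
  assumes f: "f holomorphic_on UNIV" and gr: "growth32 f" and B: "B > 0"
    and bd: "\<And>z. \<bar>Im z\<bar> = Re z \<Longrightarrow> cmod (f z) \<le> B" and z: "\<bar>Im z\<bar> \<le> Re z"
  shows "cmod (f z) \<le> B"
proof -
  obtain A where A: "A \<ge> 0" "\<And>z. cmod (f z) \<le> exp (A * (1 + cmod z) powr (3/2))"
    using gr unfolding growth32_def by blast
  define \<kappa> where "\<kappa> = cos (7 * pi / 16)"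
  have \<kappa>: "\<kappa> > 0" unfolding \<kappa>_def using pi_gt_zero by (intro cos_gt_zero) auto
  have key: "cmod (f z) \<le> B * exp (\<delta> * Re ((z + 1) powr (7/4)))" if \<delta>: "\<delta> > 0" for \<delta>
  proof -
    define g where "g = (\<lambda>z. f z * exp (- of_real \<delta> * (z + 1) powr (7/4)))"
    have ng: "cmod (g u) = cmod (f u) * exp (- \<delta> * Re ((u + 1) powr (7/4)))" for u
      by (simp add: g_def norm_mult norm_exp_eq_Re)
    have "((\<lambda>R. exp (A * (1 + R) powr (3/2) - \<delta> * \<kappa> * R powr (7/4))) \<longlongrightarrow> 0) at_top"
      using \<delta> \<kappa> by real_asymp
    hence "\<forall>\<^sub>F R in at_top. exp (A * (1 + R) powr (3/2) - \<delta> * \<kappa> * R powr (7/4)) < B"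
      using B by (rule order_tendstoD)
    hence "\<forall>\<^sub>F R in at_top. exp (A * (1 + R) powr (3/2) - \<delta> * \<kappa> * R powr (7/4)) < B \<and> R \<ge> cmod z \<and> R > 0"
      using eventually_ge_at_top[of "cmod z"] eventually_gt_at_top[of 0] by eventually_elim auto
    then obtain R where R: "exp (A * (1 + R) powr (3/2) - \<delta> * \<kappa> * R powr (7/4)) < B" "R \<ge> cmod z" "R > 0"
      using eventually_happens'[OF trivial_limit_at_top_linorder] by blast
    define S where "S = {u. \<bar>Im u\<bar> \<le> Re u} \<inter> cball 0 R"
    have clS: "closed S" unfolding S_def by (intro closed_Int closed_cball closed_Collect_le continuous_intros)
    have holS: "g holomorphic_on {u. Re u > -1}"
      unfolding g_def by (intro holomorphic_intros holomorphic_on_subset[OF f]) (auto simp: complex_nonpos_Reals_iff)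
    have SS: "S \<subseteq> {u. Re u > -1}" unfolding S_def by auto
    have "cmod (g z) \<le> B"
    proof (rule maximum_modulus_frontier[of g S])
      show "g holomorphic_on interior S" using holS SS interior_subset holomorphic_on_subset by (metis order_trans)
      show "continuous_on (closure S) g" using holS SS clS holomorphic_on_imp_continuous_on continuous_on_subset by (metis closure_closed)
      show "bounded S" unfolding S_def by (auto intro: bounded_subset[OF bounded_cball[of 0 R]])
      show "z \<in> S" using z R by (simp add: S_def)
      fix u assume u: "u \<in> frontier S"
      hence uS: "u \<in> S" "u \<notin> interior S" using clS by (auto simp: frontier_def)
      hence us: "\<bar>Im u\<bar> \<le> Re u" by (simp add: S_def)
      have kz: "\<kappa> * cmod u powr (7/4) \<le> Re ((u + 1) powr (7/4))"
        using sector_powr_lower_bound[OF us] by (simp add: \<kappa>_def)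
      have "\<bar>Im u\<bar> = Re u \<or> cmod u = R"
      proof (rule ccontr)
        assume "\<not> (\<bar>Im u\<bar> = Re u \<or> cmod u = R)"
        hence "u \<in> {u. \<bar>Im u\<bar> < Re u} \<inter> ball 0 R" using uS(1) by (auto simp: S_def)
        moreover have "open ({u. \<bar>Im u\<bar> < Re u} \<inter> ball 0 R)"
          by (intro open_Int open_ball open_Collect_less continuous_intros)
        moreover have "{u. \<bar>Im u\<bar> < Re u} \<inter> ball 0 R \<subseteq> S" by (auto simp: S_def)
        ultimately have "u \<in> interior S" using interior_maximal by blast
        thus False using uS by blast
      qed
      thus "cmod (g u) \<le> B"
      proof
        assume "\<bar>Im u\<bar> = Re u"
        have "0 \<le> \<kappa> * cmod u powr (7/4)" using \<kappa> by simp
        hence "exp (- \<delta> * Re ((u + 1) powr (7/4))) \<le> 1" using kz \<delta> by simp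
        hence "cmod (g u) \<le> B * 1" unfolding ng using bd[OF \<open>\<bar>Im u\<bar> = Re u\<close>] B by (intro mult_mono) auto
        thus ?thesis by simp
      next
        assume Ru: "cmod u = R"
        have "cmod (g u) \<le> exp (A * (1 + R) powr (3/2)) * exp (- \<delta> * (\<kappa> * R powr (7/4)))"
          unfolding ng using A(2)[of u] kz \<delta> Ru by (intro mult_mono) auto
        also have "\<dots> = exp (A * (1 + R) powr (3/2) - \<delta> * \<kappa> * R powr (7/4))" by (simp add: exp_add[symmetric] mult.assoc)
        finally show ?thesis using R(1) by linarith
      qed
    qed
    hence "cmod (f z) * exp (- \<delta> * Re ((z + 1) powr (7/4))) * exp (\<delta> * Re ((z + 1) powr (7/4))) \<le> B * exp (\<delta> * Re ((z + 1) powr (7/4)))"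
      unfolding ng by (intro mult_right_mono) auto
    thus ?thesis by (simp add: mult.assoc exp_add[symmetric])
  qed
  have "((\<lambda>\<delta>. B * exp (\<delta> * Re ((z + 1) powr (7/4)))) \<longlongrightarrow> B * exp (0 * Re ((z + 1) powr (7/4)))) (at_right 0)"
    by (intro tendsto_intros)
  moreover have "\<forall>\<^sub>F \<delta> in at_right 0. cmod (f z) \<le> B * exp (\<delta> * Re ((z + 1) powr (7/4)))"
    using eventually_at_right_less[of 0] by eventually_elim (rule key)
  ultimately have "cmod (f z) \<le> B * exp (0 * Re ((z + 1) powr (7/4)))"
    by (rule tendsto_lowerbound) simp
  thus ?thesis by simp
qed

text \<open>Boundedness on the diagonals spreads to each quarter plane after rotation by a power of
  \<open>\<i>\<close>, Liouville's theorem makes \<open>f\<close> constant, and the limit along one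
  diagonal identifies the constant.\<close>

lemma entire_eq_zero_if_decaying_on_diagonals:
  assumes f: "f holomorphic_on UNIV" and gr: "growth32 f"
    and lim: "\<And>\<omega>. cmod \<omega> = 1 \<Longrightarrow> \<bar>Re \<omega>\<bar> = \<bar>Im \<omega>\<bar> \<Longrightarrow> ((\<lambda>r. f (of_real r * \<omega>)) \<longlongrightarrow> 0) at_top"
  shows "f z = 0"
proof -
  define W where "W = {\<omega>. cmod \<omega> = 1 \<and> \<bar>Re \<omega>\<bar> = \<bar>Im \<omega>\<bar>}"
  define s where "s = sqrt (1/2)"
  have Ws: "\<omega> \<in> {Complex s s, Complex s (-s), Complex (-s) s, Complex (-s) (-s)}" if "\<omega> \<in> W" for \<omega>
  proof -
    have "(Re \<omega>)\<^sup>2 + (Im \<omega>)\<^sup>2 = 1" "(Re \<omega>)\<^sup>2 = (Im \<omega>)\<^sup>2" using that cmod_power2[of \<omega>] unfolding W_def by (auto simp: power2_eq_iff abs_eq_iff)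
    hence "(Re \<omega>)\<^sup>2 = s\<^sup>2" "(Im \<omega>)\<^sup>2 = s\<^sup>2" by (auto simp: s_def)
    thus ?thesis by (auto simp: power2_eq_iff complex_eq_iff)
  qed
  \<comment> \<open>Only four unit vectors lie on the diagonals, so that one radius
    \<open>r0\<close> serves all of them.\<close>
  have finW: "finite W" by (rule finite_subset[of _ "{Complex s s, Complex s (-s), Complex (-s) s, Complex (-s) (-s)}"]) (use Ws in auto)
  have "\<forall>\<^sub>F r in at_top. \<forall>\<omega>\<in>W. cmod (f (of_real r * \<omega>)) < 1"
    using finW by (subst eventually_ball_finite_distrib) (auto simp: W_def intro!: order_tendstoD(2)[OF tendsto_norm_zero[OF lim]])
  then obtain r0 where r0: "\<And>r \<omega>. r \<ge> r0 \<Longrightarrow> \<omega> \<in> W \<Longrightarrow> cmod (f (of_real r * \<omega>)) < 1"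
    unfolding eventually_at_top_linorder by blast
  have "compact (f ` cball 0 r0)" using f by (intro compact_continuous_image) (auto intro: holomorphic_on_imp_continuous_on continuous_on_subset)
  then obtain K where K: "\<And>u. u \<in> cball 0 r0 \<Longrightarrow> cmod (f u) \<le> K" using compact_imp_bounded bounded_iff by (metis imageI)
  define B where "B = max 1 K"
  have diag: "cmod (f u) \<le> B" if u: "\<bar>Re u\<bar> = \<bar>Im u\<bar>" for u
  \<comment> \<open>The origin is singled out because \<open>r0\<close> may be negative, in which
    case the disc of radius \<open>r0\<close> is empty.\<close>
  proof (cases "cmod u \<le> r0 \<or> u = 0")
    case True
    show ?thesis
    proof (cases "cmod u \<le> r0")
      case True thus ?thesis using K[of u] by (simp add: B_def)
    next
      case False
      hence "u = 0" "r0 < 0" using True by auto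
      have "Complex s s \<in> W" by (simp add: W_def s_def cmod_def real_sqrt_divide power_divide)
      from r0[of 0, OF _ this] \<open>r0 < 0\<close> \<open>u = 0\<close> show ?thesis by (simp add: B_def)
    qed
  next
    case False
    have "u / of_real (cmod u) \<in> W" using False u by (auto simp: W_def norm_divide)
    from r0[OF _ this, of "cmod u"] False show ?thesis by (simp add: B_def)
  qed
  have hol: "(\<lambda>z. f (c * z)) holomorphic_on UNIV" for c
    using entire_compose_affine[OF f, of c 0] by simp
  have sec: "cmod (f (c * u)) \<le> B" if c: "c \<in> {1, -1, \<i>, -\<i>}" and u: "\<bar>Im u\<bar> \<le> Re u" for c u
  proof (rule phragmen_lindelof_quarter[of "\<lambda>z. f (c * z)", OF hol _ _ _ u])
    show "growth32 (\<lambda>z. f (c * z))" using growth32_compose_affine[OF gr, of c 0] c by auto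
    show "B > 0" by (simp add: B_def)
    show "cmod (f (c * v)) \<le> B" if "\<bar>Im v\<bar> = Re v" for v
      using that c by (intro diag) auto
  qed
  have all: "cmod (f u) \<le> B" for u
  proof -
    consider "\<bar>Im u\<bar> \<le> Re u" | "\<bar>Im u\<bar> \<le> - Re u" | "\<bar>Re u\<bar> \<le> Im u" | "\<bar>Re u\<bar> \<le> - Im u" by linarith
    thus ?thesis
    proof cases
      case 1 thus ?thesis using sec[of 1 u] by simp
    next
      case 2 thus ?thesis using sec[of "-1" "- u"] by simp
    next
      case 3 thus ?thesis using sec[of "\<i>" "- \<i> * u"] by simp
    next
      case 4 thus ?thesis using sec[of "- \<i>" "\<i> * u"] by simp
    qed
  qed
  hence "bounded (range f)" by (auto simp: bounded_iff)
  from Liouville_theorem[OF f this] obtain c where c: "\<And>u. f u = c" by (auto simp: constant_on_def)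
  have "Complex s s \<in> W" by (simp add: W_def s_def cmod_def real_sqrt_divide power_divide)
  hence "((\<lambda>r::real. c) \<longlongrightarrow> 0) at_top" using lim[of "Complex s s"] c by (simp add: W_def)
  hence "c = 0" by (simp add: tendsto_const_iff)
  thus ?thesis using c by simp
qed

section \<open>The difference of the Weyl functions\<close>

text \<open>The residue of \<open>k w / (w - z) ^ Suc \<nu>\<close> is the \<nu>-th Taylor
  coefficient of \<open>k\<close> at \<open>z\<close>, and each vanishing coefficient splits off one
  factor \<open>w - z\<close>.\<close>

lemma divide_power_if_residues_zero:
  assumes "k holomorphic_on ball z r" "r > 0" "\<And>\<nu>. \<nu> < m \<Longrightarrow> residue (\<lambda>w. k w / (w - z) ^ Suc \<nu>) z = 0"
  shows "\<exists>k2. k2 holomorphic_on ball z r \<and> (\<forall>w\<in>ball z r. k w = (w - z) ^ m * k2 w)"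
  using assms
proof (induction m arbitrary: k)
  case 0
  thus ?case by auto
next
  case (Suc m)
  have "residue (\<lambda>w. k w / (w - z)) z = k z"
    using Suc.prems by (intro residue_simple[of "ball z r"]) auto
  hence kz: "k z = 0" using Suc.prems(3)[of 0] by simp
  define k1 where "k1 = (\<lambda>w. if w = z then deriv k z else (k w - k z) / (w - z))"
  have k1: "k1 holomorphic_on ball z r" unfolding k1_def by (rule pole_lemma_open[OF Suc.prems(1)]) simp
  have kk1: "k w = (w - z) * k1 w" for w using kz by (simp add: k1_def)
  have "\<exists>k2. k2 holomorphic_on ball z r \<and> (\<forall>w\<in>ball z r. k1 w = (w - z) ^ m * k2 w)"
  proof (rule Suc.IH[OF k1 Suc.prems(2)])
    fix \<nu> assume "\<nu> < m"
    have "residue (\<lambda>w. k1 w / (w - z) ^ Suc \<nu>) z = residue (\<lambda>w. k w / (w - z) ^ Suc (Suc \<nu>)) z"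
      by (rule residue_cong) (auto simp: eventually_at_filter kk1)
    thus "residue (\<lambda>w. k1 w / (w - z) ^ Suc \<nu>) z = 0" using Suc.prems(3)[of "Suc \<nu>"] \<open>\<nu> < m\<close> by simp
  qed
  thus ?case by (auto simp: kk1 mult.assoc)
qed

text \<open>Near a common zero of order \<open>m\<close> the difference is
  \<open>k w / (w - z) ^ m\<close> with \<open>k\<close> holomorphic. The weighted residues are the
  first \<open>m\<close> Taylor coefficients of \<open>k\<close>, so their agreement makes the
  singularity removable.\<close>

lemma holomorphic_difference_if_principal_parts_agree:
  fixes N D N' D' :: "complex \<Rightarrow> complex"
  assumes hol: "N holomorphic_on UNIV" "D holomorphic_on UNIV" "N' holomorphic_on UNIV" "D' holomorphic_on UNIV"
    and nz: "D \<beta> \<noteq> 0" and zeros: "\<And>z. D z = 0 \<longleftrightarrow> D' z = 0"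
    and zo: "\<And>z. zorder D z = zorder D' z"
    and res: "\<And>z \<nu>. D z = 0 \<Longrightarrow> int \<nu> < zorder D z \<Longrightarrow>
      residue (\<lambda>w. (w - z) ^ \<nu> * (N w / D w)) z = residue (\<lambda>w. (w - z) ^ \<nu> * (N' w / D' w)) z"
  shows "\<exists>h. h holomorphic_on UNIV \<and> (\<forall>z. D z \<noteq> 0 \<longrightarrow> h z = N z / D z - N' z / D' z)"
proof -
  define f where "f = (\<lambda>z. N z / D z - N' z / D' z)"
  \<comment> \<open>At the zeros of \<open>D\<close> the expression \<open>f\<close> only has the
    default value of a division by zero; the limit replaces it.\<close>
  define h where "h = (\<lambda>z. if D z \<noteq> 0 then f z else Lim (at z) f)"
  have op: "open {z. D z \<noteq> 0}"
    using hol(2) by (intro open_Collect_neq holomorphic_on_imp_continuous_on) auto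
  have fhol: "f holomorphic_on {z. D z \<noteq> 0}"
    unfolding f_def using zeros by (intro holomorphic_intros holomorphic_on_subset[OF hol(1)] holomorphic_on_subset[OF hol(2)]
        holomorphic_on_subset[OF hol(3)] holomorphic_on_subset[OF hol(4)]) auto
  have loc: "\<exists>U. open U \<and> z \<in> U \<and> h holomorphic_on U" for z
  proof (cases "D z = 0")
    case False
    have "h holomorphic_on {z. D z \<noteq> 0}" by (rule holomorphic_transform[OF fhol]) (auto simp: h_def)
    thus ?thesis using op False by blast
  next
    case True
    hence z': "D' z = 0" using zeros by simp
    define m where "m = nat (zorder D z)"
    have nz': "D' \<beta> \<noteq> 0" using nz zeros by simp
    have "zorder D z > 0" and "\<exists>r. r > 0 \<and> cball z r \<subseteq> UNIV \<and> zor_poly D z holomorphic_on cball z r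
        \<and> (\<forall>w\<in>cball z r. D w = zor_poly D z w * (w - z) ^ m \<and> zor_poly D z w \<noteq> 0)"
      using zorder_exist_zero[OF hol(2) open_UNIV connected_UNIV UNIV_I[of z]] nz True unfolding m_def by auto
    then obtain r g where r: "r > 0" and g: "g holomorphic_on cball z r" "\<And>w. w \<in> cball z r \<Longrightarrow> D w = g w * (w - z) ^ m \<and> g w \<noteq> 0"
      by blast
    have "\<exists>r. r > 0 \<and> cball z r \<subseteq> UNIV \<and> zor_poly D' z holomorphic_on cball z r
        \<and> (\<forall>w\<in>cball z r. D' w = zor_poly D' z w * (w - z) ^ m \<and> zor_poly D' z w \<noteq> 0)"
      using zorder_exist_zero[OF hol(4) open_UNIV connected_UNIV UNIV_I[of z]] nz' z' zo[of z] unfolding m_def by auto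
    then obtain r' g' where r': "r' > 0" and g': "g' holomorphic_on cball z r'" "\<And>w. w \<in> cball z r' \<Longrightarrow> D' w = g' w * (w - z) ^ m \<and> g' w \<noteq> 0"
      by blast
    define R where "R = min r r'"
    have R: "R > 0" "ball z R \<subseteq> cball z r" "ball z R \<subseteq> cball z r'" using r r' by (auto simp: R_def)
    define k where "k = (\<lambda>w. N w / g w - N' w / g' w)"
    have k: "k holomorphic_on ball z R" unfolding k_def
      using g(2) g'(2) R by (intro holomorphic_intros holomorphic_on_subset[OF hol(1)] holomorphic_on_subset[OF hol(3)]
        holomorphic_on_subset[OF g(1)] holomorphic_on_subset[OF g'(1)]) auto
    have fk: "f w = k w / (w - z) ^ m" if "w \<in> ball z R" "w \<noteq> z" for w
    proof -
      have "w \<in> cball z r" "w \<in> cball z r'" using that R by blast+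
      from g(2)[OF this(1)] g'(2)[OF this(2)] that show ?thesis unfolding f_def k_def by (simp add: field_simps)
    qed
    have Dw: "D w \<noteq> 0" if "w \<in> ball z R" "w \<noteq> z" for w
    proof -
      have "w \<in> cball z r" using that R by blast
      from g(2)[OF this] that show ?thesis by simp
    qed
    have Dw': "D' w \<noteq> 0" if "w \<in> ball z R" "w \<noteq> z" for w using Dw[OF that] zeros by simp
    have evb: "\<forall>\<^sub>F w in at z. w \<in> ball z R \<and> w \<noteq> z" using eventually_at_in_open[of "ball z R" z] R(1) by simp
    have "\<exists>k2. k2 holomorphic_on ball z R \<and> (\<forall>w\<in>ball z R. k w = (w - z) ^ m * k2 w)"
    proof (rule divide_power_if_residues_zero[OF k R(1)])
      fix \<nu> assume \<nu>: "\<nu> < m"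
      \<comment> \<open>The weight exponent \<open>j\<close> and the Taylor index
        \<open>\<nu>\<close> run in opposite directions: \<open>j + Suc \<nu> = m\<close>.\<close>
      define j where "j = m - Suc \<nu>"
      have j: "int j < zorder D z" using \<nu> \<open>zorder D z > 0\<close> by (simp add: j_def m_def)
      have mj: "m = j + Suc \<nu>" using \<nu> by (simp add: j_def)
      have "residue (\<lambda>w. k w / (w - z) ^ Suc \<nu>) z = residue (\<lambda>w. (w - z) ^ j * (N w / D w) - (w - z) ^ j * (N' w / D' w)) z"
      proof (rule residue_cong)
        show "\<forall>\<^sub>F w in at z. k w / (w - z) ^ Suc \<nu> = (w - z) ^ j * (N w / D w) - (w - z) ^ j * (N' w / D' w)"
          using evb
        proof eventually_elim
          case (elim w)
          have "(w - z) ^ j * (N w / D w) - (w - z) ^ j * (N' w / D' w) = (w - z) ^ j * f w" by (simp add: f_def right_diff_distrib)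
          also have "f w = k w / ((w - z) ^ j * (w - z) ^ Suc \<nu>)" using fk[of w] elim by (simp add: mj power_add)
          also have "(w - z) ^ j * \<dots> = k w / (w - z) ^ Suc \<nu>" using elim by simp
          finally show ?case by simp
        qed
      qed simp
      also have "\<dots> = residue (\<lambda>w. (w - z) ^ j * (N w / D w)) z - residue (\<lambda>w. (w - z) ^ j * (N' w / D' w)) z"
      proof (rule residue_diff[of "ball z R"])
        show "(\<lambda>w. (w - z) ^ j * (N w / D w)) holomorphic_on ball z R - {z}"
          by (intro holomorphic_intros holomorphic_on_subset[OF hol(1) subset_UNIV] holomorphic_on_subset[OF hol(2) subset_UNIV]) (use Dw in blast)
        show "(\<lambda>w. (w - z) ^ j * (N' w / D' w)) holomorphic_on ball z R - {z}"
          by (intro holomorphic_intros holomorphic_on_subset[OF hol(3) subset_UNIV] holomorphic_on_subset[OF hol(4) subset_UNIV]) (use Dw' in blast)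
      qed (use R(1) in auto)
      also have "\<dots> = 0" using res[OF True j] by simp
      finally show "residue (\<lambda>w. k w / (w - z) ^ Suc \<nu>) z = 0" .
    qed
    then obtain k2 where k2: "k2 holomorphic_on ball z R" "\<And>w. w \<in> ball z R \<Longrightarrow> k w = (w - z) ^ m * k2 w" by blast
    have fk2: "f w = k2 w" if "w \<in> ball z R" "w \<noteq> z" for w using fk[OF that] k2(2)[OF that(1)] that by simp
    have "isCont k2 z"
      using holomorphic_on_imp_continuous_on[OF k2(1)] R(1) by (simp add: continuous_on_eq_continuous_at)
    hence "(k2 \<longlongrightarrow> k2 z) (at z)" by (simp add: isCont_def)
    hence "(f \<longlongrightarrow> k2 z) (at z)"
    proof (rule Lim_transform_eventually)
      show "\<forall>\<^sub>F w in at z. k2 w = f w" using evb by eventually_elim (use fk2 in auto)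
    qed
    hence "Lim (at z) f = k2 z" by (intro tendsto_Lim) auto
    hence "h w = k2 w" if "w \<in> ball z R" for w using that fk2 Dw True by (cases "w = z") (auto simp: h_def)
    hence "h holomorphic_on ball z R" by (intro holomorphic_transform[OF k2(1)]) auto
    thus ?thesis using R(1) by (intro exI[of _ "ball z R"]) auto
  qed
  have "h holomorphic_on UNIV"
    unfolding holomorphic_on_def
  proof
    fix z
    obtain U where "open U" "z \<in> U" "h holomorphic_on U" using loc by blast
    thus "h field_differentiable at z within UNIV"
      using holomorphic_on_imp_differentiable_at by blast
  qed
  thus ?thesis by (intro exI[of _ h]) (auto simp: h_def f_def)
qed

section \<open>Growth of the fundamental solutions and counting of eigenvalues\<close>

context pencil begin

text \<open>Away from the eigenvalues this is the Weyl solution, 1 at \<open>0\<close> and 0 at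
  \<open>pi\<close>. It is written over the common denominator so that the backward bound of
  \<open>SC_bounds\<close> applies to the numerator.\<close>

abbreviation weyl_sol :: "complex \<Rightarrow> real \<Rightarrow> complex" where
  "weyl_sol \<mu> x \<equiv> (C \<mu> x * S \<mu> pi - C \<mu> pi * S \<mu> x) / S \<mu> pi"

lemma growth32_SC:
  assumes x: "x \<in> {0..pi}"
  shows "growth32 (\<lambda>\<mu>. S \<mu> x)" "growth32 (\<lambda>\<mu>. C \<mu> x)"
proof -
  have e: "exp (\<bar>Im \<mu>\<bar> * x + 2 * K0) \<le> exp (pi * cmod \<mu> + 2 * K0)" for \<mu>
    using x mult_mono[OF abs_Im_le_cmod[of \<mu>], of x pi] by (simp add: mult.commute)
  show "growth32 (\<lambda>\<mu>. S \<mu> x)"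
  proof (rule growth32I)
    show "continuous_on UNIV (\<lambda>\<mu>. S \<mu> x)" using SC_holomorphic(1)[OF x] holomorphic_on_imp_continuous_on by blast
    fix \<mu> assume m: "1 \<le> cmod \<mu>"
    have "cmod (S \<mu> x) \<le> exp (\<bar>Im \<mu>\<bar> * x + 2 * K0) / cmod \<mu>" by (rule SC_bounds(1)[OF m x])
    also have "\<dots> \<le> exp (\<bar>Im \<mu>\<bar> * x + 2 * K0) / 1" using m by (intro divide_left_mono) auto
    finally have "cmod (S \<mu> x) \<le> exp (\<bar>Im \<mu>\<bar> * x + 2 * K0)" by simp
    thus "cmod (S \<mu> x) \<le> exp (pi * cmod \<mu> + 2 * K0)" using e order_trans by blast
  qed
  show "growth32 (\<lambda>\<mu>. C \<mu> x)"
  proof (rule growth32I)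
    show "continuous_on UNIV (\<lambda>\<mu>. C \<mu> x)" using SC_holomorphic(2)[OF x] holomorphic_on_imp_continuous_on by blast
    fix \<mu> assume m: "1 \<le> cmod \<mu>"
    show "cmod (C \<mu> x) \<le> exp (pi * cmod \<mu> + 2 * K0)" by (rule order_trans[OF SC_bounds(3)[OF m x] e])
  qed
qed

lemma S_nonzero_eventually:
  assumes "cmod \<omega> = 1" "Im \<omega> \<noteq> 0" "0 < x" "x \<le> pi"
  shows "\<forall>\<^sub>F r in at_top. S (of_real r * \<omega>) x \<noteq> 0"
proof -
  obtain c where c: "c > 0" "\<forall>\<^sub>F r in at_top. c * exp (r * \<bar>Im \<omega>\<bar> * x) / r \<le> cmod (S (of_real r * \<omega>) x)"
    using S_lower_bound[OF assms] by blast
  show ?thesis using c(2) eventually_gt_at_top[of 0]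
  proof eventually_elim
    case (elim r)
    have "c * exp (r * \<bar>Im \<omega>\<bar> * x) / r > 0" using c(1) elim by simp
    thus ?case using elim by auto
  qed
qed

text \<open>Square summability of the remainders bounds the distance of \<open>lam n\<close> from
  \<open>n + mean_omega0 q1\<close> uniformly in \<open>n\<close>, which makes the count in a disc
  linear. The first claim also covers points that are not eigenvalues, where both sides are
  0.\<close>

lemma zeros_count:
  assumes ev: "eigenvalue_sequence \<sigma> q1 lam"
  shows "zorder (\<lambda>\<mu>. S \<mu> pi) z = int (card {n \<in> Z0. lam n = z})"
    "\<exists>a. \<forall>R\<ge>1. finite {n \<in> Z0. cmod (lam n) \<le> R} \<and> real (card {n \<in> Z0. cmod (lam n) \<le> R}) \<le> a * R"
proof -
  have zer: "lam ` Z0 = {\<mu>. S \<mu> pi = 0}" and mult: "\<And>n. n \<in> Z0 \<Longrightarrow> int (index_mult lam n) = zorder (\<lambda>\<mu>. S \<mu> pi) (lam n)"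
    and su: "(\<lambda>n. (cmod (lam n - of_int n - mean_omega0 q1))\<^sup>2) summable_on Z0"
    using ev unfolding eigenvalue_sequence_def char_fun_eq by auto
  show "zorder (\<lambda>\<mu>. S \<mu> pi) z = int (card {n \<in> Z0. lam n = z})"
  proof (cases "S z pi = 0")
    case True
    hence "z \<in> lam ` Z0" unfolding zer by simp
    then obtain n where "n \<in> Z0" "lam n = z" by auto
    thus ?thesis using mult[of n] by (simp add: index_mult_def)
  next
    case False
    have "(\<lambda>\<mu>. S \<mu> pi) analytic_on {z}" 
      unfolding analytic_on_holomorphic using SC_holomorphic(1)[of pi] by (intro exI[of _ UNIV]) auto
    hence "zorder (\<lambda>\<mu>. S \<mu> pi) z = 0" using False by (rule zorder_eq_0I)
    moreover have "z \<notin> lam ` Z0" unfolding zer using False by simp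
    hence "{n \<in> Z0. lam n = z} = {}" by auto
    ultimately show ?thesis by (simp only: card.empty of_nat_0)
  qed
  define T where "T = infsum (\<lambda>n. (cmod (lam n - of_int n - mean_omega0 q1))\<^sup>2) Z0"
  define c where "c = cmod (mean_omega0 q1) + sqrt T"
  have low: "\<bar>real_of_int n\<bar> \<le> cmod (lam n) + c" if n: "n \<in> Z0" for n
  proof -
    have "(cmod (lam n - of_int n - mean_omega0 q1))\<^sup>2 = infsum (\<lambda>n. (cmod (lam n - of_int n - mean_omega0 q1))\<^sup>2) {n}" by simp
    also have "\<dots> \<le> T" unfolding T_def using n by (intro infsum_mono2 su) auto
    finally have "cmod (lam n - of_int n - mean_omega0 q1) \<le> sqrt T" by (simp add: real_le_rsqrt)
    moreover have "cmod (of_int n) \<le> cmod (lam n) + cmod (mean_omega0 q1) + cmod (lam n - of_int n - mean_omega0 q1)"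
      using norm_triangle_ineq4[of "lam n - mean_omega0 q1" "lam n - of_int n - mean_omega0 q1"] norm_triangle_ineq4[of "lam n" "mean_omega0 q1"] by simp
    ultimately show ?thesis by (simp add: c_def)
  qed
  have c0: "c \<ge> 0"
  proof -
    have "T \<ge> 0" unfolding T_def by (rule infsum_nonneg) auto
    thus ?thesis by (simp add: c_def)
  qed
  have "finite {n \<in> Z0. cmod (lam n) \<le> R} \<and> real (card {n \<in> Z0. cmod (lam n) \<le> R}) \<le> (2 * c + 3) * R" if R: "R \<ge> 1" for R
  proof -
    define b where "b = \<lfloor>R + c\<rfloor>"
    have sub: "{n \<in> Z0. cmod (lam n) \<le> R} \<subseteq> {-b..b}"
    proof
      fix n assume "n \<in> {n \<in> Z0. cmod (lam n) \<le> R}"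
      hence "\<bar>real_of_int n\<bar> \<le> R + c" using low[of n] by auto
      hence "\<bar>n\<bar> \<le> b" by (simp add: b_def le_floor_iff)
      thus "n \<in> {-b..b}" by auto
    qed
    have b0: "b \<ge> 0" using R c0 by (simp add: b_def)
    have "card {n \<in> Z0. cmod (lam n) \<le> R} \<le> card {-b..b}" by (rule card_mono[OF _ sub]) simp
    also have "card {-b..b} = nat (2 * b + 1)" by simp
    finally have "real (card {n \<in> Z0. cmod (lam n) \<le> R}) \<le> 2 * real_of_int b + 1" using b0 by linarith
    also have "\<dots> \<le> 2 * (R + c) + 1" unfolding b_def by (intro add_mono mult_left_mono of_int_floor_le) auto
    also have "\<dots> \<le> (2 * c + 3) * R" using R c0 mult_left_mono[OF R c0] by (simp add: algebra_simps)
    finally show ?thesis using finite_subset[OF sub] by auto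
  qed
  thus "\<exists>a. \<forall>R\<ge>1. finite {n \<in> Z0. cmod (lam n) \<le> R} \<and> real (card {n \<in> Z0. cmod (lam n) \<le> R}) \<le> a * R" by blast
qed

end

section \<open>Comparison of two problems with the same spectral data\<close>

locale two_pencils = A: pencil \<sigma> q1 + B: pencil \<sigma>' q1'
  for \<sigma> q1 \<sigma>' q1' :: "real \<Rightarrow> complex"
begin

text \<open>With \<open>t = r * \<bar>Im \<omega>\<bar>\<close>, \<open>S\<close> at
  \<open>x\<close> costs \<open>exp (t * x)\<close>, the numerator of the Weyl solution costs
  \<open>exp (t * (pi - x))\<close>, and its denominator pays back \<open>exp (t * pi)\<close>. The
  exponentials cancel; as each of the three bounds carries a factor \<open>1 / r\<close>, the
  product is of order \<open>1 / r\<close>. The potentials of the two factors do not matter for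
  these rates.\<close>

lemma product_decays:
  assumes \<omega>: "cmod \<omega> = 1" "Im \<omega> \<noteq> 0" and x: "x \<in> {0..pi}"
  shows "((\<lambda>r. A.S (of_real r * \<omega>) x * B.weyl_sol (of_real r * \<omega>) x) \<longlongrightarrow> 0) at_top"
proof -
  obtain c where c: "c > 0" "\<forall>\<^sub>F r in at_top. c * exp (r * \<bar>Im \<omega>\<bar> * pi) / r \<le> cmod (B.S (of_real r * \<omega>) pi)"
    using B.S_lower_bound[OF \<omega>, of pi] by auto
  define K where "K = exp (2 * A.K0 + 2 * B.K0) / c"
  have lim: "((\<lambda>r. K / r) \<longlongrightarrow> 0) at_top" by real_asymp
  show ?thesis
  proof (rule Lim_null_comparison[OF _ lim])
    show "\<forall>\<^sub>F r in at_top. norm (A.S (of_real r * \<omega>) x * B.weyl_sol (of_real r * \<omega>) x) \<le> K / r"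
      using c(2) eventually_ge_at_top[of 1]
    proof eventually_elim
      case (elim r)
      define \<mu> where "\<mu> = of_real r * \<omega>"
      define t where "t = r * \<bar>Im \<omega>\<bar>"
      have \<mu>: "cmod \<mu> = r" "\<bar>Im \<mu>\<bar> = t" "1 \<le> cmod \<mu>" using elim \<omega> by (auto simp: \<mu>_def t_def norm_mult abs_mult)
      have 1: "cmod (A.S \<mu> x) \<le> exp (t * x + 2 * A.K0) / r" using A.SC_bounds(1)[OF \<mu>(3) x] \<mu> by simp
      have 2: "cmod (B.C \<mu> x * B.S \<mu> pi - B.C \<mu> pi * B.S \<mu> x) \<le> exp (t * (pi - x) + 2 * B.K0) / r"
        using B.SC_bounds(4)[OF \<mu>(3) x] \<mu> by simp
      have 3: "c * exp (t * pi) / r \<le> cmod (B.S \<mu> pi)" using elim(1) by (simp add: t_def \<mu>_def)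
      have r0: "r > 0" using elim by simp
      have "norm (A.S \<mu> x * B.weyl_sol \<mu> x) =
        cmod (A.S \<mu> x) * (cmod (B.C \<mu> x * B.S \<mu> pi - B.C \<mu> pi * B.S \<mu> x) / cmod (B.S \<mu> pi))"
        by (simp add: norm_mult norm_divide)
      also have "\<dots> \<le> exp (t * x + 2 * A.K0) / r * ((exp (t * (pi - x) + 2 * B.K0) / r) / (c * exp (t * pi) / r))"
        using c(1) r0 by (intro mult_mono frac_le 1 2 3) auto
      also have "\<dots> = (exp (t * x + 2 * A.K0) * exp (t * (pi - x) + 2 * B.K0)) / (c * exp (t * pi)) / r"
        using c(1) r0 by (simp add: field_simps)
      also have "exp (t * x + 2 * A.K0) * exp (t * (pi - x) + 2 * B.K0) = exp (2 * A.K0 + 2 * B.K0) * exp (t * pi)"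
        by (simp add: exp_add[symmetric] algebra_simps)
      also have "exp (2 * A.K0 + 2 * B.K0) * exp (t * pi) / (c * exp (t * pi)) / r = K / r"
        by (simp add: K_def)
      finally show ?case by (simp add: \<mu>_def)
    qed
  qed
qed

end

text \<open>Here \<open>h\<close> is the Weyl function of the second problem minus that of the
  first, so the \<open>h\<close> term completes both \<open>C\<close> to Weyl solutions. The decay
  is then used with the two problems in either order.\<close>

lemma (in two_pencils) mapping_function_zero:
  assumes h: "h holomorphic_on UNIV" and gh: "growth32 h"
    and hM: "\<And>\<mu>. A.S \<mu> pi \<noteq> 0 \<Longrightarrow> B.S \<mu> pi \<noteq> 0 \<Longrightarrow> h \<mu> = A.C \<mu> pi / A.S \<mu> pi - B.C \<mu> pi / B.S \<mu> pi"
    and x: "x \<in> {0..pi}"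
  shows "A.S \<mu> x * B.C \<mu> x - A.C \<mu> x * B.S \<mu> x + h \<mu> * A.S \<mu> x * B.S \<mu> x = 0"
proof (rule entire_eq_zero_if_decaying_on_diagonals[of "\<lambda>\<mu>. A.S \<mu> x * B.C \<mu> x - A.C \<mu> x * B.S \<mu> x + h \<mu> * A.S \<mu> x * B.S \<mu> x"])
  show "(\<lambda>\<mu>. A.S \<mu> x * B.C \<mu> x - A.C \<mu> x * B.S \<mu> x + h \<mu> * A.S \<mu> x * B.S \<mu> x) holomorphic_on UNIV"
    by (intro holomorphic_intros h A.SC_holomorphic B.SC_holomorphic x)
  have "growth32 (\<lambda>\<mu>. A.S \<mu> x * B.C \<mu> x + - (A.C \<mu> x * B.S \<mu> x) + h \<mu> * A.S \<mu> x * B.S \<mu> x)"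
    by (intro growth32_add growth32_mult growth32_uminus gh A.growth32_SC B.growth32_SC x)
  thus "growth32 (\<lambda>\<mu>. A.S \<mu> x * B.C \<mu> x - A.C \<mu> x * B.S \<mu> x + h \<mu> * A.S \<mu> x * B.S \<mu> x)" by simp
  fix \<omega> :: complex assume \<omega>: "cmod \<omega> = 1" "\<bar>Re \<omega>\<bar> = \<bar>Im \<omega>\<bar>"
  have Im: "Im \<omega> \<noteq> 0"
  proof
    assume "Im \<omega> = 0"
    hence "\<omega> = 0" using \<omega>(2) by (simp add: complex_eq_iff)
    thus False using \<omega>(1) by simp
  qed
  let ?D = "\<lambda>r. A.S (of_real r * \<omega>) x * B.weyl_sol (of_real r * \<omega>) x - B.S (of_real r * \<omega>) x * A.weyl_sol (of_real r * \<omega>) x"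
  interpret BA: two_pencils \<sigma>' q1' \<sigma> q1 ..
  have "((\<lambda>r. ?D r) \<longlongrightarrow> 0 - 0) at_top"
    by (intro tendsto_diff product_decays BA.product_decays \<omega> Im x)
  hence "((\<lambda>r. ?D r) \<longlongrightarrow> 0) at_top" by simp
  thus "((\<lambda>r. A.S (of_real r * \<omega>) x * B.C (of_real r * \<omega>) x - A.C (of_real r * \<omega>) x * B.S (of_real r * \<omega>) x + h (of_real r * \<omega>) * A.S (of_real r * \<omega>) x * B.S (of_real r * \<omega>) x) \<longlongrightarrow> 0) at_top"
  proof (rule Lim_transform_eventually)
    have pp: "0 < pi" "pi \<le> pi" by auto
    show "\<forall>\<^sub>F r in at_top. ?D r =
     A.S (of_real r * \<omega>) x * B.C (of_real r * \<omega>) x - A.C (of_real r * \<omega>) x * B.S (of_real r * \<omega>) x + h (of_real r * \<omega>) * A.S (of_real r * \<omega>) x * B.S (of_real r * \<omega>) x"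
      using A.S_nonzero_eventually[OF \<omega>(1) Im pp] B.S_nonzero_eventually[OF \<omega>(1) Im pp]
      by eventually_elim (simp add: hM field_simps)
  qed
qed

lemma continuous_AE_zero_imp_zero:
  fixes f :: "'a::euclidean_space \<Rightarrow> 'b::real_normed_vector"
  assumes "open U" "continuous_on U f" "negligible {x \<in> U. f x \<noteq> 0}" "x \<in> U"
  shows "f x = 0"
proof -
  have "open (- {0::'b})" by (simp add: open_Compl)
  from continuous_open_preimage[OF assms(2,1) this]
  have "open {x \<in> U. f x \<noteq> 0}" by (simp add: vimage_def Int_def)
  thus ?thesis using assms(3,4) open_not_negligible by blast
qed

text \<open>The weights are compared at nonzero indices only. If the block of an eigenvalue reached
  0 after \<nu> steps, it would start at \<open>- \<nu>\<close>, and by \<open>assumption_O\<close>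
  all its indices would lie in \<open>{n..-1}\<close>, which has just \<nu> elements.\<close>

lemma first_index_shift_in_Z0:
  assumes O: "assumption_O lam" and n: "n \<in> first_indices lam" and \<nu>: "\<nu> < index_mult lam n"
  shows "n + int \<nu> \<in> Z0"
proof (rule ccontr)
  assume "n + int \<nu> \<notin> Z0"
  hence e: "n = - int \<nu>" by (simp add: Z0_def)
  have nZ: "n \<in> Z0" using n by (simp add: first_indices_def)
  hence n0: "n < 0" using e by (auto simp: Z0_def)
  have sub: "{k \<in> Z0. lam k = lam n} \<subseteq> {n..-1}"
  proof
    fix k assume k: "k \<in> {k \<in> Z0. lam k = lam n}"
    hence "\<not> n * k < 0" using O nZ unfolding assumption_O_def by (metis (mono_tags, lifting) mem_Collect_eq)
    hence "k \<le> 0" using n0 by (simp add: mult_less_0_iff)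
    hence "k \<le> -1" using k by (auto simp: Z0_def)
    moreover have "\<not> k < n" using n k by (auto simp: first_indices_def)
    ultimately show "k \<in> {n..-1}" by auto
  qed
  have "index_mult lam n \<le> card {n..-1}" unfolding index_mult_def by (rule card_mono[OF _ sub]) simp
  also have "\<dots> = \<nu>" using e by simp
  finally show False using \<nu> by simp
qed

context pencil begin

text \<open>A residue depends only on a punctured neighbourhood, so the unspecified values of the
  Weyl function at eigenvalues do no harm; the zeros of the characteristic function are isolated
  because it does not vanish identically.\<close>

lemma residue_Weyl_fun:
  assumes "S \<beta> pi \<noteq> 0"
  shows "residue (\<lambda>\<mu>. (\<mu> - z) ^ \<nu> * Weyl_fun \<sigma> q1 \<mu>) z = residue (\<lambda>\<mu>. (\<mu> - z) ^ \<nu> * (- C \<mu> pi / S \<mu> pi)) z"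
proof (rule residue_cong)
  have "(\<lambda>\<mu>. S \<mu> pi) holomorphic_on UNIV" by (rule SC_holomorphic) simp
  from non_zero_neighbour_alt[OF this open_UNIV connected_UNIV UNIV_I UNIV_I assms, of z]
  show "\<forall>\<^sub>F \<mu> in at z. (\<mu> - z) ^ \<nu> * Weyl_fun \<sigma> q1 \<mu> = (\<mu> - z) ^ \<nu> * (- C \<mu> pi / S \<mu> pi)"
    by eventually_elim (simp add: Weyl_fun_eq)
qed simp

lemma ex_nonzero_char_fun: "\<exists>\<beta>. S \<beta> pi \<noteq> 0"
  using eventually_happens'[OF trivial_limit_at_top_linorder S_nonzero_eventually[of \<i> pi]] by auto

end

context two_pencils begin

text \<open>The product of \<open>h\<close> with both characteristic functions is a combination of
  fundamental solutions at \<open>pi\<close>, whose growth is known. Removing the two factors one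
  after the other by \<open>growth32_quotient\<close> leaves the growth of \<open>h\<close>.\<close>

lemma Weyl_difference_entire:
  assumes ev: "eigenvalue_sequence \<sigma> q1 lam" "eigenvalue_sequence \<sigma>' q1' lam'"
    and O: "assumption_O lam"
    and w: "weight_sequence \<sigma> q1 lam M" "weight_sequence \<sigma>' q1' lam' M'"
    and lam: "\<And>n. n \<in> Z0 \<Longrightarrow> lam n = lam' n" and M: "\<And>n. n \<in> Z0 \<Longrightarrow> M n = M' n"
  obtains h where "h holomorphic_on UNIV" "growth32 h"
    "\<And>\<mu>. A.S \<mu> pi \<noteq> 0 \<Longrightarrow> B.S \<mu> pi \<noteq> 0 \<Longrightarrow> h \<mu> = A.C \<mu> pi / A.S \<mu> pi - B.C \<mu> pi / B.S \<mu> pi"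
proof -
  have pp: "pi \<in> {0..pi}" by simp
  have im: "lam ` Z0 = lam' ` Z0" using lam by (intro image_cong) auto
  have zA: "lam ` Z0 = {\<mu>. A.S \<mu> pi = 0}" and zB: "lam' ` Z0 = {\<mu>. B.S \<mu> pi = 0}"
    using ev unfolding eigenvalue_sequence_def A.char_fun_eq B.char_fun_eq by auto
  have zeros: "A.S z pi = 0 \<longleftrightarrow> B.S z pi = 0" for z
  proof -
    have "{\<mu>. A.S \<mu> pi = 0} = {\<mu>. B.S \<mu> pi = 0}" using zA zB im by simp
    thus ?thesis by blast
  qed
  have cards: "{n \<in> Z0. lam n = z} = {n \<in> Z0. lam' n = z}" for z using lam by auto
  have zo: "zorder (\<lambda>\<mu>. A.S \<mu> pi) z = zorder (\<lambda>\<mu>. B.S \<mu> pi) z" for z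
    unfolding A.zeros_count(1)[OF ev(1)] B.zeros_count(1)[OF ev(2)] cards ..
  obtain \<beta> where \<beta>: "A.S \<beta> pi \<noteq> 0" using A.ex_nonzero_char_fun by blast
  hence \<beta>': "B.S \<beta> pi \<noteq> 0" using zeros by simp
  have res: "residue (\<lambda>\<mu>. (\<mu> - z) ^ \<nu> * (- A.C \<mu> pi / A.S \<mu> pi)) z = residue (\<lambda>\<mu>. (\<mu> - z) ^ \<nu> * (- B.C \<mu> pi / B.S \<mu> pi)) z"
    if z: "A.S z pi = 0" and \<nu>: "int \<nu> < zorder (\<lambda>\<mu>. A.S \<mu> pi) z" for z \<nu>
  proof -
    define N where "N = {k \<in> Z0. lam k = z}"
    have fin: "finite {k \<in> Z0. lam k = lam k'}" if "k' \<in> Z0" for k' using ev(1) that unfolding eigenvalue_sequence_def by blast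
    have "z \<in> lam ` Z0" unfolding zA using z by simp
    then obtain k0 where k0: "k0 \<in> Z0" "lam k0 = z" by auto
    have N: "finite N" "N \<noteq> {}" using fin[OF k0(1)] k0 by (auto simp: N_def)
    \<comment> \<open>The least index of the eigenvalue is the one from which the weights of all
      orders are enumerated.\<close>
    define n where "n = Min N"
    have nN: "n \<in> N" using Min_in[OF N] by (simp add: n_def)
    hence nZ: "n \<in> Z0" "lam n = z" by (auto simp: N_def)
    have nf: "n \<in> first_indices lam" unfolding first_indices_def
    proof (intro CollectI conjI ballI impI nZ)
      fix k assume k: "k \<in> Z0" "k < n"
      show "lam k \<noteq> lam n"
      proof
        assume "lam k = lam n"
        hence "k \<in> N" using k nZ by (simp add: N_def)
        hence "n \<le> k" using Min_le[OF N(1)] by (simp add: n_def)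
        thus False using k by simp
      qed
    qed
    have nf': "n \<in> first_indices lam'" using nf lam unfolding first_indices_def by auto
    have "index_mult lam n = card {k \<in> Z0. lam k = z}" by (simp add: index_mult_def nZ)
    hence \<nu>1: "\<nu> < index_mult lam n" using \<nu> A.zeros_count(1)[OF ev(1), of z] by simp
    have ln: "lam' n = z" using lam[OF nZ(1)] nZ by simp
    have \<nu>2: "\<nu> < index_mult lam' n" using \<nu>1 cards[of z] by (simp add: index_mult_def nZ ln)
    have "M (n + int \<nu>) = residue (\<lambda>\<mu>. (\<mu> - z) ^ \<nu> * Weyl_fun \<sigma> q1 \<mu>) z"
      using w(1) nf \<nu>1 nZ(2) unfolding weight_sequence_def by blast
    moreover have "M' (n + int \<nu>) = residue (\<lambda>\<mu>. (\<mu> - z) ^ \<nu> * Weyl_fun \<sigma>' q1' \<mu>) z"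
      using w(2) nf' \<nu>2 ln unfolding weight_sequence_def by blast
    moreover have "M (n + int \<nu>) = M' (n + int \<nu>)" by (rule M[OF first_index_shift_in_Z0[OF O nf \<nu>1]])
    ultimately show ?thesis using A.residue_Weyl_fun[OF \<beta>] B.residue_Weyl_fun[OF \<beta>'] by simp
  qed
  have "\<exists>h. h holomorphic_on UNIV \<and> (\<forall>z. A.S z pi \<noteq> 0 \<longrightarrow> h z = - A.C z pi / A.S z pi - - B.C z pi / B.S z pi)"
    by (rule holomorphic_difference_if_principal_parts_agree[where \<beta>=\<beta>])
       (use \<beta> zeros zo res in \<open>auto intro!: holomorphic_intros A.SC_holomorphic B.SC_holomorphic\<close>)
  then obtain h0 where h0: "h0 holomorphic_on UNIV" "\<And>z. A.S z pi \<noteq> 0 \<Longrightarrow> h0 z = - A.C z pi / A.S z pi - - B.C z pi / B.S z pi"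
    by blast
  \<comment> \<open>The Weyl functions are \<open>- C pi / S pi\<close>, whereas \<open>h\<close> is
    stated without the minus sign.\<close>
  define h where "h = (\<lambda>z. - h0 z)"
  have h: "h holomorphic_on UNIV" unfolding h_def by (intro holomorphic_intros h0)
  have hM: "h z = A.C z pi / A.S z pi - B.C z pi / B.S z pi" if "A.S z pi \<noteq> 0" for z using h0(2)[OF that] by (simp add: h_def)
  \<comment> \<open>At the common eigenvalues both sides are 0 whatever the value of
    \<open>h\<close>, so the identity holds in the whole plane.\<close>
  have prod: "h z * A.S z pi * B.S z pi = A.C z pi * B.S z pi + - (B.C z pi * A.S z pi)" for z
  proof (cases "A.S z pi = 0")
    case True
    thus ?thesis using zeros[of z] by simp
  next
    case False
    thus ?thesis using hM[OF False] zeros[of z] by (simp add: field_simps)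
  qed
  have "growth32 (\<lambda>z. h z * A.S z pi * B.S z pi)" unfolding prod
    by (intro growth32_add growth32_mult growth32_uminus A.growth32_SC B.growth32_SC pp)
  moreover obtain a' where "\<forall>R\<ge>1. finite {n \<in> Z0. cmod (lam' n) \<le> R} \<and> real (card {n \<in> Z0. cmod (lam' n) \<le> R}) \<le> a' * R"
    using B.zeros_count(2)[OF ev(2)] by blast
  ultimately have "growth32 (\<lambda>z. h z * A.S z pi)"
    by (intro growth32_quotient[of "\<lambda>z. h z * A.S z pi" "\<lambda>z. B.S z pi" \<beta> Z0 lam' a'])
       (auto intro!: holomorphic_intros h A.SC_holomorphic B.SC_holomorphic B.growth32_SC \<beta>' B.zeros_count(1)[OF ev(2)])
  moreover obtain a where "\<forall>R\<ge>1. finite {n \<in> Z0. cmod (lam n) \<le> R} \<and> real (card {n \<in> Z0. cmod (lam n) \<le> R}) \<le> a * R"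
    using A.zeros_count(2)[OF ev(1)] by blast
  ultimately have "growth32 h"
    by (intro growth32_quotient[of h "\<lambda>z. A.S z pi" \<beta> Z0 lam a])
       (auto intro!: h A.SC_holomorphic A.growth32_SC \<beta> A.zeros_count(1)[OF ev(1)])
  thus ?thesis using that h hM by blast
qed

text \<open>The identity and its derivative in \<open>x\<close> are two linear equations for
  \<open>h\<close>. Eliminating \<open>h\<close> and inserting the two Wronskians leaves the
  difference of the squares, and all terms with \<sigma> and \<open>\<sigma>'\<close> cancel. The
  derivative is available only almost everywhere; continuity supplies the remaining points.\<close>

lemma S_squares_eq:
  assumes F: "\<And>x. x \<in> {0..pi} \<Longrightarrow> A.S \<mu> x * B.C \<mu> x - A.C \<mu> x * B.S \<mu> x + h * A.S \<mu> x * B.S \<mu> x = 0"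
    and x: "x \<in> {0..pi}"
  shows "(A.S \<mu> x)\<^sup>2 = (B.S \<mu> x)\<^sup>2"
proof -
  define s c t d where "s = A.S \<mu>" and "c = A.C \<mu>" and "t = B.S \<mu>" and "d = B.C \<mu>"
  have dA: "ac_deriv s (rhs0 \<sigma> s (A.S1 \<mu>))" "ac_deriv c (rhs0 \<sigma> c (A.C1 \<mu>))"
    and dB: "ac_deriv t (rhs0 \<sigma>' t (B.S1 \<mu>))" "ac_deriv d (rhs0 \<sigma>' d (B.C1 \<mu>))"
    using A.S_solution[of \<mu>] A.C_solution[of \<mu>] B.S_solution[of \<mu>] B.C_solution[of \<mu>]
    by (auto simp: is_solution_iff s_def c_def t_def d_def)
  let ?E = "\<lambda>x. s x * (\<sigma>' x * d x + B.C1 \<mu> x) + (\<sigma> x * s x + A.S1 \<mu> x) * d x -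
     (c x * (\<sigma>' x * t x + B.S1 \<mu> x) + (\<sigma> x * c x + A.C1 \<mu> x) * t x) +
     h * (s x * (\<sigma>' x * t x + B.S1 \<mu> x) + (\<sigma> x * s x + A.S1 \<mu> x) * t x)"
  note D = ac_deriv_add[OF ac_deriv_diff[OF ac_deriv_mult[OF dA(1) dB(2)] ac_deriv_mult[OF dA(2) dB(1)]]
    ac_deriv_cmult[OF ac_deriv_mult[OF dA(1) dB(1)], of h]]
  have "ac_deriv (\<lambda>x. s x * d x - c x * t x + h * (s x * t x)) (\<lambda>x. 0)"
    by (rule ac_deriv_cong[OF ac_deriv_const[of 0]]) (use F in \<open>auto simp: s_def c_def t_def d_def mult.assoc\<close>)
  from ac_deriv_unique_AE[OF D this]
  have "AE x in lebesgue_on {0<..<pi}. ?E x = 0" .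
  hence ae: "negligible {x \<in> {0<..<pi}. \<not> (?E x = 0)}"
    by (simp add: AE_lebesgue_on_iff_negligible)
  have cont: "continuous_on {0..pi} s" "continuous_on {0..pi} t"
    using ac_deriv_continuous_on dA(1) dB(1) by auto
  have sub: "{x \<in> {0<..<pi}. (s x)\<^sup>2 - (t x)\<^sup>2 \<noteq> 0} \<subseteq> {x \<in> {0<..<pi}. \<not> (?E x = 0)}"
  proof (rule Collect_mono, intro impI conjI; elim conjE)
    fix x assume x: "x \<in> {0<..<pi}" and ne: "(s x)\<^sup>2 - (t x)\<^sup>2 \<noteq> 0"
    show "x \<in> {0<..<pi}" by fact
    have x': "x \<in> {0..pi}" using x by auto
    define s1 c1 t1 d1 where "s1 = A.S1 \<mu> x" and "c1 = A.C1 \<mu> x" and "t1 = B.S1 \<mu> x" and "d1 = B.C1 \<mu> x"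
    have wA: "c x * s1 - c1 * s x = 1" and wB: "d x * t1 - d1 * t x = 1"
      using A.SC_wronskian[OF x', of \<mu>] B.SC_wronskian[OF x', of \<mu>] by (simp_all add: s_def c_def t_def d_def s1_def c1_def t1_def d1_def)
    have hF: "h * (s x * t x) = c x * t x - s x * d x" using F[OF x'] by (simp add: s_def c_def t_def d_def algebra_simps)
    show "\<not> (?E x = 0)"
    proof
      assume e: "?E x = 0"
      \<comment> \<open>The right-hand side is \<open>s x * t x\<close> times \<open>?E x\<close>
        after \<open>h * (s x * t x)\<close> has been replaced by means of \<open>F\<close>.
        Multiplying instead of dividing covers the zeros of \<open>s\<close> and
        \<open>t\<close>.\<close>
      have "(t x)\<^sup>2 * (c x * s1 - c1 * s x) - (s x)\<^sup>2 * (d x * t1 - d1 * t x) = 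
        (s x * t x) * (s x * (\<sigma>' x * d x + d1) + (\<sigma> x * s x + s1) * d x - (c x * (\<sigma>' x * t x + t1) + (\<sigma> x * c x + c1) * t x))
        + (c x * t x - s x * d x) * (s x * (\<sigma>' x * t x + t1) + (\<sigma> x * s x + s1) * t x)"
        by (simp add: power2_eq_square algebra_simps)
      also have "\<dots> = (s x * t x) * (s x * (\<sigma>' x * d x + d1) + (\<sigma> x * s x + s1) * d x - (c x * (\<sigma>' x * t x + t1) + (\<sigma> x * c x + c1) * t x)
        + h * (s x * (\<sigma>' x * t x + t1) + (\<sigma> x * s x + s1) * t x))"
        unfolding hF[symmetric] by (simp add: algebra_simps)
      also have "\<dots> = 0" using e by (simp only: s1_def c1_def t1_def d1_def mult_zero_right)
      finally show False using ne wA wB by simp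
    qed
  qed
  have "continuous_on {0<..<pi} (\<lambda>x. (s x)\<^sup>2 - (t x)\<^sup>2)"
    by (intro continuous_intros continuous_on_subset[OF cont(1)] continuous_on_subset[OF cont(2)]) auto
  from continuous_AE_zero_imp_zero[OF open_greaterThanLessThan this negligible_subset[OF ae sub]]
  have zero: "(s x)\<^sup>2 - (t x)\<^sup>2 = 0" if "x \<in> {0<..<pi}" for x using that by blast
  have "(s x)\<^sup>2 - (t x)\<^sup>2 = 0" if "x \<in> closure {0<..<pi}" for x
    by (rule continuous_constant_on_closure[of "{0<..<pi}" "\<lambda>x. (s x)\<^sup>2 - (t x)\<^sup>2"])
       (use that zero cont in \<open>auto intro!: continuous_intros\<close>)
  thus ?thesis using x by (simp add: s_def t_def)
qed

end

section \<open>Recovering the potentials\<close>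

lemma negligible_if_locally_negligible:
  fixes S :: "'a::euclidean_space set"
  assumes "\<And>x. x \<in> S \<Longrightarrow> \<exists>U. open U \<and> x \<in> U \<and> negligible (S \<inter> U)"
  shows "negligible S"
  unfolding locally_negligible_alt[of S]
proof
  fix x assume "x \<in> S"
  then obtain U where "open U" "x \<in> U" "negligible (S \<inter> U)" using assms by blast
  thus "\<exists>U. openin (top_of_set S) U \<and> x \<in> U \<and> negligible U"
    using \<open>x \<in> S\<close> by (intro exI[of _ "S \<inter> U"]) (auto intro: openin_open_Int)
qed

lemma abs_continuous_on_quotient:
  assumes W: "abs_continuous_on_Icc a b W" and P: "abs_continuous_on_Icc a b P" and nz: "\<And>x. x \<in> {a..b} \<Longrightarrow> P x \<noteq> 0"
  shows "abs_continuous_on_Icc a b (\<lambda>x. W x / P x)"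
proof -
  have cP: "continuous_on {a..b} P" and cW: "continuous_on {a..b} W"
    using W P abs_continuous_on_imp_continuous_on by auto
  have "bounded ((\<lambda>x. inverse (P x)) ` {a..b})" using nz by (intro compact_imp_bounded compact_continuous_image continuous_on_inverse cP) auto
  then obtain K where K: "\<And>x. x \<in> {a..b} \<Longrightarrow> cmod (inverse (P x)) \<le> K" unfolding bounded_iff by blast
  have "bounded (W ` {a..b})" by (intro compact_imp_bounded compact_continuous_image cW) auto
  then obtain L where L: "\<And>x. x \<in> {a..b} \<Longrightarrow> cmod (W x) \<le> L" unfolding bounded_iff by blast
  define K' where "K' = \<bar>K\<bar> + 1"
  define L' where "L' = \<bar>L\<bar> + 1"
  have K': "cmod (inverse (P x)) \<le> K'" and L': "cmod (W x) \<le> L'" if "x \<in> {a..b}" for x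
    using K[OF that] L[OF that] by (auto simp: K'_def L'_def)
  have pos: "K' \<ge> 1" "L' \<ge> 1" by (auto simp: K'_def L'_def)
  show ?thesis
  proof (rule abs_continuous_on_dominated[OF W P, of _ "K' + L' * (K' * K')"])
    fix s t assume st: "a \<le> s" "s < t" "t \<le> b"
    have in_ab: "s \<in> {a..b}" "t \<in> {a..b}" using st by auto
    have "W t / P t - W s / P s = inverse (P t) * (W t - W s) + (W s * (inverse (P s) * inverse (P t))) * (P s - P t)"
      using nz[OF in_ab(1)] nz[OF in_ab(2)] by (simp add: field_simps)
    also have "cmod \<dots> \<le> cmod (inverse (P t)) * cmod (W t - W s) + (cmod (W s) * (cmod (inverse (P s)) * cmod (inverse (P t)))) * cmod (P t - P s)"
      by (rule order_trans[OF norm_triangle_ineq]) (simp only: norm_mult norm_minus_commute[of "P s"] order_refl)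
    also have "\<dots> \<le> K' * cmod (W t - W s) + (L' * (K' * K')) * cmod (P t - P s)"
      using pos by (intro add_mono mult_right_mono mult_mono K' L' in_ab) auto
    also have "\<dots> \<le> (K' + L' * (K' * K')) * cmod (W t - W s) + (K' + L' * (K' * K')) * cmod (P t - P s)"
      using pos by (intro add_mono mult_right_mono) auto
    finally show "cmod (W t / P t - W s / P s) \<le> (K' + L' * (K' * K')) * (cmod (W t - W s) + cmod (P t - P s))"
      by (simp add: distrib_left)
  qed
qed

lemma has_vector_derivative_quotient:
  fixes W P :: "real \<Rightarrow> complex"
  assumes W: "(W has_vector_derivative W') (at x)" and P: "(P has_vector_derivative P') (at x)" and nz: "P x \<noteq> 0"
  shows "((\<lambda>x. W x / P x) has_vector_derivative (W' * P x - W x * P') / (P x)\<^sup>2) (at x)"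
proof -
  have "((inverse \<circ> P) has_vector_derivative P' * - (inverse (P x) ^ Suc (Suc 0))) (at x)"
    by (rule field_vector_diff_chain_at[OF P DERIV_inverse[OF nz]])
  from has_vector_derivative_mult[OF W this]
  show ?thesis using nz by (simp add: o_def divide_inverse power2_eq_square algebra_simps)
qed

context two_pencils begin

text \<open>\<open>W / P\<close> is the difference of the logarithmic quasi-derivatives
  \<open>S1 / S\<close> of the two problems; keeping numerator and denominator apart avoids division
  at zeros of \<open>P\<close>.\<close>

definition "W \<mu> x = A.S1 \<mu> x * B.S \<mu> x - B.S1 \<mu> x * A.S \<mu> x"
definition "P \<mu> x = A.S \<mu> x * B.S \<mu> x"
definition "P' \<mu> x = (\<sigma> x + \<sigma>' x) * P \<mu> x + A.S1 \<mu> x * B.S \<mu> x + A.S \<mu> x * B.S1 \<mu> x"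
definition "W' \<mu> x = 2 * \<mu> * (q1 x - q1' x) * P \<mu> x - (\<sigma> x - \<sigma>' x) * P' \<mu> x"

lemma solution_derivatives:
  "ac_deriv (A.S \<mu>) (rhs0 \<sigma> (A.S \<mu>) (A.S1 \<mu>))"
  "ac_deriv (A.S1 \<mu>) (rhs1 \<sigma> q1 \<mu> (A.S \<mu>) (A.S1 \<mu>))"
  "ac_deriv (B.S \<mu>) (rhs0 \<sigma>' (B.S \<mu>) (B.S1 \<mu>))"
  "ac_deriv (B.S1 \<mu>) (rhs1 \<sigma>' q1' \<mu> (B.S \<mu>) (B.S1 \<mu>))"
  using A.S_solution[of \<mu>] B.S_solution[of \<mu>] by (auto simp: is_solution_iff)

lemma P_deriv: "ac_deriv (P \<mu>) (P' \<mu>)"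
  by (rule ac_deriv_cong[OF ac_deriv_mult[OF solution_derivatives(1,3)]]) (auto simp: P_def P'_def algebra_simps)

lemma W_deriv: "ac_deriv (W \<mu>) (W' \<mu>)"
  by (rule ac_deriv_cong[OF ac_deriv_diff[OF ac_deriv_mult[OF solution_derivatives(2,3)] ac_deriv_mult[OF solution_derivatives(4,1)]]])
     (auto simp: P_def P'_def W_def W'_def algebra_simps power2_eq_square)

text \<open>Equal squares have equal logarithmic derivatives, and that of \<open>S\<close> is
  \<open>\<sigma> + S1 / S\<close>; hence \<open>W / P\<close> is
  \<open>\<sigma>' - \<sigma>\<close>. Working with the squares avoids a choice of sign between the
  two solutions.\<close>

lemma W_eq_AE:
  assumes SQ: "\<And>x. x \<in> {0..pi} \<Longrightarrow> (A.S \<mu> x)\<^sup>2 = (B.S \<mu> x)\<^sup>2"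
  shows "AE x in lebesgue_on {0<..<pi}. P \<mu> x \<noteq> 0 \<longrightarrow> W \<mu> x = - (\<sigma> x - \<sigma>' x) * P \<mu> x"
proof -
  define s t where "s = A.S \<mu>" and "t = B.S \<mu>"
  note D = ac_deriv_diff[OF ac_deriv_mult[OF solution_derivatives(1)[of \<mu>] solution_derivatives(1)[of \<mu>]]
     ac_deriv_mult[OF solution_derivatives(3)[of \<mu>] solution_derivatives(3)[of \<mu>]]]
  have "ac_deriv (\<lambda>x. A.S \<mu> x * A.S \<mu> x - B.S \<mu> x * B.S \<mu> x) (\<lambda>x. 0)"
    by (rule ac_deriv_cong[OF ac_deriv_const[of 0]]) (use SQ in \<open>auto simp: power2_eq_square\<close>)
  from ac_deriv_unique_AE[OF D this]
  have "AE x in lebesgue_on {0<..<pi}. s x * (\<sigma> x * s x + A.S1 \<mu> x) + (\<sigma> x * s x + A.S1 \<mu> x) * s x - 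
    (t x * (\<sigma>' x * t x + B.S1 \<mu> x) + (\<sigma>' x * t x + B.S1 \<mu> x) * t x) = 0" unfolding s_def t_def .
  moreover have "AE x in lebesgue_on {0<..<pi}. (s x)\<^sup>2 = (t x)\<^sup>2"
    using SQ by (intro AE_I2) (auto simp: s_def t_def)
  ultimately show ?thesis
  proof eventually_elim
    case (elim x)
    define u v where "u = \<sigma> x * s x + A.S1 \<mu> x" and "v = \<sigma>' x * t x + B.S1 \<mu> x"
    have uv: "s x * u = t x * v" using elim(1) unfolding u_def[symmetric] v_def[symmetric] by (simp add: mult.commute)
    have "s x * (u * t x - s x * v) = (s x * u) * t x - (s x)\<^sup>2 * v" by (simp add: algebra_simps power2_eq_square)
    also have "\<dots> = 0" unfolding uv elim(2) by (simp add: algebra_simps power2_eq_square)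
    finally have "s x = 0 \<or> u * t x - s x * v = 0" by simp
    moreover have "u * t x - s x * v = (\<sigma> x - \<sigma>' x) * P \<mu> x + W \<mu> x"
      by (simp add: u_def v_def P_def W_def s_def t_def algebra_simps)
    ultimately have "s x = 0 \<or> W \<mu> x + (\<sigma> x - \<sigma>' x) * P \<mu> x = 0" by (simp add: add.commute)
    thus ?case by (auto simp: P_def s_def eq_neg_iff_add_eq_0 mult_minus_left simp del: minus_diff_eq)
  qed
qed

text \<open>Where \<open>P\<close> does not vanish, \<open>W / P\<close> equals
  \<open>\<sigma>' - \<sigma>\<close> almost everywhere for every \<mu>, so the quotients at two
  values of \<mu> agree. Differentiating the cross-multiplied relation isolates
  \<open>q1 - q1'\<close>, the coefficient of \<mu>. Once this vanishes, the quotient has derivative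
  0 almost everywhere, and being absolutely continuous, unlike \<sigma> itself, it is
  constant.\<close>

lemma potentials_eq_locally:
  assumes SQ: "\<And>\<mu> x. x \<in> {0..pi} \<Longrightarrow> (A.S \<mu> x)\<^sup>2 = (B.S \<mu> x)\<^sup>2" and x0: "x0 \<in> {0<..<pi}"
  shows "\<exists>e>0. \<exists>c. ball x0 e \<subseteq> {0<..<pi} \<and> negligible {x \<in> ball x0 e. q1 x \<noteq> q1' x} \<and>
     negligible {x \<in> ball x0 e. \<sigma> x - \<sigma>' x \<noteq> c}"
proof -
  have i: "cmod \<i> = 1" "Im \<i> \<noteq> 0" by auto
  have "\<forall>\<^sub>F r in at_top. A.S (of_real r * \<i>) x0 \<noteq> 0"
    by (rule A.S_nonzero_eventually[OF i]) (use x0 in auto)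
  then obtain r0 where r0: "\<And>r. r \<ge> r0 \<Longrightarrow> A.S (of_real r * \<i>) x0 \<noteq> 0" unfolding eventually_at_top_linorder by blast
  \<comment> \<open>Two points of the imaginary axis, far enough out that \<open>S\<close> does not
    vanish at \<open>x0\<close> for either of them.\<close>
  define \<mu>1 \<mu>2 where "\<mu>1 = complex_of_real r0 * \<i>" and "\<mu>2 = complex_of_real (r0 + 1) * \<i>"
  have ne: "\<mu>1 \<noteq> \<mu>2" by (simp add: \<mu>1_def \<mu>2_def)
  have Pnz: "P \<mu> x0 \<noteq> 0" if "\<mu> = \<mu>1 \<or> \<mu> = \<mu>2" for \<mu>
  proof -
    have "A.S \<mu> x0 \<noteq> 0" using that r0[of r0] r0[of "r0 + 1"] by (auto simp: \<mu>1_def \<mu>2_def)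
    moreover have "(A.S \<mu> x0)\<^sup>2 = (B.S \<mu> x0)\<^sup>2" using SQ x0 by auto
    ultimately show ?thesis by (auto simp: P_def)
  qed
  have cP: "continuous_on {0..pi} (P \<mu>)" and cW: "continuous_on {0..pi} (W \<mu>)" for \<mu>
    using ac_deriv_continuous_on P_deriv W_deriv by auto
  have "continuous_on {0<..<pi} (\<lambda>x. P \<mu>1 x * P \<mu>2 x)"
    by (intro continuous_intros continuous_on_subset[OF cP]) auto
  moreover have "open (- {0::complex})" by (simp add: open_Compl)
  ultimately have "open ({0<..<pi} \<inter> (\<lambda>x. P \<mu>1 x * P \<mu>2 x) -` (- {0}))"
    by (intro continuous_open_preimage) auto
  moreover have "x0 \<in> {0<..<pi} \<inter> (\<lambda>x. P \<mu>1 x * P \<mu>2 x) -` (- {0})" using x0 Pnz by auto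
  ultimately obtain e where e: "e > 0" "ball x0 e \<subseteq> {0<..<pi} \<inter> (\<lambda>x. P \<mu>1 x * P \<mu>2 x) -` (- {0})"
    by (meson open_contains_ball)
  define I where "I = ball x0 e"
  have I: "open I" "I \<subseteq> {0<..<pi}" and nzI: "\<And>x. x \<in> I \<Longrightarrow> P \<mu>1 x \<noteq> 0 \<and> P \<mu>2 x \<noteq> 0" using e by (auto simp: I_def)
  define G where "G \<mu> x \<longleftrightarrow> (P \<mu> has_vector_derivative P' \<mu> x) (at x) \<and> (W \<mu> has_vector_derivative W' \<mu> x) (at x) \<and>
     (P \<mu> x \<noteq> 0 \<longrightarrow> W \<mu> x = - (\<sigma> x - \<sigma>' x) * P \<mu> x)" for \<mu> x
  have all: "AE x in lebesgue_on {0<..<pi}. G \<mu> x" for \<mu>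
    using P_deriv[of \<mu>] W_deriv[of \<mu>] W_eq_AE[of \<mu>] SQ unfolding ac_deriv_def G_def by auto
  define N where "N = {x \<in> {0<..<pi}. \<not> G \<mu>1 x} \<union> {x \<in> {0<..<pi}. \<not> G \<mu>2 x}"
  have N: "negligible N" unfolding N_def
    by (intro negligible_Un) (use all[of \<mu>1] all[of \<mu>2] in \<open>simp_all add: AE_lebesgue_on_iff_negligible\<close>)
  have good: "(P \<mu> has_vector_derivative P' \<mu> x) (at x)" "(W \<mu> has_vector_derivative W' \<mu> x) (at x)" "W \<mu> x = - (\<sigma> x - \<sigma>' x) * P \<mu> x"
    if "x \<in> I" "x \<notin> N" "\<mu> = \<mu>1 \<or> \<mu> = \<mu>2" for x \<mu>
    using that nzI[OF that(1)] I(2) unfolding N_def G_def by auto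
  \<comment> \<open>The relation known off \<open>N\<close> extends to all of \<open>I\<close> by
    continuity; the differentiation below requires it in a full neighbourhood of the point.\<close>
  have cross: "W \<mu>1 x * P \<mu>2 x - W \<mu>2 x * P \<mu>1 x = 0" if x: "x \<in> I" for x
  proof (rule continuous_AE_zero_imp_zero[OF I(1) _ _ x])
    show "continuous_on I (\<lambda>x. W \<mu>1 x * P \<mu>2 x - W \<mu>2 x * P \<mu>1 x)"
      using I(2) by (intro continuous_intros continuous_on_subset[OF cP] continuous_on_subset[OF cW]) auto
    show "negligible {x \<in> I. W \<mu>1 x * P \<mu>2 x - W \<mu>2 x * P \<mu>1 x \<noteq> 0}"
    proof (rule negligible_subset[OF N], rule ccontr)
      assume "\<not> {x \<in> I. W \<mu>1 x * P \<mu>2 x - W \<mu>2 x * P \<mu>1 x \<noteq> 0} \<subseteq> N"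
      then obtain x where "x \<in> I" "x \<notin> N" "W \<mu>1 x * P \<mu>2 x - W \<mu>2 x * P \<mu>1 x \<noteq> 0" by blast
      thus False using good(3)[of x \<mu>1] good(3)[of x \<mu>2] by simp
    qed
  qed
  have q: "q1 x = q1' x" if x: "x \<in> I" "x \<notin> N" for x
  proof -
    have "((\<lambda>x. W \<mu>1 x * P \<mu>2 x - W \<mu>2 x * P \<mu>1 x) has_vector_derivative
      (W \<mu>1 x * P' \<mu>2 x + W' \<mu>1 x * P \<mu>2 x - (W \<mu>2 x * P' \<mu>1 x + W' \<mu>2 x * P \<mu>1 x))) (at x)"
      by (intro has_vector_derivative_diff has_vector_derivative_mult good x) auto
    moreover have "((\<lambda>x. W \<mu>1 x * P \<mu>2 x - W \<mu>2 x * P \<mu>1 x) has_vector_derivative 0) (at x)"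
      by (rule has_vector_derivative_transform_within_open[OF has_vector_derivative_const[of 0] I(1) x(1)]) (use cross in auto)
    ultimately have e0: "W \<mu>1 x * P' \<mu>2 x + W' \<mu>1 x * P \<mu>2 x - (W \<mu>2 x * P' \<mu>1 x + W' \<mu>2 x * P \<mu>1 x) = 0"
      by (rule vector_derivative_unique_at)
    have wd: "W \<mu>1 x = - (\<sigma> x - \<sigma>' x) * P \<mu>1 x" "W \<mu>2 x = - (\<sigma> x - \<sigma>' x) * P \<mu>2 x"
      by (rule good(3)[OF x], simp)+
    \<comment> \<open>Once \<open>W\<close> is replaced by its multiple of \<open>P\<close>, all
      terms with a derivative of \<open>P\<close> cancel, and only the difference of the two
      spectral parameters survives.\<close>
    have id: "- d * P1 * P2' + (2 * m1 * q * P1 - d * P1') * P2 - (- d * P2 * P1' + (2 * m2 * q * P2 - d * P2') * P1) =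
      2 * (m1 - m2) * q * (P1 * P2)" for d P1 P2' m1 q P1' P2 m2 :: complex by (simp add: algebra_simps)
    have "2 * (\<mu>1 - \<mu>2) * (q1 x - q1' x) * (P \<mu>1 x * P \<mu>2 x) = 0"
      using e0[unfolded W'_def wd] unfolding id .
    thus ?thesis using ne nzI[OF x(1)] by simp
  qed
  \<comment> \<open>An absolutely continuous representative of \<open>\<sigma>' - \<sigma>\<close>
    on \<open>I\<close>.\<close>
  define g where "g = (\<lambda>x. W \<mu>1 x / P \<mu>1 x)"
  have gder: "(g has_vector_derivative 0) (at x)" if x: "x \<in> I" "x \<notin> N" for x
  proof -
    have "W' \<mu>1 x * P \<mu>1 x - W \<mu>1 x * P' \<mu>1 x = 0"
      unfolding W'_def good(3)[OF x, of \<mu>1, OF disjI1[OF refl]] q[OF x] by (simp add: algebra_simps)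
    moreover have "(g has_vector_derivative (W' \<mu>1 x * P \<mu>1 x - W \<mu>1 x * P' \<mu>1 x) / (P \<mu>1 x)\<^sup>2) (at x)"
      unfolding g_def by (intro has_vector_derivative_quotient good x) (use nzI[OF x(1)] in auto)
    ultimately show ?thesis by simp
  qed
  have gle: "g a = g b" if ab: "a \<in> I" "b \<in> I" "a \<le> b" for a b
  proof -
    have sub: "{a..b} \<subseteq> I" using ab by (auto simp: I_def dist_real_def)
    have ab': "0 \<le> a" "b \<le> pi" using ab I(2) by auto
    have "abs_continuous_on_Icc a b g" unfolding g_def
      using P_deriv[of \<mu>1] W_deriv[of \<mu>1] abs_continuous_on_subinterval[OF _ ab'] nzI sub
      by (intro abs_continuous_on_quotient) (auto simp: ac_deriv_def)
    from abs_continuous_has_integral[OF ab(3) this N, of "\<lambda>x. 0"] gder sub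
    have "((\<lambda>x. 0) has_integral (g b - g a)) {a..b}" by (auto simp: subset_iff)
    thus ?thesis by (auto simp: has_integral_0_eq)
  qed
  have x0I: "x0 \<in> I" using e(1) by (simp add: I_def)
  have gconst: "g x = g x0" if "x \<in> I" for x
  proof (cases "x \<le> x0")
    case True
    show ?thesis by (rule gle[OF that x0I True])
  next
    case False
    thus ?thesis using gle[OF x0I that] by simp
  qed
  show ?thesis
  proof (intro exI[of _ e] exI[of _ "- g x0"] conjI e(1))
    show "ball x0 e \<subseteq> {0<..<pi}" using I by (simp add: I_def)
    show "negligible {x \<in> ball x0 e. q1 x \<noteq> q1' x}"
      by (rule negligible_subset[OF N]) (use q in \<open>auto simp: I_def\<close>)
    show "negligible {x \<in> ball x0 e. \<sigma> x - \<sigma>' x \<noteq> - g x0}"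
    proof (rule negligible_subset[OF N], rule ccontr)
      assume "\<not> {x \<in> ball x0 e. \<sigma> x - \<sigma>' x \<noteq> - g x0} \<subseteq> N"
      then obtain x where x: "x \<in> I" "x \<notin> N" "\<sigma> x - \<sigma>' x \<noteq> - g x0" by (auto simp: I_def)
      have "g x = - (\<sigma> x - \<sigma>' x)" using good(3)[OF x(1,2), of \<mu>1] nzI[OF x(1)] by (simp add: g_def)
      thus False using gconst[OF x(1)] x(3) by simp
    qed
  qed
qed

text \<open>Local constants on overlapping balls agree because a nonempty open set is not
  negligible; connectedness of the interval then leaves a single constant.\<close>

lemma potentials_eq:
  assumes SQ: "\<And>\<mu> x. x \<in> {0..pi} \<Longrightarrow> (A.S \<mu> x)\<^sup>2 = (B.S \<mu> x)\<^sup>2"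
  obtains c where "AE x in lebesgue_on {0<..<pi}. q1 x = q1' x" "AE x in lebesgue_on {0<..<pi}. \<sigma> x - \<sigma>' x = c"
proof -
  define Q where "Q x0 e c \<longleftrightarrow> e > 0 \<and> ball x0 e \<subseteq> {0<..<pi} \<and> negligible {x \<in> ball x0 e. q1 x \<noteq> q1' x} \<and>
     negligible {x \<in> ball x0 e. \<sigma> x - \<sigma>' x \<noteq> c}" for x0 e c
  have "\<forall>x0. \<exists>e c. x0 \<in> {0<..<pi} \<longrightarrow> Q x0 e c" using potentials_eq_locally[OF SQ] unfolding Q_def by blast
  then obtain e c where "\<And>x0. x0 \<in> {0<..<pi} \<Longrightarrow> Q x0 (e x0) (c x0)" by metis
  hence ec: "\<And>x0. x0 \<in> {0<..<pi} \<Longrightarrow> e x0 > 0 \<and> ball x0 (e x0) \<subseteq> {0<..<pi} \<and> negligible {x \<in> ball x0 (e x0). q1 x \<noteq> q1' x} \<and>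
     negligible {x \<in> ball x0 (e x0). \<sigma> x - \<sigma>' x \<noteq> c x0}" unfolding Q_def .
  have "negligible {x \<in> {0<..<pi}. \<not> q1 x = q1' x}"
  proof (rule negligible_if_locally_negligible)
    fix x assume "x \<in> {x \<in> {0<..<pi}. \<not> q1 x = q1' x}"
    hence x: "x \<in> {0<..<pi}" by simp
    show "\<exists>U. open U \<and> x \<in> U \<and> negligible ({x \<in> {0<..<pi}. \<not> q1 x = q1' x} \<inter> U)"
      using ec[OF x] by (intro exI[of _ "ball x (e x)"]) (auto intro: negligible_subset[of "{y \<in> ball x (e x). q1 y \<noteq> q1' y}"])
  qed
  hence 1: "AE x in lebesgue_on {0<..<pi}. q1 x = q1' x" by (simp add: AE_lebesgue_on_iff_negligible)
  have cc: "c x = c y" if x: "x \<in> {0<..<pi}" and y: "y \<in> ball x (e x)" for x y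
  proof (rule ccontr)
    assume ne: "c x \<noteq> c y"
    have y': "y \<in> {0<..<pi}" using y ec[OF x] by blast
    have "ball x (e x) \<inter> ball y (e y) \<subseteq> {z \<in> ball x (e x). \<sigma> z - \<sigma>' z \<noteq> c x} \<union> {z \<in> ball y (e y). \<sigma> z - \<sigma>' z \<noteq> c y}"
      using ne by auto
    moreover have "negligible ({z \<in> ball x (e x). \<sigma> z - \<sigma>' z \<noteq> c x} \<union> {z \<in> ball y (e y). \<sigma> z - \<sigma>' z \<noteq> c y})"
      using ec[OF x] ec[OF y'] by (intro negligible_Un) auto
    ultimately have "negligible (ball x (e x) \<inter> ball y (e y))" using negligible_subset by blast
    moreover have "open (ball x (e x) \<inter> ball y (e y))" by auto
    moreover have "y \<in> ball x (e x) \<inter> ball y (e y)" using y ec[OF y'] by auto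
    ultimately show False using open_not_negligible by blast
  qed
  have const: "c x = c (pi/2)" if x: "x \<in> {0<..<pi}" for x
  proof (rule connected_local_const[of "{0<..<pi}"])
    show "connected {0<..<pi}" by simp
    show "pi / 2 \<in> {0<..<pi}" using pi_gt_zero by simp
    show "\<forall>a\<in>{0<..<pi}. eventually (\<lambda>b. c a = c b) (at a within {0<..<pi})"
    proof
      fix a :: real assume a: "a \<in> {0<..<pi}"
      show "eventually (\<lambda>b. c a = c b) (at a within {0<..<pi})"
        unfolding eventually_at_topological using ec[OF a] cc[OF a] by (intro exI[of _ "ball a (e a)"]) auto
    qed
  qed (rule x)
  have "negligible {x \<in> {0<..<pi}. \<not> \<sigma> x - \<sigma>' x = c (pi/2)}"
  proof (rule negligible_if_locally_negligible)
    fix x assume "x \<in> {x \<in> {0<..<pi}. \<not> \<sigma> x - \<sigma>' x = c (pi/2)}"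
    hence x: "x \<in> {0<..<pi}" by simp
    show "\<exists>U. open U \<and> x \<in> U \<and> negligible ({x \<in> {0<..<pi}. \<not> \<sigma> x - \<sigma>' x = c (pi/2)} \<inter> U)"
      using ec[OF x] const[OF x] by (intro exI[of _ "ball x (e x)"]) (auto intro: negligible_subset[of "{y \<in> ball x (e x). \<sigma> y - \<sigma>' y \<noteq> c x}"])
  qed
  hence 2: "AE x in lebesgue_on {0<..<pi}. \<sigma> x - \<sigma>' x = c (pi/2)" by (simp add: AE_lebesgue_on_iff_negligible)
  show ?thesis by (rule that[OF 1 2])
qed

end

section \<open>From primitives to distributions\<close>

lemma test_function_derivative:
  assumes "\<phi> \<in> test_functions"
  shows "continuous_on UNIV (\<lambda>x. vector_derivative \<phi> (at x))"
    "(LINT x|lebesgue_on {0<..<pi}. vector_derivative \<phi> (at x)) = 0"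
proof -
  have d0: "\<phi> differentiable (at x)" and d1: "(\<lambda>t. vector_derivative \<phi> (at t)) differentiable (at x)" for x
  proof -
    have "\<forall>k x. (((\<lambda>g t. vector_derivative g (at t)) ^^ k) \<phi>) differentiable (at x)" using assms by (simp add: test_functions_def)
    from this[rule_format, of 0 x] this[rule_format, of 1 x]
    show "\<phi> differentiable (at x)" "(\<lambda>t. vector_derivative \<phi> (at t)) differentiable (at x)" by simp_all
  qed
  show c: "continuous_on UNIV (\<lambda>x. vector_derivative \<phi> (at x))"
    using d1 by (simp add: continuous_on_eq_continuous_at differentiable_imp_continuous_within)
  obtain a b where ab: "0 < a" "a < b" "b < pi" "\<And>x. x \<notin> {a..b} \<Longrightarrow> \<phi> x = 0" using assms by (auto simp: test_functions_def)
  have "((\<lambda>x. vector_derivative \<phi> (at x)) has_integral (\<phi> pi - \<phi> 0)) {0..pi}"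
    by (rule fundamental_theorem_of_calculus)
       (use d0 in \<open>auto simp: vector_derivative_works intro: has_vector_derivative_at_within\<close>)
  hence "((\<lambda>x. vector_derivative \<phi> (at x)) has_integral 0) {0..pi}" using ab by simp
  hence i: "((\<lambda>x. vector_derivative \<phi> (at x)) has_integral 0) {0<..<pi}"
    using has_integral_open_interval[of "\<lambda>x. vector_derivative \<phi> (at x)" 0 0 pi] by (simp add: box_real)
  have "(\<lambda>x. vector_derivative \<phi> (at x)) absolutely_integrable_on {0..pi}"
    by (rule absolutely_integrable_continuous_real) (rule continuous_on_subset[OF c], simp)
  hence "(\<lambda>x. vector_derivative \<phi> (at x)) absolutely_integrable_on {0<..<pi}"
    using absolutely_integrable_on_open_interval[of "0::real" pi] unfolding box_real by blast
  from set_lebesgue_integral_eq_integral(2)[OF this] integral_unique[OF i]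
  show "(LINT x|lebesgue_on {0<..<pi}. vector_derivative \<phi> (at x)) = 0"
    by (simp add: set_lebesgue_integral_def integral_restrict_space)
qed

text \<open>A constant pairs to 0 with the derivative of a test function, because test functions
  vanish at both endpoints.\<close>

lemma distr_deriv_eq_if_const_diff:
  assumes s: "\<sigma> \<in> L2_0pi" and s': "\<sigma>' \<in> L2_0pi" and ae: "AE x in lebesgue_on {0<..<pi}. \<sigma> x - \<sigma>' x = c"
  shows "distr_eq (distr_deriv \<sigma>) (distr_deriv \<sigma>')"
  unfolding distr_eq_def
proof
  fix \<phi> assume \<phi>: "\<phi> \<in> test_functions"
  define d where "d = (\<lambda>x. vector_derivative \<phi> (at x))"
  have cd: "continuous_on {0..pi} d" unfolding d_def using test_function_derivative(1)[OF \<phi>] continuous_on_subset by blast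
  have int: "integrable (lebesgue_on {0<..<pi}) (\<lambda>x. u x * d x)" if "u absolutely_integrable_on {0..pi}" for u
  proof -
    have "(\<lambda>x. u x * d x) absolutely_integrable_on {0..pi}" by (rule absolutely_integrable_mult_continuous[OF that cd])
    hence "(\<lambda>x. u x * d x) absolutely_integrable_on {0<..<pi}"
      using absolutely_integrable_on_open_interval[of "0::real" pi] unfolding box_real by blast
    thus ?thesis by (simp add: set_integrable_def integrable_restrict_space)
  qed
  note i1 = int[OF L2_0pi_integrable(1)[OF s]] and i2 = int[OF L2_0pi_integrable(1)[OF s']]
  have ic: "integrable (lebesgue_on {0<..<pi}) (\<lambda>x. c * d x)"
    by (rule int, rule absolutely_integrable_continuous_real) simp
  have "(LINT x|lebesgue_on {0<..<pi}. \<sigma> x * d x) = (LINT x|lebesgue_on {0<..<pi}. \<sigma>' x * d x + c * d x)"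
  proof (rule integral_cong_AE)
    show "(\<lambda>x. \<sigma> x * d x) \<in> borel_measurable (lebesgue_on {0<..<pi})" using i1 by (rule borel_measurable_integrable)
    show "(\<lambda>x. \<sigma>' x * d x + c * d x) \<in> borel_measurable (lebesgue_on {0<..<pi})"
      by (rule borel_measurable_integrable[OF Bochner_Integration.integrable_add[OF i2 ic]])
    show "AE x in lebesgue_on {0<..<pi}. \<sigma> x * d x = \<sigma>' x * d x + c * d x"
      using ae
    proof eventually_elim
      case (elim x)
      hence "\<sigma> x = \<sigma>' x + c" by (metis add.commute diff_add_cancel)
      thus ?case by (simp add: distrib_right)
    qed
  qed
  also have "\<dots> = (LINT x|lebesgue_on {0<..<pi}. \<sigma>' x * d x) + c * (LINT x|lebesgue_on {0<..<pi}. d x)"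
    by (subst Bochner_Integration.integral_add[OF i2 ic]) simp
  also have "(LINT x|lebesgue_on {0<..<pi}. d x) = 0" unfolding d_def by (rule test_function_derivative(2)[OF \<phi>])
  finally show "distr_deriv \<sigma> \<phi> = distr_deriv \<sigma>' \<phi>" by (simp add: distr_deriv_def d_def)
qed

theorem theorem2p9:
  fixes q0 q0' :: distribution and q1 q1' :: "real \<Rightarrow> complex"
    and lam lam' M M' :: "int \<Rightarrow> complex"
  assumes "q0 \<in> W2_minus1" and "q0' \<in> W2_minus1"
    and "q1 \<in> L2_0pi" and "q1' \<in> L2_0pi"
    and "spectral_data q0 q1 lam M" and "spectral_data q0' q1' lam' M'"
    and "\<And>n. n \<in> Z0 \<Longrightarrow> lam n = lam' n" and "\<And>n. n \<in> Z0 \<Longrightarrow> M n = M' n"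
  shows "distr_eq q0 q0' \<and> (AE x in lebesgue_on {0<..<pi}. q1 x = q1' x)"
proof -
  obtain \<sigma> where \<sigma>: "\<sigma> \<in> L2_0pi" "distr_eq q0 (distr_deriv \<sigma>)" and sd: "eigenvalue_sequence \<sigma> q1 lam" "assumption_O lam" "weight_sequence \<sigma> q1 lam M"
    using assms(5) unfolding spectral_data_def by blast
  obtain \<sigma>' where \<sigma>': "\<sigma>' \<in> L2_0pi" "distr_eq q0' (distr_deriv \<sigma>')" and sd': "eigenvalue_sequence \<sigma>' q1' lam'" "weight_sequence \<sigma>' q1' lam' M'"
    using assms(6) unfolding spectral_data_def by blast
  interpret two_pencils \<sigma> q1 \<sigma>' q1'
    by unfold_locales (use \<sigma> \<sigma>' assms in auto)
  obtain h where h: "h holomorphic_on UNIV" "growth32 h"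
    "\<And>\<mu>. A.S \<mu> pi \<noteq> 0 \<Longrightarrow> B.S \<mu> pi \<noteq> 0 \<Longrightarrow> h \<mu> = A.C \<mu> pi / A.S \<mu> pi - B.C \<mu> pi / B.S \<mu> pi"
    using Weyl_difference_entire[OF sd(1) sd'(1) sd(2,3) sd'(2) assms(7,8)] by blast
  have SQ: "(A.S \<mu> x)\<^sup>2 = (B.S \<mu> x)\<^sup>2" if "x \<in> {0..pi}" for \<mu> x
    using S_squares_eq[of \<mu> "h \<mu>", OF _ that] mapping_function_zero[OF h] by blast
  obtain c where c: "AE x in lebesgue_on {0<..<pi}. q1 x = q1' x" "AE x in lebesgue_on {0<..<pi}. \<sigma> x - \<sigma>' x = c"
    using potentials_eq[OF SQ] by blast
  have "distr_eq (distr_deriv \<sigma>) (distr_deriv \<sigma>')" by (rule distr_deriv_eq_if_const_diff[OF \<sigma>(1) \<sigma>'(1) c(2)])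
  hence "distr_eq q0 q0'" using \<sigma>(2) \<sigma>'(2) unfolding distr_eq_def by simp
  thus ?thesis using c(1) by simp
qed

end
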